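(* Let $\nu>0$ and let $\mathcal{X}_h=\mathcal{X}_{CR}=\mathbf{X}_{0,CR}\times Q_{CR}$ be the lowest-order Crouzeix–Raviart mixed finite element space on $\mathcal{T}_h$. Then the continuous bilinear form $a_{S,h}(\cdot,\cdot)$ on $\mathcal{X}_h\times\mathcal{X}_h$ is $T_h$-coercive, and the problem: find $(\mathbf{u}_h,p_h)\in\mathcal{X}_h$ such that $$a_{S,h}\big((\mathbf{u}_h,p_h),(\mathbf{v}_h,q_h)\big)=\ell_{\mathbf{f}}\big((\mathbf{v}_h,q_h)\big)\qquad\forall(\mathbf{v}_h,q_h)\in\mathcal{X}_h$$ is well-posed.
   Context: $\Omega\subset\mathbb{R}^d$, $d\in\{2,3\}$, is a connected bounded domain with polygonal ($d=2$) or Lipschitz polyhedral ($d=3$) boundary, and $\mathcal{T}_h$ is a simplicial triangulation of $\Omega$ with elements $K$ and facets $F$ (edges if $d=2$, faces if $d=3$). $\mathbf{L}^2(\Omega)=L^2(\Omega)^d$, $\mathbf{H}^1_0(\Omega)=H^1_0(\Omega)^d$, $\mathbf{H}^{-1}(\Omega)$ is the dual of $\mathbf{H}^1_0(\Omega)$, and $L^2_{zmv}(\Omega)=\{q\in L^2(\Omega):\int_\Omega q=0\}$. $P^m_{disc}(\mathcal{T}_h)$ is the space of $q\in L^2(\Omega)$ with $q_{|K}\in P^m(K)$ for every $K$; $[v]$ is the jump across a facet. $$X_{CR}=\Big\{v_h\in P^1_{disc}(\mathcal{T}_h):\int_F[v_h]=0\ \text{for every interior facet }F\Big\},$$ $$X_{0,CR}=\Big\{v_h\in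 X_{CR}:\int_Fv_h=0\ \text{for every boundary facet }F\Big\},$$ $\mathbf{X}_{0,CR}=(X_{0,CR})^d$ and $Q_{CR}=P^0_{disc}(\mathcal{T}_h)\cap L^2_{zmv}(\Omega)$. With $\mathbf{Grad}\,\mathbf{v}=(\partial_jv_i)_{i,j}$, set $(\mathbf{v},\mathbf{w})_h=\sum_K\int_K\mathbf{Grad}\,\mathbf{v}:\mathbf{Grad}\,\mathbf{w}$, $\|\mathbf{v}\|_h^2=(\mathbf{v},\mathbf{v})_h$, $(\mathrm{div}_h\mathbf{v},q)=\sum_K\int_K q\,\mathrm{div}\,\mathbf{v}$. The norm on $\mathcal{X}_h$ is $\|(\mathbf{v}_h,q_h)\|_{\mathcal{X}_h}=\|\mathbf{v}_h\|_h+\nu^{-1}\|q_h\|_{L^2(\Omega)}$, and $$a_{S,h}\big((\mathbf{u}'_h,p'_h),(\mathbf{v}_h,q_h)\big)=\nu(\mathbf{u}'_h,\mathbf{v}_h)_h-(p'_h,\mathrm{div}_h\mathbf{v}_h)-(q_h,\mathrm{div}_h\mathbf{u}'_h).$$ For $\mathbf{f}\in\mathbf{H}^{-1}(\Omega)$: $\ell_{\mathbf{f}}((\mathbf{v}_h,q_h))=(\mathbf{f},\mathbf{v}_h)_{\mathbf{L}^2(\Omega)}$ if $\mathbf{f}\in\mathbf{L}^2(\Omega)$, and $\ell_{\mathbf{f}}((\mathbf{v}_h,q_h))=\langle\mathbf{f},\mathcal{I}_h(\mathbf{v}_h)\rangle_{\mathbf{H}^1_0(\Omega)}$ otherwise,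 where $\mathcal{I}_h$ is the linear averaging operator from $\mathbf{X}_{0,CR}$ to the continuous piecewise $P^1$ vector fields vanishing on $\partial\Omega$ (value at each interior vertex: mean of the values at this vertex of $\mathbf{v}_{h|K}$ over all elements $K$ containing it; value $0$ at boundary vertices). $T_h$-coercive (for the symmetric form $a_{S,h}$) means: there exist a continuous linear operator $T_h:\mathcal{X}_h\to\mathcal{X}_h$ and $\alpha>0$ such that $|a_{S,h}(x,T_hx)|\ge\alpha\|x\|_{\mathcal{X}_h}^2$ for all $x\in\mathcal{X}_h$. Well-posed means: for every continuous linear form on $\mathcal{X}_h$ as right-hand side there is exactly one solution, and it depends continuously on the right-hand side. *)

theory Defs
  imports "HOL-Analysis.Analysis"
begin

section \<open>Domains and meshes\<close>

definition lipschitz_boundary :: "(real^'n) set \<Rightarrow> bool" where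
  "lipschitz_boundary \<Omega> \<longleftrightarrow>
     (\<forall>x\<in>frontier \<Omega>. \<exists>U e \<gamma> L.
        open U \<and> x \<in> U \<and> norm e = 1 \<and> L-lipschitz_on {z. e \<bullet> z = 0} \<gamma> \<and>
        \<Omega> \<inter> U = {y \<in> U. e \<bullet> y < \<gamma> (y - (e \<bullet> y) *\<^sub>R e)})"

text \<open>The boundary is a finite union of nondegenerate segments (dimension 2) or of
  two-dimensional convex polygons (dimension 3).\<close>

definition polyhedral_boundary :: "(real^'n) set \<Rightarrow> bool" where
  "polyhedral_boundary \<Omega> \<longleftrightarrow>
     (\<exists>\<P>. finite \<P> \<and> (\<forall>P\<in>\<P>. polytope P \<and> aff_dim P = int CARD('n) - 1) \<and>
          frontier \<Omega> = \<Union>\<P>)"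

text \<open>In dimension 2 the boundary is only required to be polygonal; the Lipschitz condition
  is imposed in dimension 3.\<close>

definition admissible_domain :: "(real^'n) set \<Rightarrow> bool" where
  "admissible_domain \<Omega> \<longleftrightarrow>
     open \<Omega> \<and> connected \<Omega> \<and> bounded \<Omega> \<and> \<Omega> \<noteq> {} \<and> polyhedral_boundary \<Omega> \<and>
     (CARD('n) = 3 \<longrightarrow> lipschitz_boundary \<Omega>)"

definition mesh_facets :: "(real^'n) set set \<Rightarrow> (real^'n) set set" where
  "mesh_facets \<T> = {F. \<exists>K\<in>\<T>. F facet_of K}"

definition boundary_facets :: "(real^'n) set \<Rightarrow> (real^'n) set set \<Rightarrow> (real^'n) set set" where
  "boundary_facets \<Omega> \<T> = {F \<in> mesh_facets \<T>. F \<subseteq> frontier \<Omega>}"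

definition interior_facets :: "(real^'n) set \<Rightarrow> (real^'n) set set \<Rightarrow> (real^'n) set set" where
  "interior_facets \<Omega> \<T> = mesh_facets \<T> - boundary_facets \<Omega> \<T>"

definition mesh_vertices :: "(real^'n) set set \<Rightarrow> (real^'n) set" where
  "mesh_vertices \<T> = {a. \<exists>K\<in>\<T>. a extreme_point_of K}"

text \<open>The last condition says that the mesh resolves the boundary. For Lipschitz domains it
  follows from the others; it matters for plane domains with slits, where the
  closure does not determine the domain.\<close>

definition simplicial_mesh :: "(real^'n) set \<Rightarrow> (real^'n) set set \<Rightarrow> bool" where
  "simplicial_mesh \<Omega> \<T> \<longleftrightarrow>
     triangulation \<T> \<and> (\<forall>K\<in>\<T>. (int CARD('n)) simplex K) \<and> \<Union>\<T> = closure \<Omega> \<and>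
     frontier \<Omega> = \<Union>(boundary_facets \<Omega> \<T>)"


section \<open>Function spaces on the domain\<close>

text \<open>Elements of the spaces are functions on the whole space; for the spaces in this section
  only their values on \<open>\<Omega>\<close>, up to null sets, are relevant.\<close>

definition L2 :: "(real^'n) set \<Rightarrow> (real^'n \<Rightarrow> real) set" where
  "L2 \<Omega> = {g. g \<in> borel_measurable (lebesgue_on \<Omega>) \<and>
              integrable (lebesgue_on \<Omega>) (\<lambda>x. (g x)\<^sup>2)}"

definition L2_inner :: "(real^'n) set \<Rightarrow> (real^'n \<Rightarrow> real) \<Rightarrow> (real^'n \<Rightarrow> real) \<Rightarrow> real" where
  "L2_inner \<Omega> f g = (\<integral>x. f x * g x \<partial>lebesgue_on \<Omega>)"

definition L2_norm :: "(real^'n) set \<Rightarrow> (real^'n \<Rightarrow> real) \<Rightarrow> real" where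
  "L2_norm \<Omega> g = sqrt (L2_inner \<Omega> g g)"

definition L2_zmv :: "(real^'n) set \<Rightarrow> (real^'n \<Rightarrow> real) set" where
  "L2_zmv \<Omega> = {q \<in> L2 \<Omega>. (\<integral>x. q x \<partial>lebesgue_on \<Omega>) = 0}"

text \<open>The product space \<open>V\<^sup>d\<close> of vector fields with all components in \<open>V\<close>.\<close>

definition vec_space :: "(real^'n \<Rightarrow> real) set \<Rightarrow> (real^'n \<Rightarrow> real^'n) set" where
  "vec_space V = {v. \<forall>i. (\<lambda>x. v x $ i) \<in> V}"

definition L2_inner_vec ::
    "(real^'n) set \<Rightarrow> (real^'n \<Rightarrow> real^'n) \<Rightarrow> (real^'n \<Rightarrow> real^'n) \<Rightarrow> real" where
  "L2_inner_vec \<Omega> f g = (\<integral>x. f x \<bullet> g x \<partial>lebesgue_on \<Omega>)"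

definition pderiv_at :: "'n \<Rightarrow> (real^'n \<Rightarrow> real) \<Rightarrow> real^'n \<Rightarrow> real" where
  "pderiv_at j g x = frechet_derivative g (at x) (axis j 1)"

primrec Ck :: "nat \<Rightarrow> (real^'n \<Rightarrow> real) \<Rightarrow> bool" where
  "Ck 0 g \<longleftrightarrow> continuous_on UNIV g"
| "Ck (Suc k) g \<longleftrightarrow> (\<forall>x. g differentiable (at x)) \<and> (\<forall>j. Ck k (pderiv_at j g))"

definition test_functions :: "(real^'n) set \<Rightarrow> (real^'n \<Rightarrow> real) set" where
  "test_functions \<Omega> = {\<phi>. (\<forall>k. Ck k \<phi>) \<and> compact (closure {x. \<phi> x \<noteq> 0}) \<and>
                        closure {x. \<phi> x \<noteq> 0} \<subseteq> \<Omega>}"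

definition weak_gradient ::
    "(real^'n) set \<Rightarrow> (real^'n \<Rightarrow> real) \<Rightarrow> (real^'n \<Rightarrow> real^'n) \<Rightarrow> bool" where
  "weak_gradient \<Omega> u g \<longleftrightarrow>
     g \<in> vec_space (L2 \<Omega>) \<and>
     (\<forall>\<phi>\<in>test_functions \<Omega>. \<forall>j.
        L2_inner \<Omega> u (pderiv_at j \<phi>) = - L2_inner \<Omega> (\<lambda>x. g x $ j) \<phi>)"

text \<open>The norm of \<open>H\<^sup>1(\<Omega>)\<close>, for a function given together with its gradient.\<close>

definition H1_norm ::
    "(real^'n) set \<Rightarrow> (real^'n \<Rightarrow> real) \<Rightarrow> (real^'n \<Rightarrow> real^'n) \<Rightarrow> real" where
  "H1_norm \<Omega> u g = sqrt ((L2_norm \<Omega> u)\<^sup>2 + (\<Sum>j\<in>UNIV. (L2_norm \<Omega> (\<lambda>x. g x $ j))\<^sup>2))"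

definition H10 :: "(real^'n) set \<Rightarrow> (real^'n \<Rightarrow> real) set" where
  "H10 \<Omega> = {u \<in> L2 \<Omega>. \<exists>g. weak_gradient \<Omega> u g \<and>
     (\<exists>\<phi>. (\<forall>n::nat. \<phi> n \<in> test_functions \<Omega>) \<and>
          (\<lambda>n. H1_norm \<Omega> (\<lambda>x. u x - \<phi> n x) (\<lambda>x. g x - (\<chi> j. pderiv_at j (\<phi> n) x)))
            \<longlonglongrightarrow> 0)}"

text \<open>The dual of \<open>H\<^sup>1\<^sub>0(\<Omega>)\<^sup>d\<close>. Boundedness makes these functionals insensitive to
  changes on null sets and to values outside \<open>\<Omega>\<close>.\<close>

definition Hminus1 :: "(real^'n) set \<Rightarrow> ((real^'n \<Rightarrow> real^'n) \<Rightarrow> real) set" where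
  "Hminus1 \<Omega> = {f.
     (\<forall>v\<in>vec_space (H10 \<Omega>). \<forall>w\<in>vec_space (H10 \<Omega>). \<forall>a b.
        f (\<lambda>x. a *\<^sub>R v x + b *\<^sub>R w x) = a * f v + b * f w) \<and>
     (\<exists>C. \<forall>v\<in>vec_space (H10 \<Omega>). \<forall>G. (\<forall>i. weak_gradient \<Omega> (\<lambda>x. v x $ i) (G i)) \<longrightarrow>
        \<bar>f v\<bar> \<le> C * sqrt (\<Sum>i\<in>UNIV. (H1_norm \<Omega> (\<lambda>x. v x $ i) (G i))\<^sup>2))}"

text \<open>\<open>g \<in> L\<^sup>2(\<Omega>)\<^sup>d\<close> represents the functional \<open>f\<close>; such a \<open>g\<close> is unique almost everywhere.\<close>

definition L2_represents ::
    "(real^'n) set \<Rightarrow> (real^'n \<Rightarrow> real^'n) \<Rightarrow> ((real^'n \<Rightarrow> real^'n) \<Rightarrow> real) \<Rightarrow> bool" where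
  "L2_represents \<Omega> g f \<longleftrightarrow>
     g \<in> vec_space (L2 \<Omega>) \<and> (\<forall>v\<in>vec_space (H10 \<Omega>). f v = L2_inner_vec \<Omega> g v)"


section \<open>Crouzeix--Raviart spaces\<close>

definition poly_space :: "nat \<Rightarrow> (real^'n \<Rightarrow> real) set" where
  "poly_space m = {p. \<exists>c. \<forall>x. p x =
     (\<Sum>\<alpha> | (\<Sum>i\<in>UNIV. \<alpha> i) \<le> m. c \<alpha> * (\<Prod>i\<in>UNIV. (x $ i) ^ \<alpha> i))}"

text \<open>Broken polynomials, as elements of \<open>L\<^sup>2(\<Omega>)\<close>. Of each class modulo null sets only the
  representative vanishing off the open elements is kept, so that equality of functions is
  equality in \<open>L\<^sup>2(\<Omega>)\<close>.\<close>

definition P_disc :: "(real^'n) set \<Rightarrow> (real^'n) set set \<Rightarrow> nat \<Rightarrow> (real^'n \<Rightarrow> real) set" where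
  "P_disc \<Omega> \<T> m = {q \<in> L2 \<Omega>.
     (\<forall>K\<in>\<T>. \<exists>p\<in>poly_space m. \<forall>x\<in>interior K. q x = p x) \<and>
     (\<forall>x. x \<notin> (\<Union>K\<in>\<T>. interior K) \<longrightarrow> q x = 0)}"

text \<open>The restriction of a broken \<open>P\<^sup>1\<close> function to the closed element \<open>K\<close>, as the polynomial it
  is there (so that it has values on the facets of \<open>K\<close>).\<close>

definition on_elem :: "(real^'n \<Rightarrow> real) \<Rightarrow> (real^'n) set \<Rightarrow> real^'n \<Rightarrow> real" where
  "on_elem v K = (THE p. p \<in> poly_space 1 \<and> (\<forall>x\<in>interior K. p x = v x))"

text \<open>The surface integral over a flat \<open>(d-1)\<close>-dimensional set \<open>F\<close>. The library has no surface
  measure, so the integrand is extended constantly in the direction of a unit normal \<open>n\<close> and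
  integrated over the right prism of height 1 over \<open>F\<close>; by Fubini this is the integral with
  respect to the \<open>(d-1)\<close>-dimensional Lebesgue measure on the hyperplane through \<open>F\<close>.\<close>

definition unit_normal :: "(real^'n) set \<Rightarrow> real^'n" where
  "unit_normal F = (SOME n. norm n = 1 \<and> (\<forall>x\<in>F. \<forall>y\<in>F. n \<bullet> (x - y) = 0))"

definition facet_integral :: "(real^'n) set \<Rightarrow> (real^'n \<Rightarrow> real) \<Rightarrow> real" where
  "facet_integral F g = (let n = unit_normal F; a = (SOME a. a \<in> F) in
     \<integral>x. g (x - (n \<bullet> (x - a)) *\<^sub>R n)
       \<partial>lebesgue_on {y + t *\<^sub>R n | y t. y \<in> F \<and> 0 \<le> t \<and> t \<le> 1})"

text \<open>Both orientations of the jump are covered by quantifying over ordered pairs.\<close>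

definition X_CR :: "(real^'n) set \<Rightarrow> (real^'n) set set \<Rightarrow> (real^'n \<Rightarrow> real) set" where
  "X_CR \<Omega> \<T> = {v \<in> P_disc \<Omega> \<T> 1.
     \<forall>F\<in>interior_facets \<Omega> \<T>. \<forall>K\<in>\<T>. \<forall>K'\<in>\<T>. K \<noteq> K' \<and> F facet_of K \<and> F facet_of K' \<longrightarrow>
       facet_integral F (\<lambda>x. on_elem v K x - on_elem v K' x) = 0}"

definition X0_CR :: "(real^'n) set \<Rightarrow> (real^'n) set set \<Rightarrow> (real^'n \<Rightarrow> real) set" where
  "X0_CR \<Omega> \<T> = {v \<in> X_CR \<Omega> \<T>.
     \<forall>F\<in>boundary_facets \<Omega> \<T>. \<forall>K\<in>\<T>. F facet_of K \<longrightarrow> facet_integral F (on_elem v K) = 0}"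

definition Q_CR :: "(real^'n) set \<Rightarrow> (real^'n) set set \<Rightarrow> (real^'n \<Rightarrow> real) set" where
  "Q_CR \<Omega> \<T> = P_disc \<Omega> \<T> 0 \<inter> L2_zmv \<Omega>"

type_synonym 'n mixed = "(real^'n \<Rightarrow> real^'n) \<times> (real^'n \<Rightarrow> real)"

definition CR_space :: "(real^'n) set \<Rightarrow> (real^'n) set set \<Rightarrow> ('n::finite) mixed set" where
  "CR_space \<Omega> \<T> = vec_space (X0_CR \<Omega> \<T>) \<times> Q_CR \<Omega> \<T>"

definition broken_pd ::
    "(real^'n \<Rightarrow> real^'n) \<Rightarrow> (real^'n) set \<Rightarrow> 'n \<Rightarrow> 'n \<Rightarrow> real^'n \<Rightarrow> real" where
  "broken_pd v K i j = pderiv_at j (on_elem (\<lambda>x. v x $ i) K)"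

definition h_inner ::
    "(real^'n) set set \<Rightarrow> (real^'n \<Rightarrow> real^'n) \<Rightarrow> (real^'n \<Rightarrow> real^'n) \<Rightarrow> real" where
  "h_inner \<T> v w = (\<Sum>K\<in>\<T>. \<integral>x. (\<Sum>i\<in>UNIV. \<Sum>j\<in>UNIV. broken_pd v K i j x * broken_pd w K i j x)
                        \<partial>lebesgue_on K)"

definition h_norm :: "(real^'n) set set \<Rightarrow> (real^'n \<Rightarrow> real^'n) \<Rightarrow> real" where
  "h_norm \<T> v = sqrt (h_inner \<T> v v)"

definition div_h ::
    "(real^'n) set set \<Rightarrow> (real^'n \<Rightarrow> real^'n) \<Rightarrow> (real^'n \<Rightarrow> real) \<Rightarrow> real" where
  "div_h \<T> v q = (\<Sum>K\<in>\<T>. \<integral>x. q x * (\<Sum>i\<in>UNIV. broken_pd v K i i x) \<partial>lebesgue_on K)"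

definition CR_norm :: "real \<Rightarrow> (real^'n) set \<Rightarrow> (real^'n) set set \<Rightarrow> ('n::finite) mixed \<Rightarrow> real" where
  "CR_norm \<nu> \<Omega> \<T> x = h_norm \<T> (fst x) + inverse \<nu> * L2_norm \<Omega> (snd x)"

definition a_S :: "real \<Rightarrow> (real^'n) set set \<Rightarrow> ('n::finite) mixed \<Rightarrow> ('n::finite) mixed \<Rightarrow> real" where
  "a_S \<nu> \<T> x y = \<nu> * h_inner \<T> (fst x) (fst y)
                  - div_h \<T> (fst y) (snd x) - div_h \<T> (fst x) (snd y)"


section \<open>The right-hand side\<close>

definition P1_cont_0 :: "(real^'n) set \<Rightarrow> (real^'n) set set \<Rightarrow> (real^'n \<Rightarrow> real) set" where
  "P1_cont_0 \<Omega> \<T> = {w. continuous_on (closure \<Omega>) w \<and>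
     (\<forall>K\<in>\<T>. \<exists>p\<in>poly_space 1. \<forall>x\<in>K. w x = p x) \<and> (\<forall>x. x \<notin> \<Omega> \<longrightarrow> w x = 0)}"

definition vertex_mean ::
    "(real^'n) set set \<Rightarrow> (real^'n \<Rightarrow> real^'n) \<Rightarrow> real^'n \<Rightarrow> real^'n" where
  "vertex_mean \<T> v a = inverse (real (card {K\<in>\<T>. a \<in> K})) *\<^sub>R
     (\<Sum>K | K \<in> \<T> \<and> a \<in> K. \<chi> i. on_elem (\<lambda>x. v x $ i) K a)"

definition averaging ::
    "(real^'n) set \<Rightarrow> (real^'n) set set \<Rightarrow> (real^'n \<Rightarrow> real^'n) \<Rightarrow> real^'n \<Rightarrow> real^'n" where
  "averaging \<Omega> \<T> v = (THE w. w \<in> vec_space (P1_cont_0 \<Omega> \<T>) \<and>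
     (\<forall>a\<in>mesh_vertices \<T> \<inter> \<Omega>. w a = vertex_mean \<T> v a))"

definition rhs_form ::
    "(real^'n) set \<Rightarrow> (real^'n) set set \<Rightarrow> ((real^'n \<Rightarrow> real^'n) \<Rightarrow> real) \<Rightarrow> ('n::finite) mixed \<Rightarrow> real" where
  "rhs_form \<Omega> \<T> f y =
     (if \<exists>g. L2_represents \<Omega> g f
      then L2_inner_vec \<Omega> (SOME g. L2_represents \<Omega> g f) (fst y)
      else f (averaging \<Omega> \<T> (fst y)))"


section \<open>Linear problems on a normed space of pairs of functions\<close>

definition lincomb :: "real \<Rightarrow> ('n::finite) mixed \<Rightarrow> real \<Rightarrow> ('n::finite) mixed \<Rightarrow> ('n::finite) mixed" where
  "lincomb s x t y = ((\<lambda>z. s *\<^sub>R fst x z + t *\<^sub>R fst y z), (\<lambda>z. s * snd x z + t * snd y z))"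

definition linear_form_on :: "('n::finite) mixed set \<Rightarrow> (('n::finite) mixed \<Rightarrow> real) \<Rightarrow> bool" where
  "linear_form_on X l \<longleftrightarrow>
     (\<forall>x\<in>X. \<forall>y\<in>X. \<forall>s t. l (lincomb s x t y) = s * l x + t * l y)"

definition continuous_linear_form ::
    "('n::finite) mixed set \<Rightarrow> (('n::finite) mixed \<Rightarrow> real) \<Rightarrow> (('n::finite) mixed \<Rightarrow> real) \<Rightarrow> bool" where
  "continuous_linear_form X nrm l \<longleftrightarrow>
     linear_form_on X l \<and> (\<exists>C. \<forall>x\<in>X. \<bar>l x\<bar> \<le> C * nrm x)"

definition continuous_bilinear_form ::
    "('n::finite) mixed set \<Rightarrow> (('n::finite) mixed \<Rightarrow> real) \<Rightarrow> (('n::finite) mixed \<Rightarrow> ('n::finite) mixed \<Rightarrow> real) \<Rightarrow> bool" where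
  "continuous_bilinear_form X nrm a \<longleftrightarrow>
     (\<forall>x\<in>X. linear_form_on X (a x)) \<and> (\<forall>y\<in>X. linear_form_on X (\<lambda>x. a x y)) \<and>
     (\<exists>C. \<forall>x\<in>X. \<forall>y\<in>X. \<bar>a x y\<bar> \<le> C * nrm x * nrm y)"

definition continuous_linear_operator ::
    "('n::finite) mixed set \<Rightarrow> (('n::finite) mixed \<Rightarrow> real) \<Rightarrow> (('n::finite) mixed \<Rightarrow> ('n::finite) mixed) \<Rightarrow> bool" where
  "continuous_linear_operator X nrm T \<longleftrightarrow>
     (\<forall>x\<in>X. T x \<in> X) \<and>
     (\<forall>x\<in>X. \<forall>y\<in>X. \<forall>s t. T (lincomb s x t y) = lincomb s (T x) t (T y)) \<and>
     (\<exists>C. \<forall>x\<in>X. nrm (T x) \<le> C * nrm x)"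

definition T_coercive ::
    "('n::finite) mixed set \<Rightarrow> (('n::finite) mixed \<Rightarrow> real) \<Rightarrow> (('n::finite) mixed \<Rightarrow> ('n::finite) mixed \<Rightarrow> real) \<Rightarrow> bool" where
  "T_coercive X nrm a \<longleftrightarrow>
     (\<exists>T \<alpha>. continuous_linear_operator X nrm T \<and> \<alpha> > 0 \<and>
            (\<forall>x\<in>X. \<bar>a x (T x)\<bar> \<ge> \<alpha> * (nrm x)\<^sup>2))"

definition is_solution ::
    "('n::finite) mixed set \<Rightarrow> (('n::finite) mixed \<Rightarrow> ('n::finite) mixed \<Rightarrow> real) \<Rightarrow> (('n::finite) mixed \<Rightarrow> real) \<Rightarrow> ('n::finite) mixed \<Rightarrow> bool" where
  "is_solution X a l x \<longleftrightarrow> x \<in> X \<and> (\<forall>y\<in>X. a x y = l y)"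

text \<open>Continuous dependence: every bound \<open>M\<close> on the dual norm of the right-hand side bounds the
  solution by \<open>C * M\<close>.\<close>

definition well_posed ::
    "('n::finite) mixed set \<Rightarrow> (('n::finite) mixed \<Rightarrow> real) \<Rightarrow> (('n::finite) mixed \<Rightarrow> ('n::finite) mixed \<Rightarrow> real) \<Rightarrow> bool" where
  "well_posed X nrm a \<longleftrightarrow>
     (\<forall>l. continuous_linear_form X nrm l \<longrightarrow> (\<exists>!x. is_solution X a l x)) \<and>
     (\<exists>C. \<forall>l x M. continuous_linear_form X nrm l \<and> is_solution X a l x \<and>
        0 \<le> M \<and> (\<forall>y\<in>X. \<bar>l y\<bar> \<le> M * nrm y) \<longrightarrow> nrm x \<le> C * M)"

end

theory Submission
  imports Defs "HOL-Library.Function_Algebras"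
begin

text \<open>
  The mesh is fixed, so everything happens in a finite-dimensional space, and the theorem is a
  statement of linear algebra once two injectivity facts are known.

  \<^item> The broken \<open>H\<^sup>1\<close> seminorm is a norm on the velocities (\<open>broken_gradient_injective\<close>): a
    function with vanishing broken gradient is constant on each element, the constants agree
    across interior facets because the facet means do, and they vanish next to a boundary facet.
  \<^item> A pressure that is orthogonal to all discrete divergences vanishes
    (\<open>div_h_orthogonal_eq_0\<close>): testing with the Crouzeix--Raviart basis function of an interior
    facet, times a unit vector, shows that the two pressure values at the facet agree, so the
    pressure is constant, and its mean value is zero.

  Both use that any two elements are joined by a chain of elements with common interior facets
  (\<open>facet_connected\<close>). The second also needs the geometry of the basis function \<open>1 - d \<lambda>\<close>, where
  \<open>\<lambda>\<close> is the barycentric coordinate of the opposite vertex: facet integrals of affine functions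
  are multiples of the sum over the vertices (\<open>facet_integral_affine\<close>), and the volumes of two
  simplices with a common facet are proportional to their heights
  (\<open>content_simplex_common_facet\<close>), so that the two integrated gradients cancel.

  Consequently \<open>a\<^sub>S\<close> is a nondegenerate symmetric form: testing \<open>(u, p)\<close> with \<open>(u, - p)\<close> gives
  \<open>u = 0\<close>, and then \<open>p = 0\<close>. For such a form \<open>a\<close> on a space with inner product \<open>b\<close>, let
  \<open>T x = \<Sum>\<^sub>e a x e \<cdot> e\<close> over a \<open>b\<close>-orthonormal basis. Then \<open>a x (T y) = \<Sum>\<^sub>e a x e \<cdot> a y e\<close> is again
  an inner product, hence equivalent to \<open>b\<close>. This is the \<open>T\<close>-coercivity; the Riesz
  representation with respect to the new inner product solves the linear problems, and all linear
  forms are continuous (\<open>nondegenerate_form_well_posed\<close>).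

  It remains that the right-hand side is a linear form. If the functional is not represented in
  \<open>L\<^sup>2\<close>, this requires that the averaging operator is well defined and linear
  (\<open>averaging_ex1\<close>, \<open>averaging_lincomb\<close>), and that its values lie in \<open>H\<^sup>1\<^sub>0\<close>, since only there is
  the functional known to be linear (\<open>P1_cont_0_subset_H10\<close>). Continuous piecewise affine
  functions \<open>w\<close> that vanish off the domain are Lipschitz; truncating \<open>w\<close> at height \<open>\<epsilon>\<close> gives it a
  compact support, and mollifying at a scale below \<open>\<epsilon>\<close> gives test functions. Near almost
  every point the truncation is affine with the gradient of \<open>w\<close> when \<open>\<epsilon>\<close> is small, mollification
  preserves this, and dominated convergence does the rest.
\<close>

section \<open>Symmetric bilinear forms on finite-dimensional spaces\<close>

text \<open>The arguments of this section take place in a subspace \<open>X\<close> of a real vector space. Scalar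
  multiplication is a parameter, so that they apply to pairs of functions with pointwise
  operations.\<close>

locale real_space = vector_space scale
  for scale :: "real \<Rightarrow> 'a::ab_group_add \<Rightarrow> 'a" (infixr "\<odot>" 75)
begin

text \<open>Linearity on a subspace; nothing is said about arguments outside \<open>X\<close>.\<close>

definition lin_on :: "'a set \<Rightarrow> ('a \<Rightarrow> real) \<Rightarrow> bool" where
  "lin_on X l \<longleftrightarrow> (\<forall>x\<in>X. \<forall>y\<in>X. \<forall>s t. l (s \<odot> x + t \<odot> y) = s * l x + t * l y)"

text \<open>Inner products on \<open>X\<close>.\<close>

definition inner_on :: "'a set \<Rightarrow> ('a \<Rightarrow> 'a \<Rightarrow> real) \<Rightarrow> bool" where
  "inner_on X b \<longleftrightarrow> (\<forall>x\<in>X. lin_on X (b x)) \<and> (\<forall>x\<in>X. \<forall>y\<in>X. b x y = b y x) \<and>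
     (\<forall>x\<in>X. 0 \<le> b x x) \<and> (\<forall>x\<in>X. b x x = 0 \<longrightarrow> x = 0)"

text \<open>Finite families for which the orthonormal expansion holds. Orthogonality is not demanded:
  the expansion alone implies Parseval's identity.\<close>

definition frame :: "'a set \<Rightarrow> ('a \<Rightarrow> 'a \<Rightarrow> real) \<Rightarrow> 'a set \<Rightarrow> bool" where
  "frame X b E \<longleftrightarrow> finite E \<and> E \<subseteq> X \<and> (\<forall>y\<in>X. y = (\<Sum>e\<in>E. b y e \<odot> e))"

lemma lin_onD: "lin_on X l \<Longrightarrow> x \<in> X \<Longrightarrow> y \<in> X \<Longrightarrow> l (s \<odot> x + t \<odot> y) = s * l x + t * l y"
  by (simp add: lin_on_def)

lemma lin_on_add: "lin_on X l \<Longrightarrow> x \<in> X \<Longrightarrow> y \<in> X \<Longrightarrow> l (x + y) = l x + l y"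
  using lin_onD[of X l x y 1 1] by simp

lemma lin_on_scale: "lin_on X l \<Longrightarrow> x \<in> X \<Longrightarrow> l (s \<odot> x) = s * l x"
  using lin_onD[of X l x x s 0] by simp

lemma lin_on_zero: "lin_on X l \<Longrightarrow> x \<in> X \<Longrightarrow> l 0 = 0"
  using lin_on_scale[of X l x 0] by simp

lemma lin_on_sum:
  assumes "lin_on X l" "subspace X" "finite E" "E \<subseteq> X"
  shows "l (\<Sum>e\<in>E. c e \<odot> e) = (\<Sum>e\<in>E. c e * l e)"
  using assms(3,4)
proof (induction E rule: finite_induct)
  case empty
  show ?case using lin_on_zero[OF assms(1), of 0] subspace_0[OF assms(2)] by simp
next
  case (insert e E)
  have "(\<Sum>e\<in>E. c e \<odot> e) \<in> X"
    using insert.prems by (intro subspace_sum assms(2) subspace_scale) auto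
  then show ?case
    using insert assms by (simp add: lin_on_add[OF assms(1)] lin_on_scale[OF assms(1)] subspace_scale)
qed

lemma lin_on_subset: "lin_on X l \<Longrightarrow> Y \<subseteq> X \<Longrightarrow> lin_on Y l"
  by (auto simp: lin_on_def)

lemma inner_on_subset: "inner_on X b \<Longrightarrow> Y \<subseteq> X \<Longrightarrow> inner_on Y b"
  by (simp add: inner_on_def lin_on_def subset_iff)

text \<open>Finite dimension enters as the existence of finitely many linear functionals that separate
  points; the proof is Gram--Schmidt along the chain of their kernels.\<close>

lemma frame_exists:
  assumes "finite L" "subspace X" "inner_on X b" "\<forall>l\<in>L. lin_on X l"
    and "\<forall>x\<in>X. (\<forall>l\<in>L. l x = 0) \<longrightarrow> x = 0"
  shows "\<exists>E. frame X b E"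
  using assms
proof (induction L arbitrary: X rule: finite_induct)
  case empty
  then have "frame X b {}" by (auto simp: frame_def)
  then show ?case ..
next
  case (insert l L X)
  note sub = insert.prems(1) and inn = insert.prems(2)
  have l: "lin_on X l" using insert.prems by simp
  define Y where "Y = {x\<in>X. l x = 0}"
  have YX: "Y \<subseteq> X" by (auto simp: Y_def)
  have "subspace Y"
    unfolding subspace_def Y_def
    using sub lin_on_zero[OF l] lin_on_add[OF l] lin_on_scale[OF l] by (auto simp: subspace_def)
  moreover have "inner_on Y b" using inner_on_subset[OF inn YX] .
  moreover have "\<forall>l\<in>L. lin_on Y l" using insert.prems lin_on_subset[OF _ YX] by simp
  moreover have "\<forall>x\<in>Y. (\<forall>l\<in>L. l x = 0) \<longrightarrow> x = 0"
    using insert.prems by (auto simp: Y_def)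
  ultimately obtain E where E: "frame Y b E" using insert.IH[of Y] by auto
  have fE: "finite E" "E \<subseteq> Y" and expand: "\<And>y. y \<in> Y \<Longrightarrow> y = (\<Sum>e\<in>E. b y e \<odot> e)"
    using E by (auto simp: frame_def)
  have bl: "lin_on X (b x)" if "x \<in> X" for x using inn that by (auto simp: inner_on_def)
  have sym: "b x y = b y x" if "x \<in> X" "y \<in> X" for x y using inn that by (auto simp: inner_on_def)
  show ?case
  proof (cases "Y = X")
    case True
    then show ?thesis using E by auto
  next
    case False
    then obtain x0 where x0: "x0 \<in> X" "l x0 \<noteq> 0" using YX by (auto simp: Y_def)
    define x1 where "x1 = inverse (l x0) \<odot> x0"
    have x1: "x1 \<in> X" "l x1 = 1"
      using x0 by (auto simp: x1_def lin_on_scale[OF l] subspace_scale[OF sub])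
    \<comment> \<open>the projection of \<open>x1\<close> to the kernel \<open>Y\<close>; what remains is orthogonal to \<open>Y\<close>\<close>
    define p where "p = (\<Sum>e\<in>E. b x1 e \<odot> e)"
    have pY: "p \<in> Y" unfolding p_def using fE \<open>subspace Y\<close>
      by (intro subspace_sum subspace_scale) auto
    have bp: "b p y = b x1 y" if "y \<in> Y" for y
    proof -
      have "b p y = b y p" using sym that pY YX by blast
      also have "\<dots> = (\<Sum>e\<in>E. b x1 e * b y e)"
        unfolding p_def using fE that YX by (intro lin_on_sum[of X] bl sub) auto
      also have "\<dots> = (\<Sum>e\<in>E. b y e * b x1 e)" by (simp add: mult.commute)
      also have "\<dots> = b x1 (\<Sum>e\<in>E. b y e \<odot> e)"
        using fE x1 YX by (intro lin_on_sum[of X, symmetric] bl sub) auto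
      also have "\<dots> = b x1 y" using expand[OF that] by simp
      finally show ?thesis .
    qed
    define x2 where "x2 = x1 - p"
    have x2e: "x2 = 1 \<odot> x1 + (-1) \<odot> p" by (simp add: x2_def)
    have x2: "x2 \<in> X" using x1 pY YX sub by (auto simp: x2_def intro: subspace_diff)
    have lx2: "l x2 = 1"
      using x1 pY YX unfolding x2e by (subst lin_onD[OF l]) (auto simp: Y_def)
    have b2: "b x2 y = 0" if "y \<in> Y" for y
    proof -
      have "b x2 y = b y x2" using sym that x2 YX by blast
      also have "\<dots> = b y x1 - b y p"
        using x1 pY YX that unfolding x2e by (subst lin_onD[OF bl]) auto
      also have "\<dots> = b x1 y - b p y" using sym[of y x1] sym[of y p] subsetD[OF YX that] x1 subsetD[OF YX pY] by simp
      finally show ?thesis using bp[OF that] by simp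
    qed
    have "x2 \<noteq> 0" using lx2 lin_on_zero[OF l x2] by auto
    then have pos: "b x2 x2 > 0" using inn x2 by (metis inner_on_def order_less_le)
    define s where "s = inverse (sqrt (b x2 x2))"
    have s2: "s * s * b x2 x2 = 1" using pos
      by (simp add: s_def field_simps flip: real_sqrt_mult)
    define f where "f = s \<odot> x2"
    have f: "f \<in> X" using x2 sub by (simp add: f_def subspace_scale)
    have bf: "b y f = s * b y x2" if "y \<in> X" for y
      unfolding f_def using that x2 by (simp add: lin_on_scale[OF bl])
    have "s \<noteq> 0" using pos by (simp add: s_def)
    have fY: "f \<notin> E"
    proof
      assume "f \<in> E"
      then have "l f = 0" using fE by (auto simp: Y_def)
      then show False using lin_on_scale[OF l x2] lx2 \<open>s \<noteq> 0\<close> by (simp add: f_def)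
    qed
    have "y = (\<Sum>e\<in>insert f E. b y e \<odot> e)" if y: "y \<in> X" for y
    proof -
      define z where "z = y - l y \<odot> x2"
      have ze: "z = 1 \<odot> y + (- l y) \<odot> x2" by (simp add: z_def)
      have zX: "z \<in> X" using y x2 sub by (simp add: z_def subspace_diff subspace_scale)
      have zY: "z \<in> Y"
        using zX lin_onD[OF l y x2, of 1 "- l y"] lx2 unfolding Y_def ze by simp
      have ye: "y = 1 \<odot> z + l y \<odot> x2" by (simp add: z_def)
      have bye: "b y e = b z e" if "e \<in> Y" for e
      proof -
        have eX: "e \<in> X" using that YX by auto
        have "b y e = b e (1 \<odot> z + l y \<odot> x2)" using sym[OF y eX] ye by metis
        also have "\<dots> = b e z + l y * b e x2" using zX x2 eX by (subst lin_onD[OF bl]) auto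
        also have "\<dots> = b z e + l y * b x2 e" using sym[of e z] sym[of e x2] eX zX x2 by auto
        finally show ?thesis using b2[OF that] by simp
      qed
      have byx2: "b y x2 = l y * b x2 x2"
      proof -
        have "b y x2 = b x2 (1 \<odot> z + l y \<odot> x2)" using sym[OF y x2] ye by metis
        also have "\<dots> = b x2 z + l y * b x2 x2" using zX x2 by (subst lin_onD[OF bl]) auto
        finally show ?thesis using b2[OF zY] by simp
      qed
      have "(\<Sum>e\<in>insert f E. b y e \<odot> e) = b y f \<odot> f + (\<Sum>e\<in>E. b y e \<odot> e)"
        using fE fY by simp
      also have "(\<Sum>e\<in>E. b y e \<odot> e) = (\<Sum>e\<in>E. b z e \<odot> e)"
        using fE bye by (intro sum.cong) auto
      also have "\<dots> = z" using expand[OF zY] by simp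
      also have "b y f \<odot> f = (l y * (s * s * b x2 x2)) \<odot> x2"
        using bf[OF y] byx2 by (simp add: f_def algebra_simps)
      also have "\<dots> = l y \<odot> x2" using s2 by simp
      finally show ?thesis by (simp add: z_def)
    qed
    then have "frame X b (insert f E)" using fE YX f by (auto simp: frame_def)
    then show ?thesis ..
  qed
qed

lemma frame_lin_bound:
  assumes "frame X b E" "subspace X" "inner_on X b" "lin_on X l"
  obtains C where "C \<ge> 0" "\<And>x. x \<in> X \<Longrightarrow> \<bar>l x\<bar> \<le> C * sqrt (b x x)"
proof
  have E: "finite E" "E \<subseteq> X" "\<And>y. y \<in> X \<Longrightarrow> y = (\<Sum>e\<in>E. b y e \<odot> e)"
    using assms(1) by (auto simp: frame_def)
  show "(\<Sum>e\<in>E. \<bar>l e\<bar>) \<ge> 0" by (simp add: sum_nonneg)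
  fix x assume x: "x \<in> X"
  \<comment> \<open>Parseval's identity, from the expansion alone\<close>
  have pars: "b x x = (\<Sum>e\<in>E. (b x e)\<^sup>2)"
  proof -
    have "b x x = b x (\<Sum>e\<in>E. b x e \<odot> e)" using E(3)[OF x] by simp
    also have "\<dots> = (\<Sum>e\<in>E. b x e * b x e)"
      using assms(2,3) E x by (intro lin_on_sum[of X]) (auto simp: inner_on_def)
    finally show ?thesis by (simp add: power2_eq_square)
  qed
  have be: "\<bar>b x e\<bar> \<le> sqrt (b x x)" if "e \<in> E" for e
  proof -
    have "(b x e)\<^sup>2 \<le> b x x" unfolding pars using that E by (intro member_le_sum) auto
    then have "sqrt ((b x e)\<^sup>2) \<le> sqrt (b x x)" by (rule real_sqrt_le_mono)
    then show ?thesis by simp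
  qed
  have "l x = l (\<Sum>e\<in>E. b x e \<odot> e)" using E(3)[OF x] by simp
  also have "\<dots> = (\<Sum>e\<in>E. b x e * l e)" using assms E by (intro lin_on_sum[of X]) auto
  finally have "\<bar>l x\<bar> \<le> (\<Sum>e\<in>E. \<bar>b x e\<bar> * \<bar>l e\<bar>)"
    by (metis (mono_tags, lifting) abs_mult sum.cong sum_abs)
  also have "\<dots> \<le> (\<Sum>e\<in>E. sqrt (b x x) * \<bar>l e\<bar>)"
    using be by (intro sum_mono mult_right_mono) auto
  finally show "\<bar>l x\<bar> \<le> (\<Sum>e\<in>E. \<bar>l e\<bar>) * sqrt (b x x)"
    by (simp add: sum_distrib_left mult.commute)
qed

lemma frame_bilin_bound:
  assumes "frame X b E" "subspace X" "inner_on X b"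
    and "\<And>x. x \<in> X \<Longrightarrow> lin_on X (a x)" "\<And>y. y \<in> X \<Longrightarrow> lin_on X (\<lambda>x. a x y)"
  obtains C where "C \<ge> 0" "\<And>x y. x \<in> X \<Longrightarrow> y \<in> X \<Longrightarrow> \<bar>a x y\<bar> \<le> C * sqrt (b x x) * sqrt (b y y)"
proof -
  have E: "finite E" "E \<subseteq> X" "\<And>y. y \<in> X \<Longrightarrow> y = (\<Sum>e\<in>E. b y e \<odot> e)"
    using assms(1) by (auto simp: frame_def)
  have "\<forall>e\<in>E. \<exists>C\<ge>0. \<forall>x\<in>X. \<bar>a x e\<bar> \<le> C * sqrt (b x x)"
    using frame_lin_bound[OF assms(1-3) assms(5)] E(2) by (metis subsetD)
  then obtain C where C: "\<And>e. e \<in> E \<Longrightarrow> C e \<ge> 0"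
    "\<And>e x. e \<in> E \<Longrightarrow> x \<in> X \<Longrightarrow> \<bar>a x e\<bar> \<le> C e * sqrt (b x x)"
    by metis
  have "\<forall>e\<in>E. \<exists>D\<ge>0. \<forall>y\<in>X. \<bar>b e y\<bar> \<le> D * sqrt (b y y)"
    using frame_lin_bound[OF assms(1-3)] assms(3) E(2) unfolding inner_on_def by (metis subsetD)
  then obtain D where D: "\<And>e. e \<in> E \<Longrightarrow> D e \<ge> 0"
    "\<And>e x. e \<in> E \<Longrightarrow> x \<in> X \<Longrightarrow> \<bar>b e x\<bar> \<le> D e * sqrt (b x x)"
    by metis
  show thesis
  proof
    show "(\<Sum>e\<in>E. C e * D e) \<ge> 0" using C D by (simp add: sum_nonneg)
    fix x y assume x: "x \<in> X" and y: "y \<in> X"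
    have "a x y = a x (\<Sum>e\<in>E. b y e \<odot> e)" using E(3)[OF y] by simp
    also have "\<dots> = (\<Sum>e\<in>E. b y e * a x e)" using assms E x by (intro lin_on_sum[of X]) auto
    finally have "\<bar>a x y\<bar> \<le> (\<Sum>e\<in>E. \<bar>b y e\<bar> * \<bar>a x e\<bar>)"
      by (metis (mono_tags, lifting) abs_mult sum.cong sum_abs)
    also have "\<dots> \<le> (\<Sum>e\<in>E. (D e * sqrt (b y y)) * (C e * sqrt (b x x)))"
    proof (intro sum_mono mult_mono)
      fix e assume e: "e \<in> E"
      show "\<bar>b y e\<bar> \<le> D e * sqrt (b y y)"
        using D(2)[OF e y] assms(3) e y E(2) by (metis inner_on_def subsetD)
      show "\<bar>a x e\<bar> \<le> C e * sqrt (b x x)" using C(2)[OF e x] .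
      show "0 \<le> D e * sqrt (b y y)" using D(1)[OF e] assms(3) y by (simp add: inner_on_def)
    qed simp
    also have "\<dots> = (\<Sum>e\<in>E. C e * D e) * sqrt (b x x) * sqrt (b y y)"
      by (simp add: sum_distrib_left mult_ac)
    finally show "\<bar>a x y\<bar> \<le> (\<Sum>e\<in>E. C e * D e) * sqrt (b x x) * sqrt (b y y)" .
  qed
qed

end

text \<open>Scalar multiplication of pairs of functions.\<close>

definition mscale :: "real \<Rightarrow> ('n::finite) mixed \<Rightarrow> 'n mixed" where
  "mscale s x = ((\<lambda>z. s *\<^sub>R fst x z), (\<lambda>z. s * snd x z))"

interpretation mixed: real_space mscale
  by unfold_locales
    (auto simp: mscale_def prod_eq_iff fun_eq_iff algebra_simps)

lemma lincomb_eq: "lincomb s x t y = mscale s x + mscale t y"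
  by (simp add: lincomb_def mscale_def prod_eq_iff fun_eq_iff)

lemma linear_form_on_eq: "linear_form_on X l \<longleftrightarrow> mixed.lin_on X l"
  by (simp add: linear_form_on_def mixed.lin_on_def lincomb_eq)

text \<open>A symmetric nondegenerate form on a finite-dimensional space is continuous, \<open>T\<close>-coercive and
  well-posed for every norm \<open>N\<close> equivalent to an inner product \<open>b\<close>. The set \<open>L\<close> of separating
  functionals expresses finite dimension.\<close>

theorem nondegenerate_form_well_posed:
  fixes X :: "('n::finite) mixed set" and a b :: "'n mixed \<Rightarrow> 'n mixed \<Rightarrow> real"
  assumes ne: "X \<noteq> {}" and closed: "\<And>x y s t. x \<in> X \<Longrightarrow> y \<in> X \<Longrightarrow> lincomb s x t y \<in> X"
    and L: "finite L" "\<And>l. l \<in> L \<Longrightarrow> linear_form_on X l"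
      "\<And>x. x \<in> X \<Longrightarrow> (\<And>l. l \<in> L \<Longrightarrow> l x = 0) \<Longrightarrow> x = 0"
    and b: "\<And>x. x \<in> X \<Longrightarrow> linear_form_on X (b x)"
      "\<And>x y. x \<in> X \<Longrightarrow> y \<in> X \<Longrightarrow> b x y = b y x"
      "\<And>x. x \<in> X \<Longrightarrow> b x x \<ge> 0" "\<And>x. x \<in> X \<Longrightarrow> b x x = 0 \<Longrightarrow> x = 0"
    and N: "\<And>x. x \<in> X \<Longrightarrow> N x \<ge> 0" "\<And>x. x \<in> X \<Longrightarrow> N x \<le> C * sqrt (b x x)"
      "\<And>x. x \<in> X \<Longrightarrow> sqrt (b x x) \<le> C * N x"
    and a: "\<And>x. x \<in> X \<Longrightarrow> linear_form_on X (a x)"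
      "\<And>x y. x \<in> X \<Longrightarrow> y \<in> X \<Longrightarrow> a x y = a y x"
      "\<And>x. x \<in> X \<Longrightarrow> (\<And>y. y \<in> X \<Longrightarrow> a x y = 0) \<Longrightarrow> x = 0"
  shows "continuous_bilinear_form X N a" "T_coercive X N a" "well_posed X N a"
    "\<And>l. linear_form_on X l \<Longrightarrow> continuous_linear_form X N l"
proof -
  obtain x0 where x0: "x0 \<in> X" using ne by blast
  have sub: "mixed.subspace X"
  proof (rule mixed.subspaceI)
    show "0 \<in> X" using closed[OF x0 x0, of 0 0] by (simp add: lincomb_eq)
    show "x + y \<in> X" if "x \<in> X" "y \<in> X" for x y
      using closed[OF that, of 1 1] by (simp add: lincomb_eq)
    show "mscale c x \<in> X" if "x \<in> X" for c x
      using closed[OF that that, of c 0] by (simp add: lincomb_eq)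
  qed
  define D where "D = max C 1"
  have D: "D > 0" by (simp add: D_def)
  have ND: "N x \<le> D * sqrt (b x x)" "sqrt (b x x) \<le> D * N x" if "x \<in> X" for x
  proof -
    have "C * sqrt (b x x) \<le> D * sqrt (b x x)" "C * N x \<le> D * N x"
      using b(3)[OF that] N(1)[OF that] by (auto intro!: mult_right_mono simp: D_def)
    then show "N x \<le> D * sqrt (b x x)" "sqrt (b x x) \<le> D * N x"
      using N[OF that] by linarith+
  qed
  have inn: "mixed.inner_on X b"
    unfolding mixed.inner_on_def using b[unfolded linear_form_on_eq] by blast
  have Ls: "\<forall>l\<in>L. mixed.lin_on X l" "\<forall>x\<in>X. (\<forall>l\<in>L. l x = 0) \<longrightarrow> x = 0"
    using L[unfolded linear_form_on_eq] by blast+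
  obtain E where E: "mixed.frame X b E"
    using mixed.frame_exists[OF L(1) sub inn Ls] by blast
  have EX: "finite E" "E \<subseteq> X" "\<And>y. y \<in> X \<Longrightarrow> y = (\<Sum>e\<in>E. mscale (b y e) e)"
    using E by (auto simp: mixed.frame_def)
  have alin: "mixed.lin_on X (a x)" if "x \<in> X" for x
    using a that by (auto simp: linear_form_on_eq)
  have alin': "mixed.lin_on X (\<lambda>x. a x y)" if "y \<in> X" for y
    unfolding mixed.lin_on_def
  proof (intro ballI allI)
    fix x x' s t assume xx: "x \<in> X" "x' \<in> X"
    then have "mscale s x + mscale t x' \<in> X"
      using sub by (auto intro: mixed.subspace_add mixed.subspace_scale)
    then show "a (mscale s x + mscale t x') y = s * a x y + t * a x' y"
      using that xx by (simp add: a(2)[of _ y] mixed.lin_onD[OF alin])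
  qed
  show cont: "continuous_linear_form X N l" if l: "linear_form_on X l" for l
  proof -
    obtain K where K: "K \<ge> 0" "\<And>x. x \<in> X \<Longrightarrow> \<bar>l x\<bar> \<le> K * sqrt (b x x)"
      using mixed.frame_lin_bound[OF E sub inn l[unfolded linear_form_on_eq]] by blast
    have "\<bar>l x\<bar> \<le> K * D * N x" if "x \<in> X" for x
      using K(2)[OF that] mult_left_mono[OF ND(2)[OF that] K(1)] by (simp add: mult.assoc)
    then show ?thesis unfolding continuous_linear_form_def using l by blast
  qed
  show "continuous_bilinear_form X N a"
  proof -
    obtain K where K: "K \<ge> 0"
      "\<And>x y. x \<in> X \<Longrightarrow> y \<in> X \<Longrightarrow> \<bar>a x y\<bar> \<le> K * sqrt (b x x) * sqrt (b y y)"
      using mixed.frame_bilin_bound[OF E sub inn alin alin'] by blast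
    have "\<bar>a x y\<bar> \<le> (K * D * D) * N x * N y" if xy: "x \<in> X" "y \<in> X" for x y
    proof -
      have "\<bar>a x y\<bar> \<le> K * (sqrt (b x x) * sqrt (b y y))" using K(2)[OF xy] by (simp add: mult.assoc)
      also have "\<dots> \<le> K * ((D * N x) * (D * N y))"
        using K(1) ND(2) N(1) D b(3) xy by (intro mult_left_mono mult_mono) auto
      finally show ?thesis by (simp add: mult_ac)
    qed
    then show ?thesis
      unfolding continuous_bilinear_form_def linear_form_on_eq using alin alin' by blast
  qed
  \<comment> \<open>the operator that represents \<open>a\<close> with respect to \<open>b\<close>\<close>
  define T where "T x = (\<Sum>e\<in>E. mscale (a x e) e)" for x
  have TX: "T x \<in> X" for x
    unfolding T_def using EX by (intro mixed.subspace_sum sub mixed.subspace_scale) auto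
  have Tlin: "T (lincomb s x t y) = lincomb s (T x) t (T y)" if "x \<in> X" "y \<in> X" for s t x y
  proof -
    have "T (lincomb s x t y) = (\<Sum>e\<in>E. mscale (s * a x e + t * a y e) e)"
      unfolding T_def lincomb_eq using EX that
      by (intro sum.cong refl) (auto simp: mixed.lin_onD[OF alin'])
    also have "\<dots> = lincomb s (T x) t (T y)"
      by (simp add: T_def lincomb_eq mixed.scale_sum_right mixed.scale_left_distrib sum.distrib)
    finally show ?thesis .
  qed
  \<comment> \<open>a second inner product: symmetric by the formula below, definite by nondegeneracy\<close>
  define b' where "b' x y = a x (T y)" for x y
  have b'e: "b' x y = (\<Sum>e\<in>E. a x e * a y e)" if "x \<in> X" "y \<in> X" for x y
    unfolding b'_def T_def using EX that
    by (subst mixed.lin_on_sum[OF alin sub]) (auto simp: mult.commute)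
  have inn': "mixed.inner_on X b'"
    unfolding mixed.inner_on_def
  proof (intro conjI ballI impI)
    fix x assume x: "x \<in> X"
    show "mixed.lin_on X (b' x)"
      unfolding mixed.lin_on_def b'_def
      by (intro ballI allI) (simp add: x TX Tlin[unfolded lincomb_eq] mixed.lin_onD[OF alin])
    show "0 \<le> b' x x" using x by (simp add: b'e sum_nonneg)
    show "b' x y = b' y x" if "y \<in> X" for y using x that by (simp add: b'e mult.commute)
    assume "b' x x = 0"
    then have z: "\<forall>e\<in>E. a x e = 0" using x EX(1) by (simp add: b'e sum_nonneg_eq_0_iff)
    have "a x y = 0" if y: "y \<in> X" for y
    proof -
      have "a x y = a x (\<Sum>e\<in>E. mscale (b y e) e)" using EX(3)[OF y] by simp
      also have "\<dots> = 0" using z x EX by (subst mixed.lin_on_sum[OF alin sub]) auto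
      finally show ?thesis .
    qed
    then show "x = 0" using a(3) x by blast
  qed
  obtain E' where E': "mixed.frame X b' E'"
    using mixed.frame_exists[OF L(1) sub inn' Ls] by blast
  have EX': "finite E'" "E' \<subseteq> X" "\<And>y. y \<in> X \<Longrightarrow> y = (\<Sum>e\<in>E'. mscale (b' y e) e)"
    using E' by (auto simp: mixed.frame_def)
  have blin: "mixed.lin_on X (b x)" if "x \<in> X" for x
    using b(1)[OF that] by (simp add: linear_form_on_eq)
  have blin': "mixed.lin_on X (\<lambda>x. b x y)" if "y \<in> X" for y
    unfolding mixed.lin_on_def
  proof (intro ballI allI)
    fix x x' s t assume xx: "x \<in> X" "x' \<in> X"
    then have "mscale s x + mscale t x' \<in> X"
      using sub by (auto intro: mixed.subspace_add mixed.subspace_scale)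
    then show "b (mscale s x + mscale t x') y = s * b x y + t * b x' y"
      using that xx by (simp add: b(2)[of _ y] mixed.lin_onD[OF blin])
  qed
  obtain K where K: "K \<ge> 0"
    "\<And>x y. x \<in> X \<Longrightarrow> y \<in> X \<Longrightarrow> \<bar>b x y\<bar> \<le> K * sqrt (b' x x) * sqrt (b' y y)"
    using mixed.frame_bilin_bound[OF E' sub inn' blin blin'] by blast
  \<comment> \<open>\<open>K\<close> compares the two inner products, \<open>D\<close> compares \<open>b\<close> with the norm\<close>
  define \<alpha> where "\<alpha> = inverse ((K + 1) * D\<^sup>2)"
  have \<alpha>: "\<alpha> > 0" using K(1) D by (simp add: \<alpha>_def)
  have coer: "\<alpha> * (N x)\<^sup>2 \<le> a x (T x)" if x: "x \<in> X" for x
  proof -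
    have b'0: "b' x x \<ge> 0" using inn' x by (auto simp: mixed.inner_on_def)
    have "b x x \<le> K * (sqrt (b' x x) * sqrt (b' x x))" using K(2)[OF x x] by (simp add: mult.assoc)
    then have "b x x \<le> (K + 1) * b' x x" using b'0 by (simp add: algebra_simps)
    moreover have "(N x)\<^sup>2 \<le> D\<^sup>2 * b x x"
    proof -
      have "(N x)\<^sup>2 \<le> (D * sqrt (b x x))\<^sup>2" using ND(1)[OF x] N(1)[OF x] by (rule power_mono)
      then show ?thesis using b(3)[OF x] by (simp add: power_mult_distrib)
    qed
    ultimately have "(N x)\<^sup>2 \<le> D\<^sup>2 * ((K + 1) * b' x x)"
      by (meson mult_left_mono order_trans zero_le_power2)
    moreover have "(K + 1) * D\<^sup>2 > 0" using K(1) D by simp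
    ultimately show ?thesis
      by (simp add: \<alpha>_def b'_def pos_divide_le_eq mult_ac flip: divide_inverse_commute)
  qed
  obtain M where M: "M \<ge> 0" "\<And>x. x \<in> X \<Longrightarrow> N (T x) \<le> M * N x"
  proof -
    have "mixed.lin_on X (\<lambda>y. b (T x) (T y))" if "x \<in> X" for x
      unfolding mixed.lin_on_def using TX
      by (intro ballI allI) (simp add: Tlin[unfolded lincomb_eq] mixed.lin_onD[OF blin])
    moreover have "mixed.lin_on X (\<lambda>x. b (T x) (T y))" if "y \<in> X" for y
      unfolding mixed.lin_on_def
      by (intro ballI allI) (simp add: TX Tlin[unfolded lincomb_eq] mixed.lin_onD[OF blin'])
    ultimately obtain M where M: "M \<ge> 0"
      "\<And>x y. x \<in> X \<Longrightarrow> y \<in> X \<Longrightarrow> \<bar>b (T x) (T y)\<bar> \<le> M * sqrt (b x x) * sqrt (b y y)"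
      using mixed.frame_bilin_bound[OF E sub inn, of "\<lambda>x y. b (T x) (T y)"] by blast
    have "N (T x) \<le> (D * sqrt M * D) * N x" if x: "x \<in> X" for x
    proof -
      have "b (T x) (T x) \<le> M * b x x"
        using M(2)[OF x x] b(3)[OF x] by (simp add: mult.assoc)
      then have "sqrt (b (T x) (T x)) \<le> sqrt M * sqrt (b x x)"
        by (metis real_sqrt_le_mono real_sqrt_mult)
      also have "\<dots> \<le> sqrt M * (D * N x)" using ND(2)[OF x] M(1) by (intro mult_left_mono) auto
      finally have "D * sqrt (b (T x) (T x)) \<le> D * (sqrt M * (D * N x))"
        using D by (intro mult_left_mono) auto
      then show ?thesis using ND(1)[OF TX[of x]] by (simp add: mult_ac)
    qed
    moreover have "D * sqrt M * D \<ge> 0" using D M(1) by simp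
    ultimately show thesis using that by blast
  qed
  show "T_coercive X N a"
    unfolding T_coercive_def continuous_linear_operator_def
  proof (intro exI conjI)
    show "\<forall>x\<in>X. T x \<in> X" using TX by blast
    show "\<forall>x\<in>X. \<forall>y\<in>X. \<forall>s t. T (lincomb s x t y) = lincomb s (T x) t (T y)" using Tlin by blast
    show "\<forall>x\<in>X. N (T x) \<le> M * N x" using M by blast
    show "\<forall>x\<in>X. \<alpha> * (N x)\<^sup>2 \<le> \<bar>a x (T x)\<bar>"
      using coer by (meson abs_ge_self order_trans)
  qed (fact \<alpha>)
  have ex: "\<exists>!x. is_solution X a l x" if l: "continuous_linear_form X N l" for l
  proof -
    have l: "mixed.lin_on X l" using l by (auto simp: continuous_linear_form_def linear_form_on_eq)
    \<comment> \<open>the Riesz representative of \<open>l\<close> in the second inner product; \<open>T z\<close> is the solution\<close>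
    define z where "z = (\<Sum>f\<in>E'. mscale (l f) f)"
    have z: "z \<in> X"
      unfolding z_def using EX' by (intro mixed.subspace_sum sub mixed.subspace_scale) auto
    have bz: "b' z y = l y" if y: "y \<in> X" for y
    proof -
      have "b' z y = b' y z" using inn' y z by (simp add: mixed.inner_on_def)
      also have "\<dots> = (\<Sum>f\<in>E'. l f * b' y f)"
        unfolding z_def using EX' inn' y
        by (intro mixed.lin_on_sum[OF _ sub]) (auto simp: mixed.inner_on_def)
      also have "\<dots> = l (\<Sum>f\<in>E'. mscale (b' y f) f)"
        using EX' by (subst mixed.lin_on_sum[OF l sub]) (auto simp: mult.commute)
      finally show ?thesis using EX'(3)[OF y] by simp
    qed
    have "a (T z) y = l y" if y: "y \<in> X" for y
      using bz[OF y] y z TX[of z] a(2)[of "T z" y] b'e[OF y z] b'e[OF z y]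
      by (simp add: b'_def mult.commute)
    then have 1: "is_solution X a l (T z)" unfolding is_solution_def using TX by blast
    show ?thesis
    proof (rule ex1I[of _ "T z"], fact 1)
      fix x assume x: "is_solution X a l x"
      have xz: "x \<in> X" "T z \<in> X" using x TX by (auto simp: is_solution_def)
      have d: "x - T z = mscale 1 x + mscale (-1) (T z)" by simp
      have dX: "x - T z \<in> X" using xz sub by (auto intro: mixed.subspace_diff)
      have "a (x - T z) y = 0" if y: "y \<in> X" for y
        unfolding d using xz y x 1
        by (subst mixed.lin_onD[OF alin'[OF y]]) (auto simp: is_solution_def)
      then have "x - T z = 0" using a(3) dX by blast
      then show "x = T z" by simp
    qed
  qed
  have "N x \<le> (M / \<alpha>) * R" if x: "is_solution X a l x" and R: "0 \<le> R" "\<forall>y\<in>X. \<bar>l y\<bar> \<le> R * N y"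
    for l x R
  proof -
    have xX: "x \<in> X" and eq: "a x (T x) = l (T x)" using x TX by (auto simp: is_solution_def)
    have "\<alpha> * (N x)\<^sup>2 \<le> \<bar>l (T x)\<bar>" using coer[OF xX] eq by simp
    also have "\<dots> \<le> R * N (T x)" using R TX by blast
    also have "\<dots> \<le> R * (M * N x)" using M(2)[OF xX] R(1) by (rule mult_left_mono)
    finally have "(\<alpha> * N x) * N x \<le> (R * M) * N x" by (simp add: power2_eq_square mult_ac)
    then have "\<alpha> * N x \<le> R * M \<or> N x = 0"
      using N(1)[OF xX] by (auto simp: mult_le_cancel_right)
    moreover have "0 \<le> M / \<alpha> * R" using M(1) \<alpha> R(1) by simp
    ultimately show ?thesis using \<alpha> by (auto simp: field_simps)
  qed
  then show "well_posed X N a" unfolding well_posed_def using ex by blast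
qed

section \<open>Smooth functions and mollifiers\<close>

text \<open>The function \<open>p (1/t) exp (- 1/t)\<close>, extended by zero to \<open>t \<le> 0\<close>. These functions are closed
  under differentiation, with \<open>p\<close> replaced by \<open>s\<^sup>2 (p - p')\<close>.\<close>

definition exp_bump :: "real poly \<Rightarrow> real \<Rightarrow> real" where
  "exp_bump p t = (if t > 0 then poly p (inverse t) * exp (- inverse t) else 0)"

lemma poly_div_exp_tendsto_0: "((\<lambda>s::real. poly p s / exp s) \<longlongrightarrow> 0) at_top"
proof -
  have "((\<lambda>s. \<Sum>i\<le>degree p. coeff p i * (s ^ i / exp s)) \<longlongrightarrow> (\<Sum>i\<le>degree p. coeff p i * 0)) at_top"
    by (intro tendsto_intros tendsto_power_div_exp_0)
  then show ?thesis by (simp add: poly_altdef sum_divide_distrib)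
qed

lemma exp_bump_deriv:
  "(exp_bump p has_real_derivative exp_bump ([:0, 0, 1:] * (p - pderiv p)) t) (at t)"
proof -
  consider "t > 0" | "t < 0" | "t = 0" by linarith
  then show ?thesis
  proof cases
    case 1
    have "((\<lambda>t. poly p (inverse t) * exp (- inverse t)) has_real_derivative
        exp_bump ([:0, 0, 1:] * (p - pderiv p)) t) (at t)"
      using 1
      by (auto intro!: derivative_eq_intros simp: exp_bump_def field_simps power2_eq_square)
    then show ?thesis
      by (rule DERIV_cong_ev[OF refl _ refl, THEN iffD1, rotated])
        (use 1 in \<open>auto simp: exp_bump_def eventually_nhds intro!: exI[of _ "{0<..}"]\<close>)
  next
    case 2
    have "((\<lambda>t. 0) has_real_derivative 0) (at t)" by simp
    then have "(exp_bump p has_real_derivative 0) (at t)"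
      by (rule DERIV_cong_ev[OF refl _ refl, THEN iffD1, rotated])
        (use 2 in \<open>auto simp: exp_bump_def eventually_nhds intro!: exI[of _ "{..<0}"]\<close>)
    then show ?thesis using 2 by (simp add: exp_bump_def)
  next
    case 3
    have right: "((\<lambda>h. exp_bump p h / h) \<longlongrightarrow> 0) (at_right 0)"
    proof -
      have "((\<lambda>h::real. poly (pCons 0 p) (inverse h) / exp (inverse h)) \<longlongrightarrow> 0) (at_right 0)"
        by (rule filterlim_compose[OF poly_div_exp_tendsto_0 filterlim_inverse_at_top_right])
      then show ?thesis
        by (rule Lim_transform_eventually)
          (auto simp: eventually_at_filter exp_bump_def exp_minus divide_simps)
    qed
    have left: "((\<lambda>h. exp_bump p h / h) \<longlongrightarrow> 0) (at_left 0)"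
      by (rule Lim_transform_eventually[OF tendsto_const])
        (auto simp: eventually_at_filter exp_bump_def)
    have "((\<lambda>h. exp_bump p h / h) \<longlongrightarrow> 0) (at 0)"
      using left right by (simp add: filterlim_split_at)
    then show ?thesis using 3 by (simp add: DERIV_def exp_bump_def)
  qed
qed

text \<open>A class of functions on space that is closed under partial derivatives, so that all its members
  are smooth, and that contains a nonnegative function supported in a ball.\<close>

inductive smooth_gen :: "(real^'n \<Rightarrow> real) \<Rightarrow> bool" where
  const: "smooth_gen (\<lambda>x. c)"
| coord: "smooth_gen (\<lambda>x. x $ i)"
| add: "smooth_gen f \<Longrightarrow> smooth_gen g \<Longrightarrow> smooth_gen (\<lambda>x. f x + g x)"
| mult: "smooth_gen f \<Longrightarrow> smooth_gen g \<Longrightarrow> smooth_gen (\<lambda>x. f x * g x)"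
| bump: "smooth_gen f \<Longrightarrow> smooth_gen (\<lambda>x. exp_bump p (f x))"

lemma pderiv_at_eqI:
  assumes "(f has_derivative (\<lambda>h. \<Sum>j\<in>UNIV. G j * h $ j)) (at x)"
  shows "pderiv_at j f x = G j"
proof -
  have "frechet_derivative f (at x) = (\<lambda>h. \<Sum>j\<in>UNIV. G j * h $ j)"
    using frechet_derivative_at[OF assms] by simp
  then show ?thesis
    by (simp add: pderiv_at_def axis_def if_distrib cong: if_cong)
qed

lemma smooth_gen_gradient:
  assumes "smooth_gen f"
  shows "\<exists>G. (\<forall>j. smooth_gen (G j)) \<and>
    (\<forall>x. (f has_derivative (\<lambda>h. \<Sum>j\<in>UNIV. G j x * h $ j)) (at x))"
  using assms
proof induction
  case (const c)
  show ?case
    by (intro exI[of _ "\<lambda>j x. 0"]) (auto intro: smooth_gen.const)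
next
  case (coord i)
  show ?case
    by (intro exI[of _ "\<lambda>j x. if j = i then 1 else 0"])
      (auto intro!: smooth_gen.const bounded_linear_imp_has_derivative[OF bounded_linear_vec_nth]
        simp: if_distrib[of "\<lambda>x. x * _"] cong: if_cong)
next
  case (add f g)
  then obtain F G where F: "\<forall>j. smooth_gen (F j)"
      "\<And>x. (f has_derivative (\<lambda>h. \<Sum>j\<in>UNIV. F j x * h $ j)) (at x)"
    and G: "\<forall>j. smooth_gen (G j)"
      "\<And>x. (g has_derivative (\<lambda>h. \<Sum>j\<in>UNIV. G j x * h $ j)) (at x)" by blast
  show ?case
  proof (intro exI[of _ "\<lambda>j x. F j x + G j x"] conjI allI)
    show "smooth_gen (\<lambda>x. F j x + G j x)" for j using F G smooth_gen.add by blast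
    show "((\<lambda>x. f x + g x) has_derivative (\<lambda>h. \<Sum>j\<in>UNIV. (F j x + G j x) * h $ j)) (at x)" for x
      using has_derivative_add[OF F(2) G(2)] by (simp add: algebra_simps sum.distrib)
  qed
next
  case (mult f g)
  then obtain F G where F: "\<forall>j. smooth_gen (F j)"
      "\<And>x. (f has_derivative (\<lambda>h. \<Sum>j\<in>UNIV. F j x * h $ j)) (at x)"
    and G: "\<forall>j. smooth_gen (G j)"
      "\<And>x. (g has_derivative (\<lambda>h. \<Sum>j\<in>UNIV. G j x * h $ j)) (at x)" by blast
  show ?case
  proof (intro exI[of _ "\<lambda>j x. f x * G j x + F j x * g x"] conjI allI)
    show "smooth_gen (\<lambda>x. f x * G j x + F j x * g x)" for j
      using F G mult.hyps by (intro smooth_gen.add smooth_gen.mult) auto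
    show "((\<lambda>x. f x * g x) has_derivative
        (\<lambda>h. \<Sum>j\<in>UNIV. (f x * G j x + F j x * g x) * h $ j)) (at x)" for x
      using has_derivative_mult[OF F(2) G(2)]
      by (simp add: algebra_simps sum.distrib sum_distrib_left sum_distrib_right)
  qed
next
  case (bump f p)
  then obtain F where F: "\<forall>j. smooth_gen (F j)"
      "\<And>x. (f has_derivative (\<lambda>h. \<Sum>j\<in>UNIV. F j x * h $ j)) (at x)" by blast
  let ?q = "[:0, 0, 1:] * (p - pderiv p)"
  show ?case
  proof (intro exI[of _ "\<lambda>j x. exp_bump ?q (f x) * F j x"] conjI allI)
    show "smooth_gen (\<lambda>x. exp_bump ?q (f x) * F j x)" for j
      using F bump.hyps by (intro smooth_gen.mult smooth_gen.bump) auto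
    show "((\<lambda>x. exp_bump p (f x)) has_derivative
        (\<lambda>h. \<Sum>j\<in>UNIV. (exp_bump ?q (f x) * F j x) * h $ j)) (at x)" for x
    proof -
      have "(exp_bump p has_derivative (*) (exp_bump ?q (f x))) (at (f x))"
        using exp_bump_deriv[of p "f x"] by (simp only: has_field_derivative_def)
      from has_derivative_compose[OF F(2) this]
      show ?thesis by (simp only: sum_distrib_left mult.assoc)
    qed
  qed
qed

lemma smooth_gen_has_derivative:
  assumes "smooth_gen f"
  shows "(f has_derivative (\<lambda>h. \<Sum>j\<in>UNIV. pderiv_at j f x * h $ j)) (at x)"
    and "smooth_gen (pderiv_at j f)"
proof -
  obtain G where G: "\<And>j. smooth_gen (G j)"
      "\<And>x. (f has_derivative (\<lambda>h. \<Sum>j\<in>UNIV. G j x * h $ j)) (at x)"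
    using smooth_gen_gradient[OF assms] by blast
  have eq: "pderiv_at j f = G j" for j
    using pderiv_at_eqI[OF G(2)] by blast
  show "(f has_derivative (\<lambda>h. \<Sum>j\<in>UNIV. pderiv_at j f x * h $ j)) (at x)"
    and "smooth_gen (pderiv_at j f)"
    using G by (simp_all add: eq)
qed

lemma smooth_gen_continuous: "smooth_gen f \<Longrightarrow> continuous_on S f"
  by (meson continuous_at_imp_continuous_on has_derivative_continuous smooth_gen_has_derivative(1))

lemma smooth_gen_sum:
  "finite I \<Longrightarrow> (\<And>i. i \<in> I \<Longrightarrow> smooth_gen (f i)) \<Longrightarrow> smooth_gen (\<lambda>x. \<Sum>i\<in>I. f i x)"
  by (induction I rule: finite_induct) (auto intro: smooth_gen.intros)

lemma smooth_gen_norm_bump: "smooth_gen (\<lambda>x::real^'n. exp_bump p (d - x \<bullet> x))"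
proof -
  have "smooth_gen (\<lambda>x::real^'n. \<Sum>i\<in>UNIV. x $ i * x $ i)"
    by (intro smooth_gen_sum smooth_gen.intros) auto
  then have "smooth_gen (\<lambda>x::real^'n. d + (-1) * (\<Sum>i\<in>UNIV. x $ i * x $ i))"
    by (intro smooth_gen.add smooth_gen.mult smooth_gen.const)
  from smooth_gen.bump[OF this, of p] show ?thesis
    by (simp add: inner_vec_def)
qed

lemma convolution_has_derivative:
  fixes u r :: "real^'n \<Rightarrow> real"
  assumes u: "continuous_on UNIV u" and r: "smooth_gen r"
  shows "((\<lambda>x. integral (cbox a b) (\<lambda>t. u t * r (x - t))) has_derivative
    (\<lambda>h. \<Sum>j\<in>UNIV. integral (cbox a b) (\<lambda>t. u t * pderiv_at j r (x - t)) * h $ j)) (at x)"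
proof -
  define B :: "'n \<Rightarrow> ((real^'n) \<Rightarrow>\<^sub>L real)" where "B j = blinfun_inner_right (axis j 1)" for j
  have B: "blinfun_apply (B j) h = h $ j" for j h by (simp add: B_def inner_axis')
  define fx where "fx x t = (\<Sum>j\<in>UNIV. (u t * pderiv_at j r (x - t)) *\<^sub>R B j)" for x t
  have rc: "continuous_on S (\<lambda>y. pderiv_at j r (f y))" if "continuous_on S f"
    for S :: "'b::topological_space set" and f j
    using continuous_on_compose2[OF smooth_gen_continuous[OF smooth_gen_has_derivative(2)[OF r]] that]
    by blast
  have uc: "continuous_on S (\<lambda>y. u (f y))" if "continuous_on S f"
    for S :: "'b::topological_space set" and f
    using continuous_on_compose2[OF u that] by blast
  have rc0: "continuous_on S (\<lambda>y. r (f y))" if "continuous_on S f"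
    for S :: "'b::topological_space set" and f
    using continuous_on_compose2[OF smooth_gen_continuous[OF r] that] by blast
  have int: "(\<lambda>t. u t * pderiv_at j r (x - t)) integrable_on cbox a b" for j
    by (intro integrable_continuous continuous_intros uc rc)
  have "((\<lambda>x. integral (cbox a b) (\<lambda>t. u t * r (x - t))) has_derivative integral (cbox a b) (fx x))
    (at x within UNIV)"
  proof (rule leibniz_rule)
    fix x t :: "real^'n"
    have "((\<lambda>x. r (x - t)) has_derivative (\<lambda>h. \<Sum>j\<in>UNIV. pderiv_at j r (x - t) * h $ j)) (at x)"
      using has_derivative_compose[OF _ smooth_gen_has_derivative(1)[OF r], of "\<lambda>x. x - t" "\<lambda>h. h" x UNIV]
      by (simp add: has_derivative_diff[OF has_derivative_ident has_derivative_const, simplified])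
    moreover have "blinfun_apply (fx x t) =
        (\<lambda>h. u t * (\<Sum>j\<in>UNIV. pderiv_at j r (x - t) * h $ j))"
      by (rule ext) (simp add: fx_def B blinfun.sum_left blinfun.scaleR_left sum_distrib_left mult.assoc)
    ultimately show "((\<lambda>x. u t * r (x - t)) has_derivative blinfun_apply (fx x t)) (at x within UNIV)"
      by (simp add: has_derivative_mult_right)
  next
    show "(\<lambda>t. u t * r (x - t)) integrable_on cbox a b" for x
      by (intro integrable_continuous continuous_intros uc rc0)
    show "continuous_on (UNIV \<times> cbox a b) (\<lambda>(x, t). fx x t)"
      unfolding fx_def case_prod_beta by (intro continuous_intros uc rc)
  qed auto
  moreover have *: "integral (cbox a b) (fx x) =
      (\<Sum>j\<in>UNIV. integral (cbox a b) (\<lambda>t. u t * pderiv_at j r (x - t)) *\<^sub>R B j)"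
    unfolding fx_def
    by (subst integral_sum)
      (auto intro!: integrable_on_scaleR_left int sum.cong
        integral_unique[OF has_integral_scaleR_left[OF integrable_integral[OF int]]])
  moreover have "blinfun_apply (integral (cbox a b) (fx x)) =
      (\<lambda>h. \<Sum>j\<in>UNIV. integral (cbox a b) (\<lambda>t. u t * pderiv_at j r (x - t)) * h $ j)"
    unfolding * by (rule ext) (simp add: B blinfun.sum_left blinfun.scaleR_left)
  ultimately show ?thesis by simp
qed

text \<open>Convolution with a member of the class is smooth: every derivative falls on that factor.\<close>

lemma convolution_Ck:
  fixes u r :: "real^'n \<Rightarrow> real"
  assumes u: "continuous_on UNIV u" and r: "smooth_gen r"
  shows "Ck k (\<lambda>x. integral (cbox a b) (\<lambda>t. u t * r (x - t)))"
  using r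
proof (induction k arbitrary: r)
  case 0
  have "continuous (at x) (\<lambda>x. integral (cbox a b) (\<lambda>t. u t * r (x - t)))" for x
    using convolution_has_derivative[OF u 0] has_derivative_continuous by blast
  then show ?case by (simp add: continuous_at_imp_continuous_on)
next
  case (Suc k)
  have *: "pderiv_at j (\<lambda>x. integral (cbox a b) (\<lambda>t. u t * r (x - t))) =
      (\<lambda>x. integral (cbox a b) (\<lambda>t. u t * pderiv_at j r (x - t)))" for j
    using pderiv_at_eqI[OF convolution_has_derivative[OF u Suc.prems]] by blast
  have "(\<lambda>x. integral (cbox a b) (\<lambda>t. u t * r (x - t))) differentiable at x" for x
    using convolution_has_derivative[OF u Suc.prems] differentiableI by blast
  then show ?case
    using Suc.IH[OF smooth_gen_has_derivative(2)[OF Suc.prems]] by (simp add: *)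
qed

text \<open>The unnormalised mollifier: smooth, positive on the open ball of radius \<open>d\<close>, zero outside.\<close>

definition ball_bump :: "real \<Rightarrow> real^'n \<Rightarrow> real" where
  "ball_bump d x = exp_bump 1 (d\<^sup>2 - x \<bullet> x)"

text \<open>The average of \<open>u\<close> over the ball of radius \<open>d\<close> around \<open>x\<close> with weight \<open>ball_bump d\<close>.\<close>

definition mollify :: "real \<Rightarrow> (real^'n \<Rightarrow> real) \<Rightarrow> real^'n \<Rightarrow> real" where
  "mollify d u x = (\<integral>z. u (x - z) * ball_bump d z \<partial>lborel) / (\<integral>z. ball_bump d (z::real^'n) \<partial>lborel)"

lemma ball_bump_nonneg: "ball_bump d x \<ge> 0"
  by (simp add: ball_bump_def exp_bump_def)

lemma ball_bump_pos: "norm x < d \<Longrightarrow> ball_bump d x > 0"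
proof -
  assume "norm x < d"
  then have "(norm x)\<^sup>2 < d\<^sup>2" by (intro power_strict_mono) auto
  then show ?thesis by (simp add: ball_bump_def exp_bump_def dot_square_norm)
qed

lemma ball_bump_eq_0: "norm x \<ge> d \<Longrightarrow> d > 0 \<Longrightarrow> ball_bump d x = 0"
proof -
  assume "norm x \<ge> d" "d > 0"
  then have "(norm x)\<^sup>2 \<ge> d\<^sup>2" by (intro power_mono) auto
  then show ?thesis by (simp add: ball_bump_def exp_bump_def dot_square_norm)
qed

lemma smooth_gen_ball_bump: "smooth_gen (ball_bump d)"
proof -
  have "ball_bump d = (\<lambda>x::real^'n. exp_bump 1 (d\<^sup>2 - x \<bullet> x))" by (simp add: fun_eq_iff ball_bump_def)
  then show ?thesis by (rule ssubst) (rule smooth_gen_norm_bump)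
qed

lemma continuous_ball_bump: "continuous_on S (ball_bump d)"
  by (rule smooth_gen_continuous[OF smooth_gen_ball_bump])

lemma integrable_continuous_bounded_support:
  fixes f :: "'a::euclidean_space \<Rightarrow> real"
  assumes "continuous_on UNIV f" "\<And>x. R < norm x \<Longrightarrow> f x = 0"
  shows "integrable lborel f"
proof -
  have "integrable lborel (\<lambda>x. indicator (cball 0 R) x *\<^sub>R f x)"
    using assms(1) by (intro borel_integrable_compact) (auto intro: continuous_on_subset)
  moreover have "(\<lambda>x. indicator (cball 0 R) x *\<^sub>R f x) = f"
    using assms(2) by (auto simp: fun_eq_iff indicator_def not_le)
  ultimately show ?thesis by simp
qed

lemma integrable_times_ball_bump:
  fixes F :: "real^'n \<Rightarrow> real"
  assumes "continuous_on UNIV F" "d > 0"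
  shows "integrable lborel (\<lambda>z. F z * ball_bump d z)"
  using assms
  by (intro integrable_continuous_bounded_support[where R = d] continuous_intros continuous_ball_bump)
    (auto simp: ball_bump_eq_0)

lemma integrable_ball_bump: "d > 0 \<Longrightarrow> integrable lborel (ball_bump d)"
  using integrable_times_ball_bump[of "\<lambda>_. 1" d] by simp

lemma ball_bump_mass_pos:
  assumes "d > 0"
  shows "(\<integral>z. ball_bump d (z::real^'n) \<partial>lborel) > 0"
proof -
  have "(\<integral>z. ball_bump d (z::real^'n) \<partial>lborel) \<noteq> 0"
  proof
    assume "(\<integral>z. ball_bump d (z::real^'n) \<partial>lborel) = 0"
    then have "AE z in lborel. ball_bump d (z::real^'n) = 0"
      using integral_nonneg_eq_0_iff_AE[OF integrable_ball_bump[OF assms]] ball_bump_nonneg by auto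
    then have "AE z in lborel. (z::real^'n) \<notin> ball 0 d"
      by eventually_elim (use ball_bump_pos in force)
    then have "emeasure lborel (ball (0::real^'n) d) = 0"
      by (subst (asm) AE_iff_measurable[OF _ refl]) (auto simp: ball_def)
    then have "ball (0::real^'n) d \<in> null_sets lborel" by auto
    then have "negligible (ball (0::real^'n) d)"
      by (simp add: negligible_iff_null_sets null_sets_completionI)
    then show False using open_not_negligible[of "ball (0::real^'n) d"] assms by simp
  qed
  moreover have "(\<integral>z. ball_bump d (z::real^'n) \<partial>lborel) \<ge> 0"
    by (intro integral_nonneg_AE) (simp add: ball_bump_nonneg)
  ultimately show ?thesis by linarith
qed

lemma ball_bump_average_bound:
  fixes F :: "real^'n \<Rightarrow> real"
  assumes F: "continuous_on UNIV F" and d: "d > 0" and M: "\<And>z. norm z < d \<Longrightarrow> \<bar>F z\<bar> \<le> M"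
  shows "\<bar>(\<integral>z. F z * ball_bump d z \<partial>lborel) / (\<integral>z. ball_bump d (z::real^'n) \<partial>lborel)\<bar> \<le> M"
proof -
  let ?m = "\<integral>z. ball_bump d (z::real^'n) \<partial>lborel"
  have pos: "?m > 0" by (rule ball_bump_mass_pos[OF d])
  have "\<bar>\<integral>z. F z * ball_bump d z \<partial>lborel\<bar> \<le> (\<integral>z. \<bar>F z * ball_bump d z\<bar> \<partial>lborel)"
    by (rule integral_abs_bound)
  also have "\<dots> \<le> (\<integral>z. M * ball_bump d (z::real^'n) \<partial>lborel)"
  proof (rule integral_mono)
    show "integrable lborel (\<lambda>z. \<bar>F z * ball_bump d z\<bar>)"
      using integrable_times_ball_bump[OF F d] by (rule integrable_abs)
    show "integrable lborel (\<lambda>z::real^'n. M * ball_bump d z)"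
      by (simp add: integrable_ball_bump[OF d])
    fix z :: "real^'n"
    show "\<bar>F z * ball_bump d z\<bar> \<le> M * ball_bump d z"
    proof (cases "norm z < d")
      case True
      then show ?thesis
        using M[OF True] ball_bump_nonneg[of d z] by (simp add: abs_mult mult_right_mono)
    next
      case False
      then show ?thesis using d by (simp add: ball_bump_eq_0)
    qed
  qed
  also have "\<dots> = M * ?m" by simp
  finally have "\<bar>\<integral>z. F z * ball_bump d z \<partial>lborel\<bar> \<le> M * ?m" .
  then show ?thesis using pos by (simp add: pos_divide_le_eq)
qed

lemma continuous_on_diff_arg:
  "continuous_on UNIV u \<Longrightarrow> continuous_on UNIV (\<lambda>z. u (x - z :: 'a::real_normed_vector) :: real)"
  by (rule continuous_on_compose2[of UNIV u]) (auto intro!: continuous_intros)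

lemma mollify_diff_bound:
  fixes u :: "real^'n \<Rightarrow> real"
  assumes u: "continuous_on UNIV u" and d: "d > 0"
    and M: "\<And>z. norm z < d \<Longrightarrow> \<bar>u (x - z) - c\<bar> \<le> M"
  shows "\<bar>mollify d u x - c\<bar> \<le> M"
proof -
  let ?m = "\<integral>z. ball_bump d (z::real^'n) \<partial>lborel"
  have pos: "?m > 0" by (rule ball_bump_mass_pos[OF d])
  have "(\<integral>z. (u (x - z) - c) * ball_bump d z \<partial>lborel) =
      (\<integral>z. u (x - z) * ball_bump d z \<partial>lborel) - c * ?m"
    unfolding left_diff_distrib
    using integrable_times_ball_bump[OF continuous_on_diff_arg[OF u] d] integrable_ball_bump[OF d]
    by (subst Bochner_Integration.integral_diff) auto
  then have "mollify d u x - c = (\<integral>z. (u (x - z) - c) * ball_bump d z \<partial>lborel) / ?m"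
    using pos by (simp add: mollify_def field_simps)
  then show ?thesis
    using M by (simp only:) (intro ball_bump_average_bound d continuous_intros continuous_on_diff_arg u)
qed

lemma mollify_lipschitz:
  fixes u :: "real^'n \<Rightarrow> real"
  assumes u: "continuous_on UNIV u" and d: "d > 0"
    and L: "\<And>x y. \<bar>u x - u y\<bar> \<le> L * norm (x - y)"
  shows "\<bar>mollify d u x - mollify d u y\<bar> \<le> L * norm (x - y)"
proof -
  have "(\<integral>z. (u (x - z) - u (y - z)) * ball_bump d z \<partial>lborel) =
      (\<integral>z. u (x - z) * ball_bump d z \<partial>lborel) - (\<integral>z. u (y - z) * ball_bump d z \<partial>lborel)"
    unfolding left_diff_distrib
    using integrable_times_ball_bump[OF continuous_on_diff_arg[OF u] d]
    by (subst Bochner_Integration.integral_diff) auto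
  then have "mollify d u x - mollify d u y =
      (\<integral>z. (u (x - z) - u (y - z)) * ball_bump d z \<partial>lborel) / (\<integral>z. ball_bump d (z::real^'n) \<partial>lborel)"
    by (simp add: mollify_def diff_divide_distrib)
  moreover have "\<bar>u (x - z) - u (y - z)\<bar> \<le> L * norm (x - y)" for z
    using L[of "x - z" "y - z"] by simp
  ultimately show ?thesis
    by (simp only:) (intro ball_bump_average_bound d continuous_intros continuous_on_diff_arg u)
qed

text \<open>Mollification of a function that is affine near \<open>x0\<close> is affine near \<open>x0\<close> with the same gradient.\<close>

lemma mollify_affine:
  fixes u :: "real^'n \<Rightarrow> real"
  assumes u: "continuous_on UNIV u" and d: "d > 0"
    and aff: "\<And>y. dist x0 y < 2 * d \<Longrightarrow> u y = a \<bullet> y + b"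
  shows "\<exists>b'. \<forall>x. dist x0 x < d \<longrightarrow> mollify d u x = a \<bullet> x + b'"
proof -
  let ?m = "\<integral>z. ball_bump d (z::real^'n) \<partial>lborel"
  have pos: "?m > 0" by (rule ball_bump_mass_pos[OF d])
  define I where "I = (\<integral>z. (a \<bullet> z) * ball_bump d z \<partial>lborel)"
  have "mollify d u x = a \<bullet> x + (b - I / ?m)" if x: "dist x0 x < d" for x
  proof -
    have "u (x - z) * ball_bump d z = (a \<bullet> x + b) * ball_bump d z - (a \<bullet> z) * ball_bump d z" for z
    proof (cases "norm z < d")
      case True
      have "dist x0 (x - z) \<le> dist x0 x + norm z"
        using norm_triangle_ineq[of "x0 - x" z] by (simp add: dist_norm algebra_simps)
      then have e: "u (x - z) = a \<bullet> x + b - a \<bullet> z"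
        using aff[of "x - z"] x True by (simp add: algebra_simps inner_diff_right)
      show ?thesis unfolding e by (simp add: algebra_simps)
    next
      case False
      then show ?thesis using d by (simp add: ball_bump_eq_0)
    qed
    then have "(\<integral>z. u (x - z) * ball_bump d z \<partial>lborel) =
       (\<integral>z. (a \<bullet> x + b) * ball_bump d z - (a \<bullet> z) * ball_bump d z \<partial>lborel)" by simp
    also have "\<dots> = (a \<bullet> x + b) * ?m - I"
      unfolding I_def using integrable_ball_bump[OF d]
      by (subst Bochner_Integration.integral_diff)
        (auto intro!: integrable_times_ball_bump d continuous_intros)
    finally show ?thesis using pos by (simp add: mollify_def field_simps)
  qed
  then show ?thesis by blast
qed

lemma mollify_Ck:
  fixes u :: "real^'n \<Rightarrow> real"
  assumes u: "continuous_on UNIV u" and d: "d > 0" and R: "\<And>x. R < norm x \<Longrightarrow> u x = 0"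
  shows "Ck k (mollify d u)"
proof -
  let ?m = "\<integral>z. ball_bump d (z::real^'n) \<partial>lborel"
  obtain a b where ab: "cball (0::real^'n) R \<subseteq> cbox a b"
    using bounded_subset_cbox_symmetric[OF bounded_cball] by blast
  have "mollify d u x = integral (cbox a b) (\<lambda>t. u t * (inverse ?m * ball_bump d (x - t)))" for x
  proof -
    define f where "f t = u t * ball_bump d (x - t)" for t
    have fc: "continuous_on UNIV f"
      unfolding f_def using u by (intro continuous_intros continuous_on_diff_arg continuous_ball_bump)
    have f0: "R < norm t \<Longrightarrow> f t = 0" for t using R by (simp add: f_def)
    have fi: "integrable lborel f" using fc f0 by (rule integrable_continuous_bounded_support)
    \<comment> \<open>reflection and translation preserve Lebesgue measure\<close>
    have "(lborel :: (real^'n) measure) = density (distr lborel borel (\<lambda>z. x + (-1) *\<^sub>R z)) (\<lambda>_. 1)"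
      using lborel_affine[of "-1" x] by simp
    then have dist: "distr lborel borel (\<lambda>z::real^'n. x - z) = lborel" by (simp add: density_1)
    have "integral\<^sup>L lborel f = integral\<^sup>L (distr lborel borel (\<lambda>z::real^'n. x - z)) f"
      by (simp only: dist)
    also have "\<dots> = (\<integral>z. f (x - z) \<partial>lborel)"
      by (rule integral_distr) (use borel_measurable_continuous_onI[OF fc] in auto)
    also have "\<dots> = (\<integral>z. u (x - z) * ball_bump d z \<partial>lborel)" by (simp add: f_def)
    finally have 1: "integral\<^sup>L lborel f = (\<integral>z. u (x - z) * ball_bump d z \<partial>lborel)" .
    have "integral (cbox a b) f = integral UNIV (\<lambda>t. if t \<in> cbox a b then f t else 0)"
      by (simp add: integral_restrict_UNIV)
    also have "(\<lambda>t. if t \<in> cbox a b then f t else 0) = f"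
    proof (rule ext)
      fix t show "(if t \<in> cbox a b then f t else 0) = f t"
        using f0[of t] ab by (cases "norm t \<le> R") (auto simp: subset_iff)
    qed
    finally have "integral (cbox a b) f = integral\<^sup>L lborel f" using integral_lborel[OF fi] by simp
    then have "mollify d u x = inverse ?m * integral (cbox a b) f"
      using 1 by (simp add: mollify_def field_simps)
    then show ?thesis by (simp add: f_def mult.left_commute flip: integral_mult_right)
  qed
  then have "mollify d u = (\<lambda>x. integral (cbox a b) (\<lambda>t. u t * (inverse ?m * ball_bump d (x - t))))"
    by blast
  moreover have "smooth_gen (\<lambda>x. inverse ?m * ball_bump d x)"
    by (intro smooth_gen.mult smooth_gen.const smooth_gen_ball_bump)
  ultimately show ?thesis using convolution_Ck[OF u] by simp
qed

section \<open>Lipschitz functions vanishing off the domain belong to \<open>H\<^sup>1\<^sub>0\<close>\<close>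

lemma directional_quotient_tendsto:
  assumes "(f has_derivative D) (at x)"
  shows "((\<lambda>t. (f (x + t *\<^sub>R e) - f x) / t) \<longlongrightarrow> (D e :: real)) (at 0)"
proof -
  have "((\<lambda>t::real. x + t *\<^sub>R e) has_derivative (\<lambda>t. t *\<^sub>R e)) (at 0)"
    by (auto intro!: derivative_eq_intros)
  from has_derivative_compose[OF this, of f D]
  have "((\<lambda>t. f (x + t *\<^sub>R e)) has_derivative (\<lambda>t. D (t *\<^sub>R e))) (at 0)"
    using assms by simp
  moreover have "D (t *\<^sub>R e) = D e * t" for t
    using linear_cmul[OF has_derivative_linear[OF assms]] by simp
  ultimately have "((\<lambda>t. f (x + t *\<^sub>R e)) has_real_derivative D e) (at 0)"
    by (simp add: has_field_derivative_def)
  then show ?thesis by (simp add: DERIV_def)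
qed

lemma pderiv_at_sequence:
  assumes "f differentiable at x"
  shows "(\<lambda>n. real (Suc n) * (f (x + inverse (real (Suc n)) *\<^sub>R axis j 1) - f x)) \<longlonglongrightarrow> pderiv_at j f x"
proof -
  have D: "(f has_derivative frechet_derivative f (at x)) (at x)"
    using assms frechet_derivative_works by blast
  have "filterlim (\<lambda>n. inverse (real (Suc n))) (at 0) sequentially"
    using LIMSEQ_inverse_real_of_nat by (auto simp: filterlim_at)
  from filterlim_compose[OF directional_quotient_tendsto[OF D, of "axis j 1"] this]
  show ?thesis by (simp add: pderiv_at_def field_simps)
qed

lemma abs_quotient_bound: "\<bar>d\<bar> \<le> L * inverse (real (Suc n)) \<Longrightarrow> \<bar>real (Suc n) * d\<bar> \<le> L"
  using mult_left_mono[of "\<bar>d\<bar>" "L * inverse (real (Suc n))" "real (Suc n)"]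
  by (simp add: abs_mult mult.left_commute del: of_nat_Suc)

lemma pderiv_at_lipschitz_bound:
  assumes "f differentiable at x" and L: "\<And>y. \<bar>f y - f x\<bar> \<le> L * norm (y - x)"
  shows "\<bar>pderiv_at j f x\<bar> \<le> L"
proof (rule tendsto_upperbound[OF tendsto_rabs[OF pderiv_at_sequence[OF assms(1)]]])
  show "\<forall>\<^sub>F n in sequentially.
      \<bar>real (Suc n) * (f (x + inverse (real (Suc n)) *\<^sub>R axis j 1) - f x)\<bar> \<le> L"
  proof (intro always_eventually allI)
    fix n
    have "\<bar>f (x + inverse (real (Suc n)) *\<^sub>R axis j 1) - f x\<bar> \<le> L * inverse (real (Suc n))"
      using L[of "x + inverse (real (Suc n)) *\<^sub>R axis j 1"] by (simp add: norm_axis_1)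
    then show "\<bar>real (Suc n) * (f (x + inverse (real (Suc n)) *\<^sub>R axis j 1) - f x)\<bar> \<le> L"
      by (rule abs_quotient_bound)
  qed
qed simp

lemma locally_affine_has_derivative:
  fixes a :: "real^'n"
  assumes "r > 0" "\<forall>y. dist x y < r \<longrightarrow> f y = a \<bullet> y + b"
  shows "(f has_derivative (\<lambda>h. a \<bullet> h)) (at x)" and "pderiv_at j f x = a $ j"
proof -
  have "((\<lambda>y. a \<bullet> y + b) has_derivative (\<lambda>h. a \<bullet> h)) (at x)"
    by (auto intro!: derivative_eq_intros)
  then show 1: "(f has_derivative (\<lambda>h. a \<bullet> h)) (at x)"
    by (rule has_derivative_transform_within_open[of _ _ _ _ "ball x r"]) (use assms in auto)
  then show "pderiv_at j f x = a $ j"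
    by (intro pderiv_at_eqI) (simp add: inner_vec_def)
qed

lemma locally_affine_quotient:
  fixes a :: "real^'n"
  assumes "r > 0" "\<forall>y. dist x y < r \<longrightarrow> f y = a \<bullet> y + b" "norm e = 1"
  shows "\<forall>\<^sub>F n in sequentially. real (Suc n) * (f (x + inverse (real (Suc n)) *\<^sub>R e) - f x) = a \<bullet> e"
proof -
  have "\<forall>\<^sub>F n in sequentially. inverse (real (Suc n)) < r"
    using LIMSEQ_inverse_real_of_nat assms(1) order_tendstoD(2) by blast
  then show ?thesis
  proof eventually_elim
    case (elim n)
    then show ?case
      using spec[OF assms(2), of x] spec[OF assms(2), of "x + inverse (real (Suc n)) *\<^sub>R e"] assms(1,3)
      by (simp add: dist_norm inner_add_right)
  qed
qed

text \<open>Shrinking towards zero by \<open>e\<close>: the values in \<open>[-e, e]\<close> become zero, the others move by \<open>e\<close>.\<close>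

definition truncate_by :: "real \<Rightarrow> real \<Rightarrow> real" where
  "truncate_by e s = max (s - e) 0 - max (- s - e) 0"

lemma truncate_by_lipschitz: "\<bar>truncate_by e s - truncate_by e t\<bar> \<le> \<bar>s - t\<bar>" if "e \<ge> 0"
  using that unfolding truncate_by_def by linarith

lemma truncate_by_eq_0: "\<bar>s\<bar> \<le> e \<Longrightarrow> truncate_by e s = 0"
  unfolding truncate_by_def by linarith

lemma truncate_by_diff: "e \<ge> 0 \<Longrightarrow> \<bar>truncate_by e s - s\<bar> \<le> e"
  unfolding truncate_by_def by linarith

lemma borel_imp_lebesgue_on:
  fixes f :: "'a::euclidean_space \<Rightarrow> real"
  shows "f \<in> borel_measurable borel \<Longrightarrow> f \<in> borel_measurable (lebesgue_on S)"
  by (intro measurable_restrict_space1 measurable_completion) simp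

lemma L2_inner_borel:
  assumes "open \<Omega>" "f \<in> borel_measurable borel" "g \<in> borel_measurable borel"
  shows "L2_inner \<Omega> f g = (\<integral>x. indicator \<Omega> x * (f x * g x) \<partial>lborel)"
proof -
  have [measurable]: "f \<in> borel_measurable borel" "g \<in> borel_measurable borel" "\<Omega> \<in> sets borel"
    using assms by auto
  have "L2_inner \<Omega> f g = (\<integral>x. indicator \<Omega> x *\<^sub>R (f x * g x) \<partial>lebesgue)"
    unfolding L2_inner_def using assms by (subst integral_restrict_space) auto
  also have "\<dots> = (\<integral>x. indicator \<Omega> x *\<^sub>R (f x * g x) \<partial>lborel)"
    by (rule integral_completion) measurable
  finally show ?thesis by simp
qed

lemma integrable_indicator_bounded:
  "bounded (\<Omega>::'a::euclidean_space set) \<Longrightarrow> open \<Omega> \<Longrightarrow> integrable lborel (\<lambda>x. indicator \<Omega> x * (c::real))"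
  using emeasure_bounded_finite[of \<Omega>] by (intro integrable_mult_left integrable_real_indicator) auto

lemma L2_boundedI:
  fixes f :: "real^'n \<Rightarrow> real"
  assumes \<Omega>: "open \<Omega>" "bounded \<Omega>" and f: "f \<in> borel_measurable borel" and B: "AE x in lborel. \<bar>f x\<bar> \<le> B"
  shows "f \<in> L2 \<Omega>"
proof -
  have [measurable]: "f \<in> borel_measurable borel" "\<Omega> \<in> sets borel" using f \<Omega> by auto
  have "integrable lborel (\<lambda>x. indicator \<Omega> x * (f x)\<^sup>2)"
  proof (rule Bochner_Integration.integrable_bound[OF integrable_indicator_bounded[OF \<Omega>(2,1), of "B\<^sup>2"]])
    show "AE x in lborel. norm (indicator \<Omega> x * (f x)\<^sup>2) \<le> norm (indicator \<Omega> x * B\<^sup>2)"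
      using B
    proof eventually_elim
      case (elim x)
      then have "(f x)\<^sup>2 \<le> B\<^sup>2" by (meson abs_ge_zero order_trans power2_le_iff_abs_le)
      then show ?case by (simp add: indicator_def)
    qed
  qed measurable
  then have "integrable lebesgue (\<lambda>x. indicator \<Omega> x *\<^sub>R (f x)\<^sup>2)"
    by (subst integrable_completion) auto
  then show ?thesis
    unfolding L2_def using borel_imp_lebesgue_on[OF f] \<Omega> by (auto simp: integrable_restrict_space)
qed

lemma L2_norm_tendsto_0:
  fixes f :: "nat \<Rightarrow> real^'n \<Rightarrow> real"
  assumes \<Omega>: "open \<Omega>" "bounded \<Omega>" and f: "\<And>n. f n \<in> borel_measurable borel"
    and B: "\<And>n. AE x in lborel. \<bar>f n x\<bar> \<le> B" and lim: "AE x in lborel. (\<lambda>n. f n x) \<longlonglongrightarrow> 0"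
  shows "(\<lambda>n. L2_norm \<Omega> (f n)) \<longlonglongrightarrow> 0"
proof -
  have [measurable]: "f n \<in> borel_measurable borel" "\<Omega> \<in> sets borel" for n using f \<Omega> by auto
  have "(\<lambda>n. \<integral>x. indicator \<Omega> x * (f n x * f n x) \<partial>lborel) \<longlonglongrightarrow> (\<integral>x. 0 \<partial>(lborel :: (real^'n) measure))"
  proof (rule integral_dominated_convergence[where w = "\<lambda>x. indicator \<Omega> x * B\<^sup>2"])
    show "integrable lborel (\<lambda>x. indicator \<Omega> x * B\<^sup>2)"
      by (rule integrable_indicator_bounded[OF \<Omega>(2,1)])
    show "AE x in lborel. (\<lambda>n. indicator \<Omega> x * (f n x * f n x)) \<longlonglongrightarrow> 0"
      using lim by eventually_elim (auto intro!: tendsto_eq_intros)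
    show "AE x in lborel. norm (indicator \<Omega> x * (f n x * f n x)) \<le> indicator \<Omega> x * B\<^sup>2" for n
      using B[of n]
    proof eventually_elim
      case (elim x)
      then have "(f n x)\<^sup>2 \<le> B\<^sup>2" by (meson abs_ge_zero order_trans power2_le_iff_abs_le)
      then show ?case by (simp add: indicator_def power2_eq_square)
    qed
  qed measurable
  then have "(\<lambda>n. sqrt (\<integral>x. indicator \<Omega> x * (f n x * f n x) \<partial>lborel)) \<longlonglongrightarrow> sqrt 0"
    by (intro tendsto_real_sqrt) simp
  then show ?thesis using f \<Omega> by (simp add: L2_norm_def L2_inner_borel)
qed

text \<open>The limit of forward difference quotients. It is Borel measurable for every Borel function,
  and equals the gradient wherever the function is locally affine; at other points its value is
  arbitrary.\<close>

definition quotient_gradient :: "(real^'n \<Rightarrow> real) \<Rightarrow> real^'n \<Rightarrow> real^'n" where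
  "quotient_gradient w x =
     (\<chi> j. lim (\<lambda>n. real (Suc n) * (w (x + inverse (real (Suc n)) *\<^sub>R axis j 1) - w x)))"

lemma quotient_gradient_borel:
  fixes w :: "real^'n \<Rightarrow> real"
  assumes "w \<in> borel_measurable borel"
  shows "(\<lambda>x. quotient_gradient w x $ j) \<in> borel_measurable borel"
proof -
  have [measurable]: "w \<in> borel_measurable borel" by fact
  show ?thesis unfolding quotient_gradient_def by simp
qed

lemma quotient_gradient_affine:
  fixes a :: "real^'n"
  assumes "r > 0" "\<forall>y. dist x y < r \<longrightarrow> w y = a \<bullet> y + b"
  shows "quotient_gradient w x = a"
proof -
  have "(\<lambda>n. real (Suc n) * (w (x + inverse (real (Suc n)) *\<^sub>R axis j 1) - w x)) \<longlonglongrightarrow> a $ j" for j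
    using locally_affine_quotient[OF assms, where e = "axis j 1"]
    by (intro tendsto_eventually) (simp add: norm_axis_1 inner_axis)
  then show ?thesis by (simp add: quotient_gradient_def limI vec_eq_iff)
qed

lemma test_function_facts:
  assumes "\<phi> \<in> test_functions \<Omega>"
  shows "\<phi> differentiable at x" "continuous_on S \<phi>" "continuous_on S (pderiv_at j \<phi>)"
    "x \<notin> \<Omega> \<Longrightarrow> \<phi> x = 0" "\<exists>R. \<forall>x. R < norm x \<longrightarrow> \<phi> x = 0"
proof -
  have k: "Ck k \<phi>" for k using assms by (auto simp: test_functions_def)
  show "\<phi> differentiable at x" using k[of "Suc 0"] by simp
  show "continuous_on S \<phi>" using k[of 0] by (auto intro: continuous_on_subset)
  have "Ck (Suc 0) \<phi>" by (rule k)
  then show "continuous_on S (pderiv_at j \<phi>)" by (auto intro: continuous_on_subset)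
  have sub: "{x. \<phi> x \<noteq> 0} \<subseteq> closure {x. \<phi> x \<noteq> 0}" by (rule closure_subset)
  then show "x \<notin> \<Omega> \<Longrightarrow> \<phi> x = 0" using assms by (auto simp: test_functions_def)
  have "bounded {x. \<phi> x \<noteq> 0}"
    using assms sub by (auto simp: test_functions_def intro: bounded_subset compact_imp_bounded)
  then obtain R where "\<forall>x\<in>{x. \<phi> x \<noteq> 0}. norm x \<le> R" by (auto simp: bounded_iff)
  then show "\<exists>R. \<forall>x. R < norm x \<longrightarrow> \<phi> x = 0" by (intro exI[of _ R]) force
qed

lemma lborel_integral_translate:
  fixes f :: "'a::euclidean_space \<Rightarrow> real"
  assumes "f \<in> borel_measurable borel"
  shows "(\<integral>x. f (c + x) \<partial>lborel) = (\<integral>x. f x \<partial>lborel)"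
proof -
  have "(\<integral>x. f x \<partial>lborel) = (\<integral>x. f x \<partial>distr lborel borel ((+) c))" by (simp add: lborel_distr_plus)
  also have "\<dots> = (\<integral>x. f (c + x) \<partial>lborel)" by (rule integral_distr) (use assms in auto)
  finally show ?thesis by simp
qed

text \<open>Lipschitz functions that vanish off a bounded domain and are locally affine almost everywhere,
  where almost every zero of \<open>w\<close> has a neighbourhood on which \<open>w\<close> vanishes. The last condition
  keeps the kinks of the truncations of \<open>w\<close> away from almost every given point, once the
  truncation height is small.\<close>

locale lipschitz_piecewise =
  fixes \<Omega> :: "(real^'n) set" and w :: "real^'n \<Rightarrow> real" and L :: real
  assumes \<Omega>: "open \<Omega>" "bounded \<Omega>"
    and L: "\<And>x y. \<bar>w x - w y\<bar> \<le> L * norm (x - y)" and L0: "L \<ge> 0"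
    and zero: "\<And>x. x \<notin> \<Omega> \<Longrightarrow> w x = 0"
    and aff: "AE x in lborel. \<exists>a b. \<exists>r>0. (\<forall>y. dist x y < r \<longrightarrow> w y = a \<bullet> y + b) \<and> (a \<noteq> 0 \<longrightarrow> w x \<noteq> 0)"
begin

lemma w_continuous: "continuous_on S w"
proof -
  have "L-lipschitz_on UNIV w" using L L0 by (auto simp: lipschitz_on_def dist_norm dist_real_def)
  then show ?thesis using lipschitz_on_continuous_on continuous_on_subset by blast
qed

lemma w_borel[measurable]: "w \<in> borel_measurable borel"
  by (rule borel_measurable_continuous_onI[OF w_continuous])

lemma gradient_borel[measurable]: "(\<lambda>x. quotient_gradient w x $ j) \<in> borel_measurable borel"
  by (rule quotient_gradient_borel[OF w_borel])

lemma domain_ball: obtains R where "R > 0" "\<And>x. R < norm x \<Longrightarrow> x \<notin> \<Omega>"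
proof -
  obtain R where "R > 0" "\<forall>x\<in>\<Omega>. norm x \<le> R" using \<Omega>(2) by (auto simp: bounded_pos)
  then show thesis using that[of R] by force
qed

lemma w_bounded: obtains B where "B \<ge> 0" "\<And>x. \<bar>w x\<bar> \<le> B"
proof -
  obtain R where R: "R > 0" "\<And>x. R < norm x \<Longrightarrow> x \<notin> \<Omega>" using domain_ball by blast
  have "compact (w ` cball 0 R)" by (intro compact_continuous_image w_continuous compact_cball)
  then obtain B where "\<forall>y\<in>w ` cball 0 R. norm y \<le> B"
    using compact_imp_bounded bounded_iff by blast
  then have B: "\<And>x. norm x \<le> R \<Longrightarrow> \<bar>w x\<bar> \<le> B" by simp
  have "\<bar>w x\<bar> \<le> max B 0" for x using B[of x] zero[of x] R(2)[of x] by (cases "norm x \<le> R") auto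
  then show thesis using that[of "max B 0"] by auto
qed

lemma quotient_bound:
  assumes "norm e = 1"
  shows "\<bar>real (Suc n) * (w (x + inverse (real (Suc n)) *\<^sub>R e) - w x)\<bar> \<le> L"
proof -
  have "\<bar>w (x + inverse (real (Suc n)) *\<^sub>R e) - w x\<bar> \<le> L * inverse (real (Suc n))"
    using L[of "x + inverse (real (Suc n)) *\<^sub>R e" x] assms by simp
  then show ?thesis by (rule abs_quotient_bound)
qed

lemma gradient_bound: "AE x in lborel. \<bar>quotient_gradient w x $ j\<bar> \<le> L"
  using aff
proof eventually_elim
  case (elim x)
  then obtain a b r where r: "r > 0" "\<forall>y. dist x y < r \<longrightarrow> w y = a \<bullet> y + b" by blast
  have "\<bar>pderiv_at j w x\<bar> \<le> L"
    using locally_affine_has_derivative(1)[OF r] L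
    by (intro pderiv_at_lipschitz_bound) (auto intro: differentiableI)
  then show ?case
    using locally_affine_has_derivative(2)[OF r] quotient_gradient_affine[OF r] by simp
qed

text \<open>Integration by parts, by moving the translation in a difference quotient from the test function
  to \<open>w\<close> and passing to the limit on both sides by dominated convergence.\<close>

lemma weak_gradient: "weak_gradient \<Omega> w (quotient_gradient w)"
  unfolding weak_gradient_def
proof (intro conjI ballI allI)
  show "quotient_gradient w \<in> vec_space (L2 \<Omega>)"
    unfolding vec_space_def using L2_boundedI[OF \<Omega> gradient_borel gradient_bound] by simp
next
  fix \<phi> j assume \<phi>: "\<phi> \<in> test_functions \<Omega>"
  note facts = test_function_facts[OF \<phi>]
  have [measurable]: "\<phi> \<in> borel_measurable borel" "pderiv_at j \<phi> \<in> borel_measurable borel"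
    by (auto intro!: borel_measurable_continuous_onI facts)
  define e where "e = (axis j 1 :: real^'n)"
  have e1: "norm e = 1" by (simp add: e_def norm_axis_1)
  define h where "h n = inverse (real (Suc n))" for n
  have h: "0 < h n" "h n \<le> 1" for n by (auto simp: h_def field_simps)
  obtain R where R: "R > 0" "\<And>x. R < norm x \<Longrightarrow> x \<notin> \<Omega>" using domain_ball by blast
  obtain R' where R': "\<And>x. R' < norm x \<Longrightarrow> \<phi> x = 0" using facts(5) by blast
  obtain B where B: "B \<ge> 0" "\<And>x. \<bar>w x\<bar> \<le> B" using w_bounded by blast
  have "compact (pderiv_at j \<phi> ` cball 0 (R + 1))"
    by (intro compact_continuous_image facts compact_cball)
  then obtain M where "\<forall>y\<in>pderiv_at j \<phi> ` cball 0 (R + 1). norm y \<le> M"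
    using compact_imp_bounded bounded_iff by blast
  then have M: "\<And>x. norm x \<le> R + 1 \<Longrightarrow> \<bar>pderiv_at j \<phi> x\<bar> \<le> M" by simp
  have M0: "M \<ge> 0" using M[of 0] R(1) by force
  have shiftc: "continuous_on UNIV (\<lambda>x. f (x + c))" if "continuous_on UNIV f"
    for f :: "real^'n \<Rightarrow> real" and c
    by (rule continuous_on_compose2[OF that]) (auto intro!: continuous_intros)
  have qb: "\<bar>real (Suc n) * (\<phi> (x + h n *\<^sub>R e) - \<phi> x)\<bar> \<le> M" if x: "norm x \<le> R" for n x
  proof -
    have "((\<lambda>t. \<phi> (x + t *\<^sub>R e)) has_real_derivative pderiv_at j \<phi> (x + t *\<^sub>R e)) (at t)" for t
    proof -
      have "((\<lambda>s. (\<phi> ((x + t *\<^sub>R e) + s *\<^sub>R e) - \<phi> (x + t *\<^sub>R e)) / s) \<longlongrightarrow>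
          frechet_derivative \<phi> (at (x + t *\<^sub>R e)) e) (at 0)"
        using facts(1) frechet_derivative_works by (intro directional_quotient_tendsto) blast
      then show ?thesis
        by (simp add: DERIV_def pderiv_at_def e_def algebra_simps)
    qed
    from MVT2[of 0 "h n" "\<lambda>t. \<phi> (x + t *\<^sub>R e)", OF h(1) this]
    obtain z where z: "0 < z" "z < h n" "\<phi> (x + h n *\<^sub>R e) - \<phi> x = h n * pderiv_at j \<phi> (x + z *\<^sub>R e)"
      by auto
    have "norm (x + z *\<^sub>R e) \<le> R + 1"
      using norm_triangle_ineq[of x "z *\<^sub>R e"] x z h(2)[of n] e1 by simp
    then have "\<bar>pderiv_at j \<phi> (x + z *\<^sub>R e)\<bar> \<le> M" by (rule M)
    moreover have "real (Suc n) * h n = 1" by (simp add: h_def)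
    ultimately show ?thesis unfolding z(3) mult.assoc[symmetric] by simp
  qed
  \<comment> \<open>the difference quotient on the test function, and on \<open>w\<close>\<close>
  define P where "P n x = w x * (real (Suc n) * (\<phi> (x + h n *\<^sub>R e) - \<phi> x))" for n x
  define Q where "Q n x = (real (Suc n) * (w (x - h n *\<^sub>R e) - w x)) * \<phi> x" for n x
  have PQ: "integral\<^sup>L lborel (P n) = integral\<^sup>L lborel (Q n)" for n
  proof -
    let ?F = "\<lambda>x. w (x - h n *\<^sub>R e) * \<phi> x"
    have c: "continuous_on UNIV ?F" "continuous_on UNIV (\<lambda>x. w x * \<phi> x)"
      using shiftc[OF w_continuous, of "- (h n *\<^sub>R e)"]
      by (auto intro!: continuous_intros w_continuous facts)
    have i: "integrable lborel ?F" "integrable lborel (\<lambda>x. w x * \<phi> x)"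
      using c by (auto intro!: integrable_continuous_bounded_support[where R = R'] simp: R')
    have "integrable lborel (\<lambda>x. w x * \<phi> (x + h n *\<^sub>R e))"
      by (rule integrable_continuous_bounded_support[where R = R])
        (auto intro!: continuous_intros w_continuous shiftc facts simp: zero R(2))
    moreover have "(\<integral>x. w x * \<phi> (x + h n *\<^sub>R e) \<partial>lborel) = (\<integral>x. ?F x \<partial>lborel)"
      using lborel_integral_translate[of ?F "h n *\<^sub>R e"] borel_measurable_continuous_onI[OF c(1)]
      by (simp add: add.commute)
    ultimately show ?thesis
      unfolding P_def Q_def using i by (simp add: algebra_simps)
  qed
  have Pm[measurable]: "P n \<in> borel_measurable borel" for n unfolding P_def by measurable
  have Qm[measurable]: "Q n \<in> borel_measurable borel" for n unfolding Q_def by measurable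
  have limP: "(\<lambda>n. integral\<^sup>L lborel (P n)) \<longlonglongrightarrow> (\<integral>x. w x * pderiv_at j \<phi> x \<partial>lborel)"
  proof (rule integral_dominated_convergence[where w = "\<lambda>x. indicator (cball 0 R) x *\<^sub>R (B * M)"])
    show "integrable lborel (\<lambda>x. indicator (cball (0::real^'n) R) x *\<^sub>R (B * M))"
      by (intro borel_integrable_compact) auto
    show "AE x in lborel. (\<lambda>n. P n x) \<longlonglongrightarrow> w x * pderiv_at j \<phi> x"
      unfolding P_def h_def e_def
      by (intro AE_I2 tendsto_intros pderiv_at_sequence facts)
    show "AE x in lborel. norm (P n x) \<le> indicator (cball 0 R) x *\<^sub>R (B * M)" for n
    proof (intro AE_I2)
      fix x
      show "norm (P n x) \<le> indicator (cball 0 R) x *\<^sub>R (B * M)"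
      proof (cases "norm x \<le> R")
        case True
        then show ?thesis
          using mult_mono[OF B(2)[of x] qb[OF True, of n]] B(1) by (simp add: P_def abs_mult)
      next
        case False
        then show ?thesis using zero[of x] R(2)[of x] by (simp add: P_def)
      qed
    qed
  qed measurable
  have limQ: "(\<lambda>n. integral\<^sup>L lborel (Q n)) \<longlonglongrightarrow> (\<integral>x. - (quotient_gradient w x $ j * \<phi> x) \<partial>lborel)"
  proof (rule integral_dominated_convergence[where w = "\<lambda>x. L * \<bar>\<phi> x\<bar>"])
    have "integrable lborel \<phi>"
      by (rule integrable_continuous_bounded_support[where R = R']) (auto intro: facts R')
    then show "integrable lborel (\<lambda>x. L * \<bar>\<phi> x\<bar>)" by simp
    show "AE x in lborel. (\<lambda>n. Q n x) \<longlonglongrightarrow> - (quotient_gradient w x $ j * \<phi> x)"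
      using aff
    proof eventually_elim
      case (elim x)
      then obtain a b r where r: "r > 0" "\<forall>y. dist x y < r \<longrightarrow> w y = a \<bullet> y + b" by blast
      have "\<forall>\<^sub>F n in sequentially.
          real (Suc n) * (w (x + inverse (real (Suc n)) *\<^sub>R - e) - w x) = a \<bullet> - e"
        using e1 by (intro locally_affine_quotient[OF r]) simp
      then have "\<forall>\<^sub>F n in sequentially. Q n x = - (quotient_gradient w x $ j * \<phi> x)"
        by eventually_elim
          (simp add: Q_def h_def quotient_gradient_affine[OF r] e_def inner_axis)
      then show ?case by (rule tendsto_eventually)
    qed
    show "AE x in lborel. norm (Q n x) \<le> L * \<bar>\<phi> x\<bar>" for n
      using quotient_bound[of "- e" n] e1
      by (intro AE_I2) (simp add: Q_def h_def abs_mult mult_right_mono)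
  qed measurable
  have eq: "(\<integral>x. w x * pderiv_at j \<phi> x \<partial>lborel) = - (\<integral>x. quotient_gradient w x $ j * \<phi> x \<partial>lborel)"
    using LIMSEQ_unique[OF limP] limQ by (simp add: PQ)
  have "L2_inner \<Omega> w (pderiv_at j \<phi>) = (\<integral>x. w x * pderiv_at j \<phi> x \<partial>lborel)"
    using \<Omega> zero by (subst L2_inner_borel) (auto intro!: Bochner_Integration.integral_cong simp: indicator_def)
  moreover have "L2_inner \<Omega> (\<lambda>x. quotient_gradient w x $ j) \<phi> =
      (\<integral>x. quotient_gradient w x $ j * \<phi> x \<partial>lborel)"
    using \<Omega> facts(4) by (subst L2_inner_borel) (auto intro!: Bochner_Integration.integral_cong simp: indicator_def)
  ultimately show "L2_inner \<Omega> w (pderiv_at j \<phi>) = - L2_inner \<Omega> (\<lambda>x. quotient_gradient w x $ j) \<phi>"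
    using eq by simp
qed

text \<open>The approximating test functions: \<open>w\<close> truncated at height \<open>\<epsilon> = 1/(n+1)\<close> and mollified at the scale
  \<open>\<epsilon>/(L+1)\<close>. Where \<open>w\<close> vanishes, \<open>\<bar>w\<bar> < \<epsilon>\<close> on the whole ball of that radius, so the support
  stays inside the domain.\<close>

definition approx :: "nat \<Rightarrow> real^'n \<Rightarrow> real" where
  "approx n = mollify (inverse (real (Suc n)) / (L + 1)) (\<lambda>x. truncate_by (inverse (real (Suc n))) (w x))"

lemma approx_facts:
  shows "approx n \<in> test_functions \<Omega>" "\<bar>approx n x - w x\<bar> \<le> 2 * inverse (real (Suc n))"
    "\<bar>pderiv_at j (approx n) x\<bar> \<le> L"
proof -
  define e where "e = inverse (real (Suc n))"
  define d where "d = e / (L + 1)"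
  define u where "u x = truncate_by e (w x)" for x
  have ap: "approx n = mollify d u" by (simp add: approx_def e_def d_def u_def[abs_def])
  have e: "e > 0" by (simp add: e_def)
  have d: "d > 0" "L * d < e" using e L0 by (auto simp: d_def field_simps)
  have uL: "\<bar>u x - u y\<bar> \<le> L * norm (x - y)" for x y
    using truncate_by_lipschitz[of e "w x" "w y"] L[of x y] e by (simp add: u_def)
  have "L-lipschitz_on UNIV u" using uL L0 by (auto simp: lipschitz_on_def dist_norm dist_real_def)
  then have uc: "continuous_on UNIV u" by (rule lipschitz_on_continuous_on)
  obtain R where R: "R > 0" "\<And>x. R < norm x \<Longrightarrow> x \<notin> \<Omega>" using domain_ball by blast
  have u0: "R < norm x \<Longrightarrow> u x = 0" for x using R(2) zero e by (simp add: u_def truncate_by_eq_0)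
  have ck: "Ck k (approx n)" for k unfolding ap using uc d(1) u0 by (rule mollify_Ck)
  have supp: "approx n x = 0" if "\<bar>w x\<bar> \<le> e - L * d" for x
  proof -
    have "\<bar>mollify d u x - 0\<bar> \<le> 0"
    proof (rule mollify_diff_bound[OF uc d(1)])
      fix z :: "real^'n" assume "norm z < d"
      then have "L * norm z \<le> L * d" using L0 by (intro mult_left_mono) auto
      then have "\<bar>w (x - z)\<bar> \<le> e" using L[of "x - z" x] that by auto
      then show "\<bar>u (x - z) - 0\<bar> \<le> 0" by (simp add: u_def truncate_by_eq_0)
    qed
    then show ?thesis by (simp add: ap)
  qed
  \<comment> \<open>a compact subset of the domain that contains the support\<close>
  let ?S = "{x. e - L * d \<le> \<bar>w x\<bar>}"
  have S: "closed ?S" by (intro closed_Collect_le continuous_intros w_continuous)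
  have SO: "?S \<subseteq> \<Omega>" using zero d(2) by force
  have "{x. approx n x \<noteq> 0} \<subseteq> ?S" using supp by force
  then have cl: "closure {x. approx n x \<noteq> 0} \<subseteq> ?S" using S by (rule closure_minimal)
  then have "bounded (closure {x. approx n x \<noteq> 0})"
    using SO \<Omega>(2) bounded_subset by blast
  then show "approx n \<in> test_functions \<Omega>"
    unfolding test_functions_def using ck cl SO by (auto simp: compact_eq_bounded_closed)
  show "\<bar>approx n x - w x\<bar> \<le> 2 * inverse (real (Suc n))"
    unfolding ap e_def[symmetric]
  proof (rule mollify_diff_bound[OF uc d(1)])
    fix z :: "real^'n" assume "norm z < d"
    then have "L * norm z \<le> L * d" using L0 by (intro mult_left_mono) auto
    then have "\<bar>u (x - z) - u x\<bar> \<le> e" using uL[of "x - z" x] d(2) by auto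
    moreover have "\<bar>u x - w x\<bar> \<le> e" using truncate_by_diff[of e "w x"] e by (simp add: u_def)
    ultimately show "\<bar>u (x - z) - w x\<bar> \<le> 2 * e" by linarith
  qed
  have "Ck (Suc 0) (approx n)" by (rule ck)
  then have "approx n differentiable at x" by simp
  then show "\<bar>pderiv_at j (approx n) x\<bar> \<le> L"
    using mollify_lipschitz[OF uc d(1) uL] by (intro pderiv_at_lipschitz_bound) (auto simp: ap)
qed

text \<open>Near a point where \<open>w\<close> is affine, and either nonzero or locally zero, the gradients of the
  approximations are eventually equal to that of \<open>w\<close>.\<close>

lemma approx_gradient:
  assumes r: "r > 0" "\<forall>y. dist x y < r \<longrightarrow> w y = a \<bullet> y + b" and a: "a \<noteq> 0 \<longrightarrow> w x \<noteq> 0"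
  shows "\<forall>\<^sub>F n in sequentially. pderiv_at j (approx n) x = a $ j"
proof -
  have cont: "continuous (at x) w" using w_continuous[of UNIV] by (simp add: continuous_on_eq_continuous_at)
  obtain r' c where r': "r' > 0" "r' \<le> r" and c: "c > 0"
    and near: "(\<forall>y. dist x y < r' \<longrightarrow> w y > c) \<or> (\<forall>y. dist x y < r' \<longrightarrow> w y < - c) \<or> a = 0 \<and> w x = 0"
  proof (cases "w x = 0")
    case True
    then show thesis using that[of r 1] r(1) a by auto
  next
    case False
    define c where "c = \<bar>w x\<bar> / 2"
    have c: "c > 0" using False by (simp add: c_def)
    obtain s where s: "s > 0" "\<And>y. dist y x < s \<Longrightarrow> dist (w y) (w x) < c"
      using cont c unfolding continuous_at_eps_delta by blast
    have s': "\<bar>w y - w x\<bar> < c" if "dist x y < min r s" for y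
      using s(2)[of y] that by (simp add: dist_commute dist_real_def)
    show thesis
    proof (rule that[of "min r s" c])
      show "(\<forall>y. dist x y < min r s \<longrightarrow> w y > c) \<or> (\<forall>y. dist x y < min r s \<longrightarrow> w y < - c) \<or> a = 0 \<and> w x = 0"
      proof (cases "w x > 0")
        case True
        have "w y > c" if "dist x y < min r s" for y
          using s'[OF that] True unfolding c_def by linarith
        then show ?thesis by blast
      next
        case F: False
        have "w y < - c" if "dist x y < min r s" for y
          using s'[OF that] F False unfolding c_def by linarith
        then show ?thesis by blast
      qed
    qed (use r s c in auto)
  qed
  have "\<forall>\<^sub>F n in sequentially. inverse (real (Suc n)) < min c (r' / 2)"
    using LIMSEQ_inverse_real_of_nat c r'(1) by (intro order_tendstoD(2)[of _ 0]) auto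
  then show ?thesis
  proof eventually_elim
    case (elim n)
    define e where "e = inverse (real (Suc n))"
    define d where "d = e / (L + 1)"
    define u where "u x = truncate_by e (w x)" for x
    have ap: "approx n = mollify d u" by (simp add: approx_def e_def d_def u_def[abs_def])
    have e: "e > 0" "e < c" "e < r' / 2" using elim by (auto simp: e_def)
    have d: "d > 0" "d \<le> e" using e L0 by (auto simp: d_def field_simps)
    have "\<bar>u x - u y\<bar> \<le> L * norm (x - y)" for x y
      using truncate_by_lipschitz[of e "w x" "w y"] L[of x y] e by (simp add: u_def)
    then have "L-lipschitz_on UNIV u" using L0 by (auto simp: lipschitz_on_def dist_norm dist_real_def)
    then have uc: "continuous_on UNIV u" by (rule lipschitz_on_continuous_on)
    have wr: "w y = a \<bullet> y + b" if "dist x y < r'" for y using r(2) r'(2) that by auto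
    have "\<exists>b0. \<forall>y. dist x y < r' \<longrightarrow> u y = a \<bullet> y + b0"
      using near
    proof (elim disjE conjE)
      assume n: "\<forall>y. dist x y < r' \<longrightarrow> w y > c"
      have "u y = a \<bullet> y + (b - e)" if "dist x y < r'" for y
      proof -
        have "w y > e" using n that e by force
        then have "u y = w y - e" using e unfolding u_def truncate_by_def by linarith
        then show ?thesis using wr[OF that] by simp
      qed
      then show ?thesis by blast
    next
      assume n: "\<forall>y. dist x y < r' \<longrightarrow> w y < - c"
      have "u y = a \<bullet> y + (b + e)" if "dist x y < r'" for y
      proof -
        have "w y < - e" using n that e by force
        then have "u y = w y + e" using e unfolding u_def truncate_by_def by linarith
        then show ?thesis using wr[OF that] by simp
      qed
      then show ?thesis by blast
    next
      assume n: "a = 0" "w x = 0"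
      then have "b = 0" using wr[of x] r'(1) by simp
      then have "u y = a \<bullet> y + 0" if "dist x y < r'" for y
        using wr[OF that] n e by (simp add: u_def truncate_by_eq_0)
      then show ?thesis by blast
    qed
    then obtain b0 where "\<And>y. dist x y < r' \<Longrightarrow> u y = a \<bullet> y + b0" by blast
    then have "\<And>y. dist x y < 2 * d \<Longrightarrow> u y = a \<bullet> y + b0" using d(2) e(3) by auto
    from mollify_affine[OF uc d(1) this]
    obtain b' where "\<forall>y. dist x y < d \<longrightarrow> approx n y = a \<bullet> y + b'" unfolding ap by blast
    then show ?case by (rule locally_affine_has_derivative(2)[OF d(1)])
  qed
qed

theorem in_H10: "w \<in> H10 \<Omega>"
proof -
  obtain B where B: "B \<ge> 0" "\<And>x. \<bar>w x\<bar> \<le> B" using w_bounded by blast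
  have wL2: "w \<in> L2 \<Omega>" using B by (intro L2_boundedI[OF \<Omega> w_borel, of B]) auto
  have apb[measurable]: "approx n \<in> borel_measurable borel" "pderiv_at j (approx n) \<in> borel_measurable borel"
    for n j
    using test_function_facts(2,3)[OF approx_facts(1)] by (auto intro!: borel_measurable_continuous_onI)
  have lim0: "(\<lambda>n. 2 * inverse (real (Suc n))) \<longlonglongrightarrow> 0"
    using tendsto_mult_right_zero[OF LIMSEQ_inverse_real_of_nat] by blast
  have 1: "(\<lambda>n. L2_norm \<Omega> (\<lambda>x. w x - approx n x)) \<longlonglongrightarrow> 0"
  proof (rule L2_norm_tendsto_0[OF \<Omega>, where B = 2])
    show "AE x in lborel. \<bar>w x - approx n x\<bar> \<le> 2" for n
    proof (intro AE_I2)
      fix x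
      have "2 * inverse (real (Suc n)) \<le> 2" by (simp add: field_simps)
      then show "\<bar>w x - approx n x\<bar> \<le> 2" using approx_facts(2)[of n x] by linarith
    qed
    show "AE x in lborel. (\<lambda>n. w x - approx n x) \<longlonglongrightarrow> 0"
    proof (intro AE_I2)
      fix x
      show "(\<lambda>n. w x - approx n x) \<longlonglongrightarrow> 0"
        by (rule Lim_null_comparison[OF _ lim0])
          (use approx_facts(2) in \<open>auto simp: abs_minus_commute intro!: always_eventually\<close>)
    qed
  qed measurable
  have 2: "(\<lambda>n. L2_norm \<Omega> (\<lambda>x. quotient_gradient w x $ j - pderiv_at j (approx n) x)) \<longlonglongrightarrow> 0" for j
  proof (rule L2_norm_tendsto_0[OF \<Omega>, where B = "2 * L"])
    show "AE x in lborel. \<bar>quotient_gradient w x $ j - pderiv_at j (approx n) x\<bar> \<le> 2 * L" for n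
      using gradient_bound[of j]
    proof eventually_elim
      case (elim x)
      then show ?case using approx_facts(3)[of j n x] by linarith
    qed
    show "AE x in lborel. (\<lambda>n. quotient_gradient w x $ j - pderiv_at j (approx n) x) \<longlonglongrightarrow> 0"
      using aff
    proof eventually_elim
      case (elim x)
      then obtain a b r where r: "r > 0" "\<forall>y. dist x y < r \<longrightarrow> w y = a \<bullet> y + b" "a \<noteq> 0 \<longrightarrow> w x \<noteq> 0"
        by blast
      have "\<forall>\<^sub>F n in sequentially. quotient_gradient w x $ j - pderiv_at j (approx n) x = 0"
        using approx_gradient[OF r, of j]
        by eventually_elim (simp add: quotient_gradient_affine[OF r(1,2)])
      then show ?case by (rule tendsto_eventually)
    qed
  qed measurable
  have "(\<lambda>n. sqrt ((L2_norm \<Omega> (\<lambda>x. w x - approx n x))\<^sup>2 +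
      (\<Sum>j\<in>UNIV. (L2_norm \<Omega> (\<lambda>x. quotient_gradient w x $ j - pderiv_at j (approx n) x))\<^sup>2))) \<longlonglongrightarrow>
      sqrt (0\<^sup>2 + (\<Sum>j\<in>(UNIV::'n set). 0\<^sup>2))"
    by (intro tendsto_intros 1 2)
  then have "(\<lambda>n. H1_norm \<Omega> (\<lambda>x. w x - approx n x)
      (\<lambda>x. quotient_gradient w x - (\<chi> j. pderiv_at j (approx n) x))) \<longlonglongrightarrow> 0"
    by (simp add: H1_norm_def)
  then show ?thesis
    unfolding H10_def using wL2 weak_gradient approx_facts(1) by blast
qed

end

section \<open>Simplices and affine functions\<close>

text \<open>Real-valued affine functions on the whole space.\<close>

definition affine_fun :: "(real^'n \<Rightarrow> real) \<Rightarrow> bool" where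
  "affine_fun p \<longleftrightarrow> (\<exists>c b. p = (\<lambda>x. c \<bullet> x + b))"

lemma affine_funI: "affine_fun (\<lambda>x. c \<bullet> x + b)"
  by (auto simp: affine_fun_def)

lemma affine_fun_const: "affine_fun (\<lambda>x. b)"
  using affine_funI[of 0 b] by simp

lemma affine_fun_lincomb:
  assumes "affine_fun p" "affine_fun q"
  shows "affine_fun (\<lambda>x. s * p x + t * q x)"
proof -
  obtain c b c' b' where "p = (\<lambda>x. c \<bullet> x + b)" "q = (\<lambda>x. c' \<bullet> x + b')"
    using assms by (auto simp: affine_fun_def)
  then have "(\<lambda>x. s * p x + t * q x) = (\<lambda>x. (s *\<^sub>R c + t *\<^sub>R c') \<bullet> x + (s * b + t * b'))"
    by (auto simp: fun_eq_iff inner_add_left algebra_simps)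
  then show ?thesis by (rule ssubst) (rule affine_funI)
qed

lemma affine_fun_sum:
  "finite I \<Longrightarrow> (\<And>i. i \<in> I \<Longrightarrow> affine_fun (p i)) \<Longrightarrow> affine_fun (\<lambda>x. \<Sum>i\<in>I. s i * p i x)"
proof (induction I rule: finite_induct)
  case empty
  then show ?case by (simp add: affine_fun_const)
next
  case (insert i I)
  then show ?case
    using affine_fun_lincomb[of "p i" "\<lambda>x. \<Sum>i\<in>I. s i * p i x" "s i" 1] by simp
qed

lemma affine_fun_affine_comb:
  assumes "affine_fun p" "finite S" "sum u S = 1"
  shows "p (\<Sum>v\<in>S. u v *\<^sub>R v) = (\<Sum>v\<in>S. u v * p v)"
proof -
  obtain c b where p: "p = (\<lambda>x. c \<bullet> x + b)" using assms(1) by (auto simp: affine_fun_def)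
  have "(\<Sum>v\<in>S. u v * p v) = (\<Sum>v\<in>S. u v * (c \<bullet> v)) + (\<Sum>v\<in>S. u v) * b"
    by (simp add: p distrib_left sum.distrib sum_distrib_right)
  then show ?thesis using assms(3) by (simp add: p inner_sum_right)
qed

lemma affine_fun_eq_on_open:
  fixes p q :: "real^'n \<Rightarrow> real"
  assumes "affine_fun p" "affine_fun q" "open S" "S \<noteq> {}" "\<And>x. x \<in> S \<Longrightarrow> p x = q x"
  shows "p = q"
proof -
  obtain c b c' b' where pq: "p = (\<lambda>x. c \<bullet> x + b)" "q = (\<lambda>x. c' \<bullet> x + b')"
    using assms by (auto simp: affine_fun_def)
  have eq: "(c - c') \<bullet> x = b' - b" if "x \<in> S" for x
    using assms(5)[OF that] by (simp add: pq inner_diff_left algebra_simps)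
  have "c - c' = 0"
  proof (rule ccontr)
    assume "c - c' \<noteq> 0"
    then have "negligible {x. (c - c') \<bullet> x = b' - b}" by (intro negligible_hyperplane) auto
    then have "negligible S" by (rule negligible_subset) (use eq in auto)
    then show False using open_not_negligible assms by blast
  qed
  then show ?thesis using eq assms(4) by (auto simp: pq fun_eq_iff)
qed

lemma affine_fun_eq_on_affine_basis:
  fixes p q :: "real^'n \<Rightarrow> real"
  assumes "affine_fun p" "affine_fun q" "finite V" "affine hull V = UNIV" "\<And>v. v \<in> V \<Longrightarrow> p v = q v"
  shows "p = q"
proof
  fix x
  have "x \<in> affine hull V" using assms(4) by simp
  then obtain u where u: "sum u V = 1" "(\<Sum>v\<in>V. u v *\<^sub>R v) = x"
    using affine_hull_finite[OF assms(3)] by auto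
  have "p x = (\<Sum>v\<in>V. u v * p v)" using affine_fun_affine_comb[OF assms(1,3) u(1)] u(2) by simp
  also have "\<dots> = (\<Sum>v\<in>V. u v * q v)" using assms(5) by simp
  also have "\<dots> = q x" using affine_fun_affine_comb[OF assms(2,3) u(1)] u(2) by simp
  finally show "p x = q x" .
qed

lemma affine_fun_continuous: "affine_fun p \<Longrightarrow> continuous_on S p"
  by (auto simp: affine_fun_def intro!: continuous_intros)

text \<open>A set of vertices of a nondegenerate simplex.\<close>

definition simplex_vertices :: "(real^'n) set \<Rightarrow> bool" where
  "simplex_vertices V \<longleftrightarrow> \<not> affine_dependent V \<and> card V = Suc CARD('n)"

lemma simplex_vertices_finite: "simplex_vertices V \<Longrightarrow> finite V"
  by (simp add: simplex_vertices_def aff_independent_finite)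

lemma simplex_vertices_hull:
  fixes V :: "(real^'n) set"
  assumes "simplex_vertices V"
  shows "affine hull V = UNIV"
proof -
  have "aff_dim V = int CARD('n)"
    using assms aff_dim_affine_independent[of V] by (simp add: simplex_vertices_def)
  then have "aff_dim V = DIM(real^'n)" by simp
  then show ?thesis by (rule affine_hull_UNIV)
qed

lemma barycentric_exists:
  fixes V :: "(real^'n) set"
  assumes V: "simplex_vertices V" and v: "v \<in> V"
  obtains l where "affine_fun l" "l v = 1" "\<And>u. u \<in> V - {v} \<Longrightarrow> l u = 0"
proof -
  have ind: "\<not> affine_dependent V" and card: "card V = Suc CARD('n)"
    using V by (auto simp: simplex_vertices_def)
  have ind': "\<not> affine_dependent (V - {v})"
    using ind affine_independent_Diff by blast
  have "aff_dim (V - {v}) = int CARD('n) - 1"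
    using aff_dim_affine_independent[OF ind'] card v by simp
  then obtain a b where ab: "a \<noteq> 0" "affine hull (V - {v}) = {x. a \<bullet> x = b}"
    using aff_dim_eq_hyperplane[of "V - {v}"] by auto
  have "v \<notin> affine hull (V - {v})" using ind v by (auto simp: affine_dependent_def)
  then have nz: "a \<bullet> v \<noteq> b" by (simp add: ab)
  define s where "s = inverse (a \<bullet> v - b)"
  show thesis
  proof (rule that[of "\<lambda>x. (s *\<^sub>R a) \<bullet> x + (- s * b)"])
    show "affine_fun (\<lambda>x. (s *\<^sub>R a) \<bullet> x + (- s * b))" by (rule affine_funI)
    have "s * (a \<bullet> v - b) = 1" using nz by (simp add: s_def)
    then show "(s *\<^sub>R a) \<bullet> v + (- s * b) = 1" by (simp add: algebra_simps)
    show "(s *\<^sub>R a) \<bullet> u + (- s * b) = 0" if "u \<in> V - {v}" for u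
    proof -
      have "a \<bullet> u = b" using hull_inc[OF that, of affine] ab(2) by auto
      then show ?thesis by (simp add: algebra_simps)
    qed
  qed
qed

lemma affine_interpolation:
  fixes V :: "(real^'n) set"
  assumes V: "simplex_vertices V"
  obtains p where "affine_fun p" "\<And>v. v \<in> V \<Longrightarrow> p v = f v"
proof -
  have "\<forall>v\<in>V. \<exists>l. affine_fun l \<and> l v = 1 \<and> (\<forall>u\<in>V - {v}. l u = 0)"
    using barycentric_exists[OF V] by metis
  then obtain l where l: "\<And>v. v \<in> V \<Longrightarrow> affine_fun (l v)" "\<And>v. v \<in> V \<Longrightarrow> l v v = 1"
    "\<And>u v. v \<in> V \<Longrightarrow> u \<in> V - {v} \<Longrightarrow> l v u = 0" by metis
  have fin: "finite V" using simplex_vertices_finite[OF V] .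
  show thesis
  proof (rule that[of "\<lambda>x. \<Sum>v\<in>V. f v * l v x"])
    show "affine_fun (\<lambda>x. \<Sum>v\<in>V. f v * l v x)" using l fin by (intro affine_fun_sum) auto
    fix v assume v: "v \<in> V"
    have "(\<Sum>u\<in>V. f u * l u v) = (\<Sum>u\<in>V. if u = v then f v else 0)"
      using l v by (intro sum.cong) auto
    then show "(\<Sum>u\<in>V. f u * l u v) = f v" using fin v by simp
  qed
qed

lemma simplex_interior_nonempty:
  fixes V :: "(real^'n) set"
  assumes "simplex_vertices V"
  shows "interior (convex hull V) \<noteq> {}"
proof -
  have "rel_interior (convex hull V) = interior (convex hull V)"
    using simplex_vertices_hull[OF assms] by (intro rel_interior_interior) simp
  moreover have "V \<noteq> {}" using assms by (auto simp: simplex_vertices_def)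
  ultimately show ?thesis by (metis convex_convex_hull convex_hull_eq_empty rel_interior_eq_empty)
qed

lemma facet_of_simplex_iff:
  "simplex_vertices V \<Longrightarrow> F facet_of convex hull V \<longleftrightarrow> F \<noteq> {} \<and> (\<exists>u\<in>V. F = convex hull (V - {u}))"
  using facet_of_convex_hull_affine_independent[of V F] by (auto simp: simplex_vertices_def)

section \<open>Simplicial meshes\<close>

text \<open>A simplicial mesh of a bounded domain.\<close>

locale mesh =
  fixes \<Omega> :: "(real^'n) set" and \<T> :: "(real^'n) set set"
  assumes open_dom: "open \<Omega>" and connected_dom: "connected \<Omega>" and bounded_dom: "bounded \<Omega>"
    and dom_ne: "\<Omega> \<noteq> {}" and mesh: "simplicial_mesh \<Omega> \<T>"
begin

lemma finite_T: "finite \<T>"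
  using mesh by (simp add: simplicial_mesh_def triangulation_def)

lemma union_T: "\<Union>\<T> = closure \<Omega>"
  using mesh by (simp add: simplicial_mesh_def)

lemma T_face: "K \<in> \<T> \<Longrightarrow> K' \<in> \<T> \<Longrightarrow> (K \<inter> K') face_of K"
  using mesh by (simp add: simplicial_mesh_def triangulation_def)

lemma T_simplex:
  assumes "K \<in> \<T>" obtains V where "simplex_vertices V" "K = convex hull V"
proof -
  have "int CARD('n) simplex K" using mesh assms by (simp add: simplicial_mesh_def)
  then obtain C where "\<not> affine_dependent C" "int (card C) = int CARD('n) + 1" "K = convex hull C"
    by (auto simp: simplex_def)
  then show thesis using that[of C] by (simp add: simplex_vertices_def)
qed

lemma T_compact: "K \<in> \<T> \<Longrightarrow> compact K"
  by (metis T_simplex finite_imp_compact_convex_hull simplex_vertices_finite)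

lemma T_closed: "K \<in> \<T> \<Longrightarrow> closed K"
  by (simp add: T_compact compact_imp_closed)

lemma T_convex: "K \<in> \<T> \<Longrightarrow> convex K"
  by (metis T_simplex convex_convex_hull)

lemma T_interior_ne: "K \<in> \<T> \<Longrightarrow> interior K \<noteq> {}"
  by (metis T_simplex simplex_interior_nonempty)

lemma T_closure_interior: "K \<in> \<T> \<Longrightarrow> closure (interior K) = K"
  using convex_closure_interior[OF T_convex T_interior_ne] T_closed by (simp add: closure_closed)

lemma T_aff_dim: "K \<in> \<T> \<Longrightarrow> aff_dim K = int CARD('n)"
  using aff_dim_nonempty_interior[OF T_interior_ne] by simp

text \<open>Conformity: an interior point of an element lies in no other element, since the common face would
  be the whole element.\<close>

lemma T_interior_unique:
  assumes "K \<in> \<T>" "K' \<in> \<T>" "x \<in> interior K" "x \<in> K'"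
  shows "K = K'"
proof -
  have "x \<in> (K \<inter> K') \<inter> rel_interior K"
    using assms T_interior_ne interior_subset by (auto simp: rel_interior_nonempty_interior)
  then have "K \<subseteq> K \<inter> K'"
    by (intro subset_of_face_of[OF T_face[OF assms(1,2)] subset_refl]) blast
  then have "K \<inter> K' = K" by auto
  then have "K face_of K'" using T_face[OF assms(2,1)] by (simp add: Int_commute)
  then have "K \<noteq> K' \<Longrightarrow> aff_dim K < aff_dim K'"
    by (intro face_of_aff_dim_lt T_convex assms)
  then show ?thesis using T_aff_dim[OF assms(1)] T_aff_dim[OF assms(2)] by auto
qed

lemma T_subset: "K \<in> \<T> \<Longrightarrow> K \<subseteq> closure \<Omega>"
  using union_T by blast

lemma frontier_facet: "x \<in> frontier \<Omega> \<Longrightarrow> \<exists>F\<in>boundary_facets \<Omega> \<T>. x \<in> F"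
  using mesh unfolding simplicial_mesh_def by blast

lemma facet_subset: "F facet_of K \<Longrightarrow> F \<subseteq> K"
  by (simp add: facet_of_imp_subset)

lemma facet_interior_disjoint:
  assumes "K \<in> \<T>" "F facet_of K" "x \<in> F" shows "x \<notin> interior K"
proof
  assume "x \<in> interior K"
  then have "x \<in> F \<inter> rel_interior K" using assms T_interior_ne rel_interior_nonempty_interior by blast
  moreover have "F face_of K" "F \<noteq> K" using assms facet_of_imp_face_of facet_of_irrefl by blast+
  ultimately show False using face_of_disjoint_rel_interior by blast
qed

lemma T_interior_subset: assumes "K \<in> \<T>" shows "interior K \<subseteq> \<Omega>"
proof
  fix x assume x: "x \<in> interior K"
  have "x \<notin> frontier \<Omega>"
  proof
    assume "x \<in> frontier \<Omega>"
    then obtain F K' where F: "x \<in> F" "K' \<in> \<T>" "F facet_of K'"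
      using frontier_facet unfolding boundary_facets_def mesh_facets_def by blast
    then have "x \<in> K'" using facet_subset by blast
    then have "K = K'" using T_interior_unique[OF assms F(2) x] by blast
    then show False using facet_interior_disjoint[OF F(2,3,1)] x by blast
  qed
  moreover have "x \<in> closure \<Omega>" using x T_subset[OF assms] interior_subset by blast
  ultimately show "x \<in> \<Omega>" using open_dom by (simp add: frontier_def interior_open)
qed

lemma skeleton_negligible: "negligible (\<Union>K\<in>\<T>. frontier K)"
  using finite_T T_convex by (intro negligible_Union) (auto intro: negligible_convex_frontier)

lemma dom_subset_interiors: "\<Omega> \<subseteq> (\<Union>K\<in>\<T>. interior K) \<union> (\<Union>K\<in>\<T>. frontier K)"
proof
  fix x assume "x \<in> \<Omega>"
  then obtain K where "K \<in> \<T>" "x \<in> K" using union_T closure_subset by blast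
  then show "x \<in> (\<Union>K\<in>\<T>. interior K) \<union> (\<Union>K\<in>\<T>. frontier K)"
    using T_closed by (auto simp: frontier_def)
qed

lemma boundary_facets_ne: "boundary_facets \<Omega> \<T> \<noteq> {}"
proof -
  have "\<Omega> \<noteq> UNIV" using bounded_dom not_bounded_UNIV by blast
  then have "frontier \<Omega> \<noteq> {}" using dom_ne frontier_eq_empty by blast
  then show ?thesis using frontier_facet by blast
qed

lemma frontier_disjoint: "x \<in> \<Omega> \<Longrightarrow> x \<notin> frontier \<Omega>"
  using open_dom by (simp add: frontier_def interior_open)

lemma shared_facet:
  assumes "K \<in> \<T>" "K' \<in> \<T>" "K \<noteq> K'" "aff_dim (K \<inter> K') \<ge> int CARD('n) - 1"
  shows "(K \<inter> K') facet_of K"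
proof -
  have "K \<inter> K' \<noteq> K"
    using T_interior_unique[OF assms(1,2)] T_interior_ne[OF assms(1)] assms(3) interior_subset by blast
  then have "aff_dim (K \<inter> K') < int CARD('n)"
    using face_of_aff_dim_lt[OF T_convex[OF assms(1)] T_face[OF assms(1,2)]] T_aff_dim[OF assms(1)] by simp
  then have d: "aff_dim (K \<inter> K') = aff_dim K - 1" using assms(4) T_aff_dim[OF assms(1)] by simp
  moreover have "int CARD('n) \<ge> 1" using zero_less_card_finite by (simp add: Suc_leI)
  ultimately have "aff_dim (K \<inter> K') \<noteq> -1" using T_aff_dim[OF assms(1)] by linarith
  then have "K \<inter> K' \<noteq> {}" by auto
  then show ?thesis using d T_face[OF assms(1,2)] by (simp add: facet_of_def)
qed

text \<open>Any two elements are joined by a chain in which consecutive elements share an interior facet,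
  stated as an induction principle. The reason is that a generic segment avoids all faces of
  codimension two.\<close>

lemma facet_connected:
  assumes step: "\<And>K K' F. K \<in> \<T> \<Longrightarrow> K' \<in> \<T> \<Longrightarrow> K \<noteq> K' \<Longrightarrow> F \<in> interior_facets \<Omega> \<T> \<Longrightarrow>
      F facet_of K \<Longrightarrow> F facet_of K' \<Longrightarrow> P K \<Longrightarrow> P K'"
    and K: "K \<in> \<T>" "K' \<in> \<T>" "P K"
  shows "P K'"
proof (rule ccontr)
  assume notP: "\<not> P K'"
  define U where "U = \<Union>{K\<in>\<T>. P K}"
  define W where "W = \<Union>{K\<in>\<T>. \<not> P K}"
  have UW: "closed U" "closed W"
    unfolding U_def W_def using finite_T T_closed by (auto intro: closed_Union)
  have cover: "\<Omega> \<subseteq> U \<union> W" using union_T closure_subset unfolding U_def W_def by blast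
  have "U \<inter> \<Omega> \<noteq> {}" "W \<inter> \<Omega> \<noteq> {}"
    using T_interior_ne[of K] T_interior_ne[of K'] T_interior_subset[of K] T_interior_subset[of K']
      interior_subset[of K] interior_subset[of K'] K notP unfolding U_def W_def by blast+
  then obtain z where z: "z \<in> U" "z \<in> W" "z \<in> \<Omega>"
    using connected_dom UW cover unfolding connected_closed by blast
  obtain A where A: "A \<in> \<T>" "P A" "z \<in> A" using z by (auto simp: U_def)
  obtain B where B: "B \<in> \<T>" "\<not> P B" "z \<in> B" using z by (auto simp: W_def)
  obtain r where r: "r > 0" "ball z r \<subseteq> \<Omega>" using open_dom z(3) by (auto simp: open_contains_ball)
  have "z \<in> closure (interior A)" "z \<in> closure (interior B)"
    using T_closure_interior A B by auto
  then have ne: "interior A \<inter> ball z r \<noteq> {}" "interior B \<inter> ball z r \<noteq> {}"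
    using open_Int_closure_eq_empty[OF open_ball, of z r "interior A"]
      open_Int_closure_eq_empty[OF open_ball, of z r "interior B"] centre_in_ball[of z r] r(1) by blast+
  then obtain x where x: "x \<in> interior A" "x \<in> ball z r" by blast
  \<comment> \<open>faces of codimension at least two; the cones over them with apex \<open>x\<close> are negligible\<close>
  define \<G> where "\<G> = {G. \<exists>K\<in>\<T>. G face_of K \<and> aff_dim G \<le> int CARD('n) - 2}"
  have "finite {F. F face_of K}" if K: "K \<in> \<T>" for K
  proof -
    obtain V where "simplex_vertices V" "K = convex hull V" using T_simplex[OF K] by blast
    then have "polytope K" by (auto simp: polytope_def dest: simplex_vertices_finite)
    then show ?thesis by (rule finite_polytope_faces)
  qed
  then have "finite (\<Union>K\<in>\<T>. {F. F face_of K})" using finite_T by blast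
  then have "finite \<G>" by (rule finite_subset[rotated]) (auto simp: \<G>_def)
  moreover have "negligible (affine hull (insert x G))" if "G \<in> \<G>" for G
  proof -
    have "aff_dim (affine hull (insert x G)) \<le> aff_dim G + 1"
      by (simp add: aff_dim_insert)
    also have "\<dots> < int CARD('n)" using that by (auto simp: \<G>_def)
    finally have "interior (affine hull (insert x G)) = {}"
      using aff_dim_nonempty_interior[of "affine hull (insert x G)"] by force
    then show ?thesis
      by (simp add: negligible_convex_interior affine_affine_hull affine_imp_convex)
  qed
  ultimately have neg: "negligible (\<Union>G\<in>\<G>. affine hull (insert x G))"
    by (intro negligible_Union) auto
  have "open (interior B \<inter> ball z r)" by auto
  then have "\<not> (interior B \<inter> ball z r \<subseteq> (\<Union>G\<in>\<G>. affine hull (insert x G)))"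
    using ne(2) neg negligible_subset open_not_negligible by blast
  then obtain y where y: "y \<in> interior B" "y \<in> ball z r"
    and gen: "\<And>G. G \<in> \<G> \<Longrightarrow> y \<notin> affine hull (insert x G)" by blast
  have seg: "closed_segment x y \<subseteq> \<Omega>"
    using x y r(2) convex_contains_segment[of "ball z r"] convex_ball by blast
  have "x \<in> U" using subsetD[OF interior_subset x(1)] A unfolding U_def by blast
  moreover have "y \<in> W" using subsetD[OF interior_subset y(1)] B unfolding W_def by blast
  ultimately have "U \<inter> closed_segment x y \<noteq> {}" "W \<inter> closed_segment x y \<noteq> {}" by auto
  moreover have "closed_segment x y \<subseteq> U \<union> W" using seg cover by blast
  ultimately obtain p where p: "p \<in> U" "p \<in> W" "p \<in> closed_segment x y"
    using connected_segment[of x y] UW unfolding connected_closed by blast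
  \<comment> \<open>\<open>C\<close> and \<open>D\<close> meet at a point off the codimension two faces, so they share a facet\<close>
  obtain C where C: "C \<in> \<T>" "P C" "p \<in> C" using p by (auto simp: U_def)
  obtain D where D: "D \<in> \<T>" "\<not> P D" "p \<in> D" using p by (auto simp: W_def)
  have CD: "C \<noteq> D" using C D by blast
  have "p \<noteq> x"
  proof
    assume "p = x"
    then have "A = D" using T_interior_unique[OF A(1) D(1) x(1)] D(3) by simp
    then show False using A D by simp
  qed
  obtain t where t: "p = (1 - t) *\<^sub>R x + t *\<^sub>R y" using p(3) by (auto simp: in_segment)
  have t0: "t \<noteq> 0" using t \<open>p \<noteq> x\<close> by auto
  have "aff_dim (C \<inter> D) \<ge> int CARD('n) - 1"
  proof (rule ccontr)
    assume "\<not> aff_dim (C \<inter> D) \<ge> int CARD('n) - 1"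
    then have G: "C \<inter> D \<in> \<G>" using T_face[OF C(1) D(1)] C(1) by (auto simp: \<G>_def)
    have "y = (1 - 1 / t) *\<^sub>R x + (1 / t) *\<^sub>R p"
      using t0 by (simp add: t algebra_simps)
    moreover have "x \<in> affine hull (insert x (C \<inter> D))" "p \<in> affine hull (insert x (C \<inter> D))"
      using C D by (auto intro: hull_inc)
    moreover have "affine (affine hull (insert x (C \<inter> D)))" by simp
    ultimately have "y \<in> affine hull (insert x (C \<inter> D))"
      using mem_affine[of _ x p "1 - 1 / t" "1 / t"] by simp
    then show False using gen[OF G] by blast
  qed
  then have f: "(C \<inter> D) facet_of C" "(C \<inter> D) facet_of D"
    using shared_facet[OF C(1) D(1) CD] shared_facet[OF D(1) C(1)] CD by (auto simp: Int_commute)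
  have "p \<in> \<Omega>" using p(3) seg by blast
  then have "C \<inter> D \<in> interior_facets \<Omega> \<T>"
    using f C D frontier_disjoint by (auto simp: interior_facets_def mesh_facets_def boundary_facets_def)
  then show False using step[OF C(1) D(1) CD _ f] C D by blast
qed

end

section \<open>Volumes and facet integrals\<close>

text \<open>The change of variables theorems require a well-ordered index type. An arbitrary finite index
  type is therefore replaced by an isomorphic copy that carries a well-order; relabelling the
  coordinates preserves Lebesgue measure.\<close>

typedef 'a ord_copy = "UNIV :: 'a set" morphisms un_ord mk_ord ..

lemma mk_ord_un_ord [simp]: "mk_ord (un_ord i) = i" "un_ord (mk_ord j) = j"
  by (simp_all add: un_ord_inverse mk_ord_inverse)

instance ord_copy :: (finite) finite
proof
  have "finite (range (mk_ord :: 'a \<Rightarrow> 'a ord_copy))"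
    by (rule finite_imageI) (rule finite_class.finite_UNIV)
  moreover have "range (mk_ord :: 'a \<Rightarrow> 'a ord_copy) = UNIV"
    by (rule surjI[of _ un_ord]) simp
  ultimately show "finite (UNIV :: 'a ord_copy set)" by simp
qed

text \<open>An arbitrary numbering of the index type, which defines the order.\<close>

definition ord_code :: "'a::finite \<Rightarrow> nat" where
  "ord_code = (SOME f. inj f)"

lemma inj_ord_code: "inj (ord_code :: 'a::finite \<Rightarrow> nat)"
proof -
  have "finite (UNIV :: 'a set)" by (rule finite_class.finite_UNIV)
  from finite_imp_inj_to_nat_seg[OF this] have "\<exists>f::'a \<Rightarrow> nat. inj f" by auto
  then show ?thesis unfolding ord_code_def by (rule someI_ex)
qed

instantiation ord_copy :: (finite) wellorder
begin

definition less_eq_ord_copy :: "'a ord_copy \<Rightarrow> 'a ord_copy \<Rightarrow> bool" where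
  "less_eq_ord_copy x y \<longleftrightarrow> ord_code (un_ord x) \<le> ord_code (un_ord y)"

definition less_ord_copy :: "'a ord_copy \<Rightarrow> 'a ord_copy \<Rightarrow> bool" where
  "less_ord_copy x y \<longleftrightarrow> ord_code (un_ord x) < ord_code (un_ord y)"

instance
proof
  fix x y z :: "'a ord_copy"
  show "(x < y) = (x \<le> y \<and> \<not> y \<le> x)" by (auto simp: less_eq_ord_copy_def less_ord_copy_def)
  show "x \<le> x" by (simp add: less_eq_ord_copy_def)
  show "x \<le> y \<Longrightarrow> y \<le> z \<Longrightarrow> x \<le> z" by (simp add: less_eq_ord_copy_def)
  show "x \<le> y \<or> y \<le> x" by (auto simp: less_eq_ord_copy_def)
  show "x \<le> y \<Longrightarrow> y \<le> x \<Longrightarrow> x = y"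
    by (simp add: less_eq_ord_copy_def order_antisym_conv inj_eq[OF inj_ord_code] un_ord_inject)
next
  fix P :: "'a ord_copy \<Rightarrow> bool" and a
  assume *: "\<And>x. (\<And>y. y < x \<Longrightarrow> P y) \<Longrightarrow> P x"
  show "P a"
    by (induction a rule: measure_induct_rule[where f = "\<lambda>x. ord_code (un_ord x)"])
      (use * in \<open>simp add: less_ord_copy_def\<close>)
qed

end

text \<open>Relabelling of coordinates, in both directions.\<close>

definition to_ord :: "real^'n \<Rightarrow> real^('n ord_copy)" where "to_ord x = (\<chi> i. x $ un_ord i)"
definition of_ord :: "real^('n ord_copy) \<Rightarrow> real^'n" where "of_ord x = (\<chi> i. x $ mk_ord i)"

lemma to_ord_of_ord [simp]: "to_ord (of_ord x) = x" "of_ord (to_ord y) = y"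
  by (simp_all add: to_ord_def of_ord_def vec_eq_iff)

lemma linear_to_ord: "linear to_ord" and linear_of_ord: "linear of_ord"
  by (auto simp: to_ord_def of_ord_def vec_eq_iff intro!: linearI)

lemma linear_imp_continuous_on: "linear f \<Longrightarrow> continuous_on S f"
  for f :: "'a::euclidean_space \<Rightarrow> 'b::euclidean_space"
  by (simp add: linear_continuous_on linear_conv_bounded_linear)

lemma linear_imp_borel: "linear f \<Longrightarrow> f \<in> borel_measurable borel"
  for f :: "'a::euclidean_space \<Rightarrow> 'b::euclidean_space"
  by (intro borel_measurable_continuous_onI linear_imp_continuous_on)

lemmas borel_to_ord [measurable] = linear_imp_borel[OF linear_to_ord]
lemmas borel_of_ord [measurable] = linear_imp_borel[OF linear_of_ord]

lemma bij_un_ord: "bij un_ord" and bij_mk_ord: "bij mk_ord"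
  by (rule bij_betw_byWitness[where f' = mk_ord]; simp)
    (rule bij_betw_byWitness[where f' = un_ord]; simp)

lemma inner_of_ord: "c \<bullet> of_ord y = to_ord c \<bullet> y"
proof -
  have "(\<Sum>i\<in>UNIV. c $ i * y $ mk_ord i) = (\<Sum>i\<in>UNIV. c $ un_ord i * y $ i)"
    using sum.reindex_bij_betw[OF bij_un_ord, of "\<lambda>i. c $ i * y $ mk_ord i"] by simp
  then show ?thesis by (simp add: inner_vec_def of_ord_def to_ord_def)
qed

lemma prod_Basis_vec:
  fixes x :: "real^'n" and f :: "real \<Rightarrow> real"
  shows "(\<Prod>b\<in>Basis. f (x \<bullet> b)) = (\<Prod>i\<in>UNIV. f (x $ i))"
proof -
  have 1: "(Basis :: (real^'n) set) = (\<lambda>i. axis i 1) ` UNIV" by (auto simp: Basis_vec_def)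
  have 2: "inj (\<lambda>i::'n. axis i (1::real))" by (auto simp: inj_def axis_eq_axis)
  show ?thesis unfolding 1 by (subst prod.reindex[OF 2]) (simp add: inner_axis)
qed

lemma emeasure_box_vec:
  fixes l u :: "real^'n"
  assumes "\<And>i. l $ i \<le> u $ i"
  shows "emeasure lborel (box l u) = (\<Prod>i\<in>UNIV. u $ i - l $ i)"
proof -
  have "\<And>b. b \<in> Basis \<Longrightarrow> l \<bullet> b \<le> u \<bullet> b"
    using assms by (auto simp: Basis_vec_def inner_axis)
  then show ?thesis
    using prod_Basis_vec[of "\<lambda>x. x" "u - l"] by (simp add: emeasure_lborel_box)
qed

lemma lborel_eq_vecI:
  fixes M :: "(real^'n) measure"
  assumes "\<And>l u. (\<And>i. l $ i \<le> u $ i) \<Longrightarrow> emeasure M (box l u) = (\<Prod>i\<in>UNIV. u $ i - l $ i)"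
    and "sets M = sets borel"
  shows "lborel = M"
proof (rule lborel_eqI)
  fix l u :: "real^'n" assume "\<And>b. b \<in> Basis \<Longrightarrow> l \<bullet> b \<le> u \<bullet> b"
  then have "\<And>i. l $ i \<le> u $ i" by (metis axis_in_Basis_iff cart_eq_inner_axis insertI1 Basis_real_def)
  then show "emeasure M (box l u) = ennreal (\<Prod>b\<in>Basis. (u - l) \<bullet> b)"
    using assms(1) prod_Basis_vec[of "\<lambda>x. x" "u - l"] by simp
qed (fact assms(2))

lemma distr_to_ord: "distr lborel borel to_ord = (lborel :: (real^('n::finite) ord_copy) measure)"
proof (rule lborel_eq_vecI[symmetric])
  fix l u :: "real^'n ord_copy" assume lu: "\<And>i. l $ i \<le> u $ i"
  have "to_ord -` box l u = box (of_ord l) (of_ord u)"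
    by (auto simp: mem_box_cart to_ord_def of_ord_def) (metis mk_ord_un_ord)+
  then have "emeasure (distr lborel borel to_ord) (box l u) = emeasure lborel (box (of_ord l) (of_ord u))"
    by (subst emeasure_distr) auto
  also have "\<dots> = (\<Prod>i\<in>UNIV. of_ord u $ i - of_ord l $ i)"
    using lu by (intro emeasure_box_vec) (simp add: of_ord_def)
  also have "(\<Prod>i\<in>UNIV. of_ord u $ i - of_ord l $ i) = (\<Prod>i\<in>UNIV. u $ i - l $ i)"
    using prod.reindex_bij_betw[OF bij_mk_ord, of "\<lambda>i. u $ i - l $ i"] by (simp add: of_ord_def)
  finally show "emeasure (distr lborel borel to_ord) (box l u) = ennreal (\<Prod>i\<in>UNIV. u $ i - l $ i)" .
qed simp

lemma distr_of_ord: "distr lborel borel of_ord = (lborel :: (real^('n::finite)) measure)"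
proof -
  have "distr lborel borel of_ord = distr (distr lborel borel to_ord) borel (of_ord :: _ \<Rightarrow> real^'n)"
    by (simp add: distr_to_ord)
  also have "\<dots> = distr lborel borel (of_ord \<circ> to_ord)" by (rule distr_distr) auto
  also have "of_ord \<circ> to_ord = (\<lambda>x::real^'n. x)" by (simp add: fun_eq_iff)
  finally show ?thesis by (simp add: distr_id2)
qed

lemma content_to_ord:
  assumes "compact A"
  shows "measure lborel (to_ord ` A) = measure lborel A"
proof -
  have "compact (to_ord ` A)" using assms by (intro compact_continuous_image linear_imp_continuous_on linear_to_ord)
  then have b: "to_ord ` A \<in> sets borel" by (simp add: compact_imp_closed)
  have "to_ord -` (to_ord ` A) = A" by (auto simp: image_iff) (metis to_ord_of_ord(2))
  moreover have "measure lborel (to_ord ` A) = measure (distr lborel borel to_ord) (to_ord ` A)"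
    by (simp add: distr_to_ord)
  ultimately show ?thesis using b by (simp add: measure_distr)
qed

lemma affine_fun_of_ord:
  assumes "affine_fun l"
  shows "affine_fun (\<lambda>y. l (of_ord y))"
proof -
  obtain c b where "l = (\<lambda>x. c \<bullet> x + b)" using assms by (auto simp: affine_fun_def)
  then show ?thesis using affine_funI[of "to_ord c" b] by (simp add: inner_of_ord)
qed

text \<open>Simplices with a common facet \<open>B\<close> have volumes proportional to their heights, which are measured
  by the affine function \<open>l\<close> vanishing on the facet. The matrices of edge vectors from \<open>x0\<close>
  differ in one column, so Cramer's rule gives the quotient of the determinants.\<close>

lemma content_simplex_common_facet_ord:
  fixes B :: "(real^'n::{finite,wellorder}) set"
  assumes B: "finite B" "card B = CARD('n)" "a1 \<notin> B" "a2 \<notin> B"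
    and l: "affine_fun l" "l a1 = 1" "\<And>v. v \<in> B \<Longrightarrow> l v = 0"
    and ne: "measure lborel (convex hull (insert a1 B)) \<noteq> 0"
  shows "measure lborel (convex hull (insert a2 B)) = \<bar>l a2\<bar> * measure lborel (convex hull (insert a1 B))"
proof -
  obtain c b where lc: "l = (\<lambda>x. c \<bullet> x + b)" using l(1) by (auto simp: affine_fun_def)
  have "B \<noteq> {}" using B(2) by auto
  then obtain x0 where x0: "x0 \<in> B" by blast
  have "card (insert a1 B - {x0}) = CARD('n)" using B x0 by (simp add: card_insert_if)
  then obtain f :: "'n \<Rightarrow> real^('n::_)" where f: "bij_betw f UNIV (insert a1 B - {x0})"
    using finite_same_card_bij[of "UNIV :: 'n set" "insert a1 B - {x0}"] B(1) by auto
  have "a1 \<in> range f" using f x0 B(3) by (auto simp: bij_betw_def)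
  then obtain k where k: "f k = a1" by auto
  define f' where "f' = f(k := a2)"
  have injf: "inj f" and rf: "range f = insert a1 B - {x0}" using f by (auto simp: bij_betw_def)
  have fB: "f j \<in> B" if "j \<noteq> k" for j
  proof -
    have "f j \<noteq> a1" using injf k that by (auto simp: inj_def)
    then show ?thesis using rf by blast
  qed
  have f': "bij_betw f' UNIV (insert a2 B - {x0})"
    unfolding bij_betw_def
  proof
    show "inj f'"
      using injf fB B(4) unfolding f'_def inj_def by (metis fun_upd_apply)
    show "range f' = insert a2 B - {x0}"
    proof
      show "range f' \<subseteq> insert a2 B - {x0}"
      proof
        fix y assume "y \<in> range f'"
        then obtain j where "y = f' j" by blast
        moreover have "f j \<noteq> x0" using rf by blast
        ultimately show "y \<in> insert a2 B - {x0}" using fB[of j] x0 B(4) by (auto simp: f'_def)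
      qed
      show "insert a2 B - {x0} \<subseteq> range f'"
      proof
        fix y assume y: "y \<in> insert a2 B - {x0}"
        show "y \<in> range f'"
        proof (cases "y = a2")
          case True
          then show ?thesis by (intro range_eqI[of _ _ k]) (simp add: f'_def)
        next
          case False
          then have "y \<in> range f" using y rf by blast
          then obtain j where j: "y = f j" by blast
          have "j \<noteq> k" using j k y False B(3) by auto
          then show ?thesis using j by (intro range_eqI[of _ _ j]) (simp add: f'_def)
        qed
      qed
    qed
  qed
  define M where "M = (\<chi> i j. f j $ i - x0 $ i)"
  define M' where "M' = (\<chi> i j. f' j $ i - x0 $ i)"
  have cM: "measure lborel (convex hull (insert a1 B)) = \<bar>det M\<bar> / fact CARD('n)"
    unfolding M_def using B x0 f by (intro content_simplex) auto
  have cM': "measure lborel (convex hull (insert a2 B)) = \<bar>det M'\<bar> / fact CARD('n)"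
    unfolding M'_def using B x0 f' by (intro content_simplex) auto
  have "det M \<noteq> 0" using ne cM by auto
  then obtain N where inv: "M ** N = mat 1" by (auto simp: invertible_det_nz[symmetric] invertible_def)
  define y where "y = N *v (a2 - x0)"
  have My: "M *v y = a2 - x0"
    by (simp add: y_def matrix_vector_mul_assoc inv)
  have "M' = (\<chi> i j. if j = k then (M *v y) $ i else M $ i $ j)"
    unfolding My by (simp add: M'_def M_def f'_def vec_eq_iff)
  then have det: "det M' = y $ k * det M" by (simp add: cramer_lemma)
  have lj: "c \<bullet> (f j - x0) = (if j = k then 1 else 0)" for j
  proof -
    have "l (f j) = (if j = k then 1 else 0)" using l(2,3) k fB[of j] by simp
    then show ?thesis using l(3)[OF x0] by (auto simp: lc inner_diff_right split: if_splits)
  qed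
  have "l a2 = c \<bullet> (a2 - x0)" using l(3)[OF x0] by (simp add: lc inner_diff_right)
  also have "\<dots> = c \<bullet> (\<Sum>j\<in>UNIV. y $ j *\<^sub>R (f j - x0))"
    unfolding My[symmetric] by (rule arg_cong) (simp add: vec_eq_iff matrix_vector_mult_def M_def mult.commute)
  also have "\<dots> = y $ k"
    by (simp add: inner_sum_right lj if_distrib cong: if_cong)
  finally show ?thesis using cM cM' det by (simp add: abs_mult)
qed

lemma content_simplex_common_facet:
  fixes B :: "(real^'n) set"
  assumes B: "finite B" "card B = CARD('n)" "a1 \<notin> B" "a2 \<notin> B"
    and l: "affine_fun l" "l a1 = 1" "\<And>v. v \<in> B \<Longrightarrow> l v = 0"
    and ne: "measure lborel (convex hull (insert a1 B)) \<noteq> 0"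
  shows "measure lborel (convex hull (insert a2 B)) = \<bar>l a2\<bar> * measure lborel (convex hull (insert a1 B))"
proof -
  have inj: "inj (to_ord :: real^'n \<Rightarrow> _)" by (rule inj_on_inverseI[of _ of_ord]) simp
  have hull: "measure lborel (convex hull (to_ord ` X)) = measure lborel (convex hull X)" if "finite X"
    for X :: "(real^'n) set"
    using content_to_ord[OF finite_imp_compact_convex_hull[OF that]]
    by (simp add: convex_hull_linear_image[OF linear_to_ord])
  have "CARD('n ord_copy) = CARD('n)" by (rule bij_betw_same_card[OF bij_mk_ord, symmetric])
  then have "measure lborel (convex hull (insert (to_ord a2) (to_ord ` B))) =
      \<bar>l (of_ord (to_ord a2))\<bar> * measure lborel (convex hull (insert (to_ord a1) (to_ord ` B)))"
    using B l ne hull[of "insert a1 B"] inj card_image[OF inj_on_subset[OF inj subset_UNIV], of B]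
    by (intro content_simplex_common_facet_ord affine_fun_of_ord) (auto simp: inj_eq)
  then show ?thesis using hull[of "insert a1 B"] hull[of "insert a2 B"] B(1) by simp
qed

text \<open>Linear involutions have determinant \<open>1\<close> or \<open>-1\<close>, hence preserve Lebesgue measure.\<close>

lemma distr_linear_involution_ord:
  fixes f :: "real^'n::{finite,wellorder} \<Rightarrow> real^'n::{finite,wellorder}"
  assumes f: "linear f" and inv: "\<And>x. f (f x) = x"
  shows "distr lborel borel f = lborel"
proof (rule lborel_eq_vecI[symmetric])
  have [measurable]: "f \<in> borel_measurable borel"
    using f by (rule linear_imp_borel)
  have "f \<circ> f = id" using inv by auto
  then have "matrix f ** matrix f = mat 1" using matrix_compose[OF f f] by (simp add: matrix_id_mat_1)
  then have "det (matrix f) * det (matrix f) = 1" by (metis det_I det_mul)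
  then have "\<bar>det (matrix f)\<bar>\<^sup>2 = 1\<^sup>2" by (simp add: power2_eq_square)
  then have det: "\<bar>det (matrix f)\<bar> = 1" by (rule power2_eq_imp_eq) auto
  fix l u :: "real^('n::_)" assume lu: "\<And>i. l $ i \<le> u $ i"
  have eq: "f -` box l u = f ` box l u"
    using inv by (auto simp: image_iff) metis
  have fb: "f ` box l u \<in> sets borel"
    unfolding eq[symmetric] using measurable_sets[of f borel borel "box l u"] by simp
  have bd: "bounded (f ` box l u)"
    by (rule bounded_linear_image) (use f in \<open>auto simp: linear_conv_bounded_linear\<close>)
  have "emeasure (distr lborel borel f) (box l u) = emeasure lborel (f ` box l u)"
    by (subst emeasure_distr) (auto simp: eq)
  also have "\<dots> = ennreal (measure lborel (f ` box l u))"
    using emeasure_bounded_finite[OF bd] by (intro emeasure_eq_ennreal_measure) (auto simp: less_top)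
  also have "measure lborel (f ` box l u) = measure lebesgue (f ` box l u)"
    using fb by simp
  also have "\<dots> = measure lebesgue (box l u)"
    using det f by (subst measure_lebesgue_linear_transformation) auto
  also have "ennreal \<dots> = emeasure lborel (box l u)"
    using emeasure_bounded_finite[OF bounded_box, of l u]
    by (simp add: emeasure_eq_ennreal_measure less_top)
  also have "\<dots> = (\<Prod>i\<in>UNIV. u $ i - l $ i)" using lu by (rule emeasure_box_vec)
  finally show "emeasure (distr lborel borel f) (box l u) = ennreal (\<Prod>i\<in>UNIV. u $ i - l $ i)" .
qed simp

lemma distr_linear_involution:
  fixes f :: "real^'n \<Rightarrow> real^'n"
  assumes f: "linear f" and inv: "\<And>x. f (f x) = x"
  shows "distr lborel borel f = lborel"
proof -
  have fm: "f \<in> borel_measurable borel"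
    using f by (rule linear_imp_borel)
  let ?g = "to_ord \<circ> f \<circ> of_ord"
  have g: "linear ?g" using f linear_to_ord linear_of_ord by (intro linear_compose)
  then have gm: "?g \<in> borel_measurable borel"
    by (rule linear_imp_borel)
  have dg: "distr lborel borel ?g = lborel"
    using inv by (intro distr_linear_involution_ord[OF g]) simp
  have e: "f = of_ord \<circ> (?g \<circ> to_ord)" by (auto simp: fun_eq_iff)
  have m: "?g \<circ> to_ord \<in> borel_measurable borel" by (rule linear_imp_borel[OF linear_compose[OF linear_to_ord g]])
  have "distr lborel borel f = distr lborel borel (of_ord \<circ> (?g \<circ> to_ord))" using e by simp
  also have "\<dots> = distr (distr lborel borel (?g \<circ> to_ord)) borel of_ord"
    using m by (intro distr_distr[symmetric]) auto
  also have "distr lborel borel (?g \<circ> to_ord) = distr (distr lborel borel to_ord) borel ?g"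
    using gm by (intro distr_distr[symmetric]) auto
  also have "\<dots> = lborel" by (simp add: distr_to_ord dg)
  finally show ?thesis by (simp add: distr_of_ord)
qed

lemma integral_affine_involution:
  fixes T :: "real^'n \<Rightarrow> real^'n" and g :: "real^'n \<Rightarrow> real"
  assumes T: "linear T" "\<And>x. T (T x) = x" and inv: "\<And>x. T x + c \<in> A \<longleftrightarrow> x \<in> A"
    and A: "A \<in> sets borel" and g: "g \<in> borel_measurable borel"
  shows "(\<integral>x. g (T x + c) \<partial>lebesgue_on A) = (\<integral>x. g x \<partial>lebesgue_on A)"
proof -
  have Tm[measurable]: "T \<in> borel_measurable borel"
    using T(1) by (rule linear_imp_borel)
  note [measurable] = A g
  have conv: "(\<integral>x. h x \<partial>lebesgue_on A) = (\<integral>x. indicator A x * h x \<partial>lborel)"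
    if [measurable]: "h \<in> borel_measurable borel" for h :: "real^'n \<Rightarrow> real"
  proof -
    have "(\<integral>x. h x \<partial>lebesgue_on A) = (\<integral>x. indicator A x *\<^sub>R h x \<partial>lebesgue)"
      using A by (intro integral_restrict_space) auto
    also have "\<dots> = (\<integral>x. indicator A x *\<^sub>R h x \<partial>lborel)"
      by (rule integral_completion) measurable
    finally show ?thesis by simp
  qed
  have d: "distr lborel borel (\<lambda>x. T x + c) = lborel"
  proof -
    have "distr lborel borel ((+) c \<circ> T) = distr (distr lborel borel T) borel ((+) c)"
      by (intro distr_distr[symmetric]) auto
    then show ?thesis by (simp add: distr_linear_involution[OF T] lborel_distr_plus o_def add.commute)
  qed
  have "(\<integral>x. g (T x + c) \<partial>lebesgue_on A) = (\<integral>x. indicator A x * g (T x + c) \<partial>lborel)"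
    by (rule conv) measurable
  also have "\<dots> = (\<integral>x. indicator A (T x + c) * g (T x + c) \<partial>lborel)"
    by (intro Bochner_Integration.integral_cong) (auto simp: indicator_def inv)
  also have "\<dots> = (\<integral>x. indicator A x * g x \<partial>distr lborel borel (\<lambda>x. T x + c))"
    by (rule integral_distr[symmetric]) measurable
  also have "\<dots> = (\<integral>x. indicator A x * g x \<partial>lborel)" by (simp only: d)
  also have "\<dots> = (\<integral>x. g x \<partial>lebesgue_on A)" by (rule conv[symmetric]) measurable
  finally show ?thesis .
qed

text \<open>The chosen unit normal of a facet does satisfy its defining property.\<close>

lemma unit_normal_exists:
  fixes V :: "(real^'n) set"
  assumes V: "\<not> affine_dependent V" "card V = CARD('n)"
  shows "norm (unit_normal (convex hull V)) = 1 \<and>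
    (\<forall>x\<in>convex hull V. \<forall>y\<in>convex hull V. unit_normal (convex hull V) \<bullet> (x - y) = 0)"
proof -
  have "aff_dim V = int CARD('n) - 1" using V aff_dim_affine_independent[of V] by simp
  then obtain a b where ab: "a \<noteq> 0" "affine hull V = {x. a \<bullet> x = b}"
    using aff_dim_eq_hyperplane[of V] by auto
  have "a \<bullet> x = b" if "x \<in> convex hull V" for x
    using that convex_hull_subset_affine_hull[of V] ab(2) by blast
  then have "norm (inverse (norm a) *\<^sub>R a) = 1 \<and>
      (\<forall>x\<in>convex hull V. \<forall>y\<in>convex hull V. (inverse (norm a) *\<^sub>R a) \<bullet> (x - y) = 0)"
    using ab(1) by (simp add: inner_diff_right)
  then show ?thesis unfolding unit_normal_def by (rule someI)
qed

lemma affine_fun_compose: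
  fixes p :: "real^'n \<Rightarrow> real"
  assumes "affine_fun p"
  shows "affine_fun (\<lambda>x. p (x - (n \<bullet> (x - a)) *\<^sub>R n))"
proof -
  obtain c b where p: "p = (\<lambda>x. c \<bullet> x + b)" using assms by (auto simp: affine_fun_def)
  have "(\<lambda>x. p (x - (n \<bullet> (x - a)) *\<^sub>R n)) =
      (\<lambda>x. (c - (c \<bullet> n) *\<^sub>R n) \<bullet> x + (b + (c \<bullet> n) * (n \<bullet> a)))"
    by (auto simp: p fun_eq_iff inner_diff_left inner_diff_right algebra_simps)
  then show ?thesis by (rule ssubst) (rule affine_funI)
qed

text \<open>The integral of an affine function over a facet is a positive multiple of the sum of its values
  at the vertices. By linearity it suffices that the barycentric coordinates of any two vertices
  have the same integral over the prism, and this holds because the affine involution that swaps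
  the two vertices preserves the prism and the measure.\<close>

lemma facet_integral_affine:
  fixes V :: "(real^'n) set"
  assumes V: "\<not> affine_dependent V" "card V = CARD('n)"
  obtains m where "m > 0"
    "\<And>g. affine_fun g \<Longrightarrow> facet_integral (convex hull V) g = m * (\<Sum>v\<in>V. g v)"
proof -
  define F where "F = convex hull V"
  define n where "n = unit_normal F"
  have finV: "finite V" using V(1) by (rule aff_independent_finite)
  have n1: "norm n = 1" and orth: "\<And>x y. x \<in> F \<Longrightarrow> y \<in> F \<Longrightarrow> n \<bullet> (x - y) = 0"
    using unit_normal_exists[OF V] by (auto simp: n_def F_def)
  have nn: "n \<bullet> n = 1" using n1 by (simp add: dot_square_norm)
  have VF: "v \<in> F" if "v \<in> V" for v unfolding F_def using that by (rule hull_inc)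
  have "V \<noteq> {}" using V(2) by auto
  then obtain b0 where b0: "b0 \<in> V" by blast
  define a where "a = (SOME a. a \<in> F)"
  have aF: "a \<in> F" unfolding a_def using VF[OF b0] by (rule someI)
  define P where "P = {y + t *\<^sub>R n | y t. y \<in> F \<and> 0 \<le> t \<and> t \<le> 1}"
  define I where "I g = (\<integral>x. g (x - (n \<bullet> (x - a)) *\<^sub>R n) \<partial>lebesgue_on P)" for g :: "real^'n \<Rightarrow> real"
  have I: "facet_integral F g = I g" for g
    unfolding facet_integral_def I_def P_def n_def a_def Let_def ..
  have P_eq: "P = {x + y | x y. x \<in> F \<and> y \<in> (\<lambda>t. t *\<^sub>R n) ` {0..1}}"
    unfolding P_def image_def Bex_def atLeastAtMost_iff by blast
  have "compact F" unfolding F_def using finV by (rule finite_imp_compact_convex_hull)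
  then have Pc: "compact P"
    unfolding P_eq by (intro compact_sums compact_continuous_image continuous_intros) auto
  have P_Un: "P = (\<Union>x\<in>F. \<Union>y\<in>(\<lambda>t. t *\<^sub>R n) ` {0..1}. {x + y})"
    unfolding P_eq by blast
  have seg: "convex ((\<lambda>t. t *\<^sub>R n) ` {0..1})"
    by (intro convex_linear_image) (auto intro!: linearI simp: algebra_simps)
  have "convex F" by (simp add: F_def)
  then have Pconv: "convex P" unfolding P_Un using seg by (rule convex_sums)
  have Pb: "P \<in> sets borel" using Pc by (simp add: compact_imp_closed)
  have Plm: "P \<in> lmeasurable" using Pc by (rule lmeasurable_compact)
  then interpret finite_measure "lebesgue_on P" by (rule finite_measure_lebesgue_on)
  \<comment> \<open>the vertices of a nondegenerate simplex inside the prism\<close>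
  define W where "W = insert (b0 + n) V"
  have hyp: "n \<bullet> (x - b0) = 0" if "x \<in> affine hull V" for x
  proof -
    have "V \<subseteq> {x. n \<bullet> x = n \<bullet> b0}" using orth VF b0 by (auto simp: inner_diff_right)
    then have "affine hull V \<subseteq> {x. n \<bullet> x = n \<bullet> b0}" by (intro hull_minimal affine_hyperplane)
    then show ?thesis using that by (auto simp: inner_diff_right)
  qed
  have out: "b0 + n \<notin> affine hull V" using hyp[of "b0 + n"] nn by auto
  then have "b0 + n \<notin> V" using hull_inc by metis
  then have W: "simplex_vertices W"
    using V out finV by (auto simp: simplex_vertices_def W_def affine_independent_insert)
  have "V \<subseteq> P" using VF unfolding P_def by (force intro: exI[of _ 0])
  moreover have "b0 + n \<in> P" using VF[OF b0] unfolding P_def by (force intro: exI[of _ 1])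
  ultimately have "convex hull W \<subseteq> P" unfolding W_def using Pconv by (intro hull_minimal) auto
  then have "interior P \<noteq> {}" using simplex_interior_nonempty[OF W] interior_mono by blast
  then have "\<not> negligible P" by (metis interior_subset negligible_subset open_interior open_not_negligible)
  then have mP: "measure lebesgue P > 0"
    using Plm by (simp add: negligible_iff_measure zero_less_measure_iff)
  \<comment> \<open>barycentric coordinates, constant in the normal direction\<close>
  have "\<exists>l. affine_fun l \<and> (\<forall>w\<in>W. l w = (if w = b0 + n then (if v = b0 then 1 else 0) else if w = v then 1 else 0))"
    for v
    by (rule affine_interpolation[OF W, of "\<lambda>w. if w = b0 + n then (if v = b0 then 1 else 0) else if w = v then 1 else 0"]) blast
  then obtain l where la: "\<And>v. affine_fun (l v)"
    and lw: "\<And>v w. w \<in> W \<Longrightarrow> l v w = (if w = b0 + n then (if v = b0 then 1 else 0) else if w = v then 1 else 0)"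
    by metis
  have lV: "l v w = (if w = v then 1 else 0)" if "w \<in> V" for v w
    using lw[of w v] that \<open>b0 + n \<notin> V\<close> by (auto simp: W_def)
  have ln: "l v (b0 + n) = l v b0" for v using lw[of "b0 + n" v] lV[OF b0] by (auto simp: W_def)
  have "\<exists>c b. l v = (\<lambda>x. c \<bullet> x + b)" for v using la[of v] by (simp add: affine_fun_def)
  then obtain c b where lc: "\<And>v. l v = (\<lambda>x. c v \<bullet> x + b v)" by metis
  have cn: "c v \<bullet> n = 0" for v using ln[of v] by (simp add: lc inner_add_right)
  have Will: "finite W" "affine hull W = UNIV"
    using simplex_vertices_finite[OF W] simplex_vertices_hull[OF W] by auto
  have int: "integrable (lebesgue_on P) g" if "affine_fun g" for g
  proof -
    have "compact (g ` P)" using that Pc by (intro compact_continuous_image affine_fun_continuous)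
    then obtain B where B: "\<And>x. x \<in> P \<Longrightarrow> norm (g x) \<le> B"
      using compact_imp_bounded bounded_iff by (metis image_eqI)
    have "g \<in> borel_measurable (lebesgue_on P)"
      using affine_fun_continuous[OF that] Pb by (intro continuous_imp_measurable_on_sets_lebesgue) auto
    then show ?thesis using B by (intro integrable_const_bound[of _ B] AE_I2) auto
  qed
  define J where "J v = (\<integral>x. l v x \<partial>lebesgue_on P)" for v
  have swap: "J v = J v'" if v: "v \<in> V" "v' \<in> V" "v \<noteq> v'" for v v'
  proof -
    define k where "k = c v - c v'"
    define \<mu> where "\<mu> x = l v x - l v' x" for x
    define d where "d = v' - v"
    define T where "T x = x + (k \<bullet> x) *\<^sub>R d" for x
    have \<mu>: "\<mu> x = k \<bullet> x + (b v - b v')" for x by (simp add: \<mu>_def lc k_def inner_diff_left)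
    have cd: "c v \<bullet> d = - 1" "c v' \<bullet> d = 1"
      using lV[OF v(1), of v] lV[OF v(2), of v] lV[OF v(1), of v'] lV[OF v(2), of v'] v(3)
      by (auto simp: d_def lc inner_diff_right)
    have kd: "k \<bullet> d = - 2" by (simp add: k_def inner_diff_left cd)
    have kn: "k \<bullet> n = 0" by (simp add: k_def inner_diff_left cn)
    have T: "linear T" by (intro linearI) (simp_all add: T_def inner_add_right algebra_simps)
    have TT: "T (T x) = x" for x by (simp add: T_def inner_add_right kd algebra_simps)
    \<comment> \<open>the affine map that swaps the two vertices and fixes the others; it commutes with shifts along \<open>n\<close>\<close>
    define S where "S x = T x + (b v - b v') *\<^sub>R d" for x
    have S: "S x = x + \<mu> x *\<^sub>R d" for x by (simp add: S_def T_def \<mu> algebra_simps)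
    have \<mu>S: "\<mu> (S x) = - \<mu> x" for x unfolding S by (simp add: \<mu> inner_add_right kd algebra_simps)
    have SS: "S (S x) = x" for x unfolding S[of "S x"] \<mu>S by (simp add: S)
    have SV: "S ` V \<subseteq> F"
    proof
      fix y assume "y \<in> S ` V"
      then obtain u where u: "u \<in> V" "y = S u" by blast
      have "y = (if u = v then v' else if u = v' then v else u)"
        using u v by (auto simp: S \<mu>_def lV d_def)
      then show "y \<in> F" using u v VF by auto
    qed
    have SF: "S y \<in> F" if y: "y \<in> F" for y
    proof -
      obtain w where w: "\<forall>x\<in>V. 0 \<le> w x" "sum w V = 1" "(\<Sum>x\<in>V. w x *\<^sub>R x) = y"
        using y finV by (auto simp: F_def convex_hull_finite)
      have "S y = (\<Sum>x\<in>V. w x *\<^sub>R S x)"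
      proof -
        have "(\<Sum>x\<in>V. w x *\<^sub>R S x) = y + (\<Sum>x\<in>V. w x * \<mu> x) *\<^sub>R d"
          by (simp add: S scaleR_add_right sum.distrib w(3) scaleR_sum_left)
        moreover have "(\<Sum>x\<in>V. w x * \<mu> x) = \<mu> y"
          using affine_fun_affine_comb[OF _ finV w(2), of \<mu>] w(3) affine_funI[of k "b v - b v'"]
          by (simp add: \<mu>[abs_def])
        ultimately show ?thesis by (simp add: S)
      qed
      also have "\<dots> \<in> F"
        using w(1,2) SV finV by (intro convex_sum) (auto simp: F_def)
      finally show ?thesis .
    qed
    have SP: "S x \<in> P" if x: "x \<in> P" for x
    proof -
      obtain y t where yt: "x = y + t *\<^sub>R n" "y \<in> F" "0 \<le> t" "t \<le> 1" using x by (auto simp: P_def)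
      have "S x = S y + t *\<^sub>R n" by (simp add: S \<mu> yt(1) inner_add_right kn)
      then show ?thesis using SF[OF yt(2)] yt(3,4) unfolding P_def by blast
    qed
    have SPiff: "S x \<in> P \<longleftrightarrow> x \<in> P" for x using SP[of x] SP[of "S x"] SS[of x] by auto
    have lS: "l v (S x) = l v' x" for x
      unfolding S using cd by (simp add: lc inner_add_right \<mu>_def)
    have "J v' = (\<integral>x. l v (T x + (b v - b v') *\<^sub>R d) \<partial>lebesgue_on P)"
      unfolding J_def by (simp flip: S_def add: lS)
    also have "\<dots> = J v"
      unfolding J_def
      using SPiff Pb T TT affine_fun_continuous[OF la]
      by (intro integral_affine_involution) (auto simp: S_def intro: borel_measurable_continuous_onI)
    finally show ?thesis by simp
  qed
  have Jeq: "J v = J b0" if "v \<in> V" for v using swap[OF that b0] by (cases "v = b0") auto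
  have one: "(\<lambda>x. \<Sum>v\<in>V. l v x) = (\<lambda>x. 1)"
  proof (rule affine_fun_eq_on_affine_basis[OF _ affine_fun_const Will])
    show "affine_fun (\<lambda>x. \<Sum>v\<in>V. l v x)"
      using affine_fun_sum[OF finV la, of "\<lambda>_. 1"] by simp
    fix w assume "w \<in> W"
    then consider "w \<in> V" | "w = b0 + n" by (auto simp: W_def)
    then show "(\<Sum>v\<in>V. l v w) = 1"
      using finV b0 by cases (simp_all add: lV ln)
  qed
  have "(\<Sum>v\<in>V. J v) = (\<integral>x. (\<Sum>v\<in>V. l v x) \<partial>lebesgue_on P)"
    unfolding J_def using int la by (intro Bochner_Integration.integral_sum[symmetric]) auto
  also have "\<dots> = measure lebesgue P" unfolding one using Plm by (simp add: measure_restrict_space)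
  finally have "real CARD('n) * J b0 = measure lebesgue P" using Jeq V(2) by simp
  then have J0: "J b0 > 0" using mP by (metis zero_less_mult_pos of_nat_0_less_iff zero_less_card_finite)
  show thesis
  proof (rule that[OF J0])
    fix g :: "real^'n \<Rightarrow> real" assume g: "affine_fun g"
    have "(\<lambda>x. g (x - (n \<bullet> (x - a)) *\<^sub>R n)) = (\<lambda>x. \<Sum>v\<in>V. g v * l v x)"
    proof (rule affine_fun_eq_on_affine_basis[OF affine_fun_compose[OF g] _ Will])
      show "affine_fun (\<lambda>x. \<Sum>v\<in>V. g v * l v x)" by (rule affine_fun_sum[OF finV la])
      fix w assume "w \<in> W"
      then consider "w \<in> V" | "w = b0 + n" by (auto simp: W_def)
      then show "g (w - (n \<bullet> (w - a)) *\<^sub>R n) = (\<Sum>v\<in>V. g v * l v w)"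
      proof cases
        case 1
        then show ?thesis using orth[OF VF[OF 1] aF] finV by (simp add: lV if_distrib cong: if_cong)
      next
        case 2
        have "n \<bullet> (w - a) = 1" using orth[OF VF[OF b0] aF] nn by (simp add: 2 inner_add_right inner_diff_right)
        then show ?thesis using finV b0 by (simp add: 2 ln lV if_distrib cong: if_cong)
      qed
    qed
    then have "I g = (\<integral>x. (\<Sum>v\<in>V. g v * l v x) \<partial>lebesgue_on P)"
      unfolding I_def by simp
    also have "\<dots> = (\<Sum>v\<in>V. g v * J v)"
      unfolding J_def using int la by (subst Bochner_Integration.integral_sum) auto
    also have "\<dots> = J b0 * (\<Sum>v\<in>V. g v)"
      using Jeq by (simp add: sum_distrib_left mult.commute)
    finally show "facet_integral (convex hull V) g = J b0 * (\<Sum>v\<in>V. g v)"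
      using I by (simp add: F_def)
  qed
qed

section \<open>The discrete spaces\<close>

text \<open>The polynomial spaces of degree zero and one are the constant and the affine functions.\<close>

lemma poly_space_0: "poly_space 0 = {p :: real^'n \<Rightarrow> real. \<exists>c. p = (\<lambda>x. c)}"
proof -
  have "{\<alpha> :: 'n \<Rightarrow> nat. (\<Sum>i\<in>UNIV. \<alpha> i) \<le> 0} = {\<lambda>i. 0}" by (auto simp: fun_eq_iff)
  then show ?thesis
    unfolding poly_space_def by (auto simp: fun_eq_iff)
qed

lemma multi_indices_1:
  "{\<alpha> :: 'n::finite \<Rightarrow> nat. (\<Sum>i\<in>UNIV. \<alpha> i) \<le> 1} =
    insert (\<lambda>i. 0) ((\<lambda>j i. if i = j then 1 else 0) ` UNIV)" (is "?A = ?B")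
proof
  show "?A \<subseteq> ?B"
  proof
    fix \<alpha> :: "'n \<Rightarrow> nat" assume "\<alpha> \<in> ?A"
    then have s: "(\<Sum>i\<in>UNIV. \<alpha> i) \<le> 1" by simp
    show "\<alpha> \<in> ?B"
    proof (cases "\<exists>j. \<alpha> j \<noteq> 0")
      case True
      then obtain j where j: "\<alpha> j \<noteq> 0" by blast
      have "(\<Sum>i\<in>UNIV. \<alpha> i) = \<alpha> j + (\<Sum>i\<in>UNIV - {j}. \<alpha> i)" by (rule sum.remove) auto
      then have "\<alpha> j = 1" "(\<Sum>i\<in>UNIV - {j}. \<alpha> i) = 0" using s j by linarith+
      then have "\<alpha> = (\<lambda>i. if i = j then 1 else 0)" by (auto simp: fun_eq_iff)
      then show ?thesis by blast
    next
      case False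
      then have "\<alpha> = (\<lambda>i. 0)" by (simp add: fun_eq_iff)
      then show ?thesis by blast
    qed
  qed
  show "?B \<subseteq> ?A" by auto
qed

lemma poly_space_1_sum:
  fixes c :: "('n::finite \<Rightarrow> nat) \<Rightarrow> real"
  shows "(\<Sum>\<alpha> | (\<Sum>i\<in>UNIV. \<alpha> i) \<le> 1. c \<alpha> * (\<Prod>i\<in>UNIV. (x $ i) ^ \<alpha> i)) =
    c (\<lambda>i. 0) + (\<Sum>j\<in>UNIV. c (\<lambda>i. if i = j then 1 else 0) * x $ j)"
proof -
  let ?e = "\<lambda>(j::'n) i. if i = j then 1 else (0::nat)"
  have inj: "inj ?e" by (rule injI) (metis zero_neq_one)
  have nin: "(\<lambda>i. 0) \<notin> range ?e"
  proof
    assume "(\<lambda>i. 0) \<in> range ?e"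
    then obtain j where "(\<lambda>i. 0) = ?e j" by blast
    from fun_cong[OF this, of j] show False by simp
  qed
  have pr: "(\<Prod>i\<in>UNIV. (x $ i) ^ ?e j i) = x $ j" for j
  proof -
    have "(\<Prod>i\<in>UNIV. (x $ i) ^ ?e j i) = (\<Prod>i\<in>UNIV. if i = j then x $ i else 1)"
      by (rule prod.cong) auto
    then show ?thesis by simp
  qed
  show ?thesis
    unfolding multi_indices_1 using nin
    by (subst sum.insert) (auto simp: sum.reindex[OF inj] pr simp del: image_eqI)
qed

lemma poly_space_1: "poly_space 1 = {p :: real^'n \<Rightarrow> real. affine_fun p}"
proof (rule set_eqI, unfold mem_Collect_eq)
  fix p :: "real^'n \<Rightarrow> real"
  show "p \<in> poly_space 1 \<longleftrightarrow> affine_fun p"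
  proof
    assume "p \<in> poly_space 1"
    then have "\<exists>c :: ('n \<Rightarrow> nat) \<Rightarrow> real. \<forall>x. p x = c (\<lambda>i. 0) + (\<Sum>j\<in>UNIV. c (\<lambda>i. if i = j then 1 else 0) * x $ j)"
      unfolding poly_space_def poly_space_1_sum by (rule CollectD)
    then obtain c :: "('n \<Rightarrow> nat) \<Rightarrow> real" where "\<forall>x. p x = c (\<lambda>i. 0) + (\<Sum>j\<in>UNIV. c (\<lambda>i. if i = j then 1 else 0) * x $ j)"
      by (elim exE)
    then have "p = (\<lambda>x. (\<chi> j. c (\<lambda>i. if i = j then 1 else 0)) \<bullet> x + c (\<lambda>i. 0))"
      by (simp add: fun_eq_iff inner_vec_def)
    then show "affine_fun p" by (rule ssubst) (rule affine_funI)
  next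
    assume "affine_fun p"
    then obtain a b where p: "p = (\<lambda>x. a \<bullet> x + b)" by (auto simp: affine_fun_def)
    define c :: "('n \<Rightarrow> nat) \<Rightarrow> real"
      where "c \<alpha> = (if \<alpha> = (\<lambda>i. 0) then b else a $ (SOME j. \<alpha> j \<noteq> 0))" for \<alpha>
    have c1: "c (\<lambda>i. if i = j then 1 else 0) = a $ j" for j
      by (auto simp: c_def fun_eq_iff)
    have "p x = c (\<lambda>i. 0) + (\<Sum>j\<in>UNIV. c (\<lambda>i. if i = j then 1 else 0) * x $ j)" for x
      unfolding c1 by (simp add: p c_def inner_vec_def)
    then show "p \<in> poly_space 1"
      unfolding poly_space_def poly_space_1_sum by (intro CollectI exI[of _ c] allI)
  qed
qed

lemmas poly_space_Suc_0 = poly_space_1[unfolded One_nat_def]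

lemma L2_mult_integrable:
  assumes "f \<in> L2 \<Omega>" "g \<in> L2 \<Omega>"
  shows "integrable (lebesgue_on \<Omega>) (\<lambda>x. f x * g x)"
proof (rule Bochner_Integration.integrable_bound)
  show "integrable (lebesgue_on \<Omega>) (\<lambda>x. (f x)\<^sup>2 + (g x)\<^sup>2)" using assms by (simp add: L2_def)
  show "(\<lambda>x. f x * g x) \<in> borel_measurable (lebesgue_on \<Omega>)"
    using assms by (intro borel_measurable_times) (auto simp: L2_def)
  show "AE x in lebesgue_on \<Omega>. norm (f x * g x) \<le> norm ((f x)\<^sup>2 + (g x)\<^sup>2)"
  proof (intro AE_I2)
    fix x
    have "0 \<le> (\<bar>f x\<bar> - \<bar>g x\<bar>)\<^sup>2" by simp
    then have "2 * (\<bar>f x\<bar> * \<bar>g x\<bar>) \<le> (f x)\<^sup>2 + (g x)\<^sup>2" by (simp add: power2_diff)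
    moreover have "0 \<le> \<bar>f x\<bar> * \<bar>g x\<bar>" by simp
    ultimately show "norm (f x * g x) \<le> norm ((f x)\<^sup>2 + (g x)\<^sup>2)"
      using abs_ge_self[of "(f x)\<^sup>2 + (g x)\<^sup>2"] unfolding real_norm_def abs_mult by linarith
  qed
qed

lemma L2_lincomb:
  assumes "f \<in> L2 \<Omega>" "g \<in> L2 \<Omega>"
  shows "(\<lambda>x. s * f x + t * g x) \<in> L2 \<Omega>"
proof -
  have "(\<lambda>x. (s * f x + t * g x)\<^sup>2) = (\<lambda>x. s\<^sup>2 * (f x)\<^sup>2 + 2 * s * t * (f x * g x) + t\<^sup>2 * (g x)\<^sup>2)"
    by (simp add: fun_eq_iff power2_sum power_mult_distrib algebra_simps)
  moreover have "(\<lambda>x. s * f x + t * g x) \<in> borel_measurable (lebesgue_on \<Omega>)"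
    using assms by (intro borel_measurable_add borel_measurable_times borel_measurable_const) (auto simp: L2_def)
  ultimately show ?thesis
    using assms L2_mult_integrable[OF assms] by (simp add: L2_def)
qed

lemma L2_inner_lincomb:
  assumes "h \<in> L2 \<Omega>" "f \<in> L2 \<Omega>" "g \<in> L2 \<Omega>"
  shows "L2_inner \<Omega> h (\<lambda>x. s * f x + t * g x) = s * L2_inner \<Omega> h f + t * L2_inner \<Omega> h g"
proof -
  have "(\<lambda>x. h x * (s * f x + t * g x)) = (\<lambda>x. s * (h x * f x) + t * (h x * g x))"
    by (simp add: fun_eq_iff algebra_simps)
  then show ?thesis
    unfolding L2_inner_def using L2_mult_integrable[OF assms(1,2)] L2_mult_integrable[OF assms(1,3)]
    by simp
qed

lemma L2_inner_commute: "L2_inner \<Omega> f g = L2_inner \<Omega> g f"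
  by (simp add: L2_inner_def mult.commute)

lemma L2_inner_nonneg: "L2_inner \<Omega> f f \<ge> 0"
  by (simp add: L2_inner_def)

text \<open>The vertices of a polytope.\<close>

definition vert :: "(real^'n) set \<Rightarrow> (real^'n) set" where
  "vert S = {x. x extreme_point_of S}"

lemma vert_hull: "\<not> affine_dependent V \<Longrightarrow> vert (convex hull V) = V"
  by (simp add: vert_def extreme_point_of_convex_hull_affine_independent)

text \<open>The gradient of a broken \<open>P\<^sup>1\<close> function on an element. It is constant there, so its value at
  the origin serves as well as any other.\<close>

definition elem_grad :: "(real^'n \<Rightarrow> real) \<Rightarrow> (real^'n) set \<Rightarrow> real^'n" where
  "elem_grad v K = (\<chi> j. pderiv_at j (on_elem v K) 0)"

lemma pderiv_at_affine: "pderiv_at j (\<lambda>x. c \<bullet> x + b) x = c $ j"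
  by (rule locally_affine_has_derivative(2)[of 1 _ _ _ b]) auto

text \<open>A chosen interior point of an element; evaluation there gives the value of a piecewise constant
  function on the element.\<close>

definition inner_point :: "(real^'n) set \<Rightarrow> real^'n" where
  "inner_point K = (SOME x. x \<in> interior K)"

context mesh
begin

lemma vert_T:
  assumes "K \<in> \<T>"
  shows "simplex_vertices (vert K)" "convex hull (vert K) = K" "finite (vert K)" "vert K \<subseteq> K"
proof -
  obtain V where V: "simplex_vertices V" "K = convex hull V" using T_simplex[OF assms] by blast
  have "vert K = V" using V vert_hull by (auto simp: simplex_vertices_def)
  then show "simplex_vertices (vert K)" "convex hull (vert K) = K" "finite (vert K)" "vert K \<subseteq> K"
    using V simplex_vertices_finite hull_subset[of V convex] by auto
qed

lemma facet_T:
  assumes "K \<in> \<T>" "F facet_of K"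
  obtains u where "u \<in> vert K" "F = convex hull (vert K - {u})" "vert F = vert K - {u}"
    "\<not> affine_dependent (vert F)" "card (vert F) = CARD('n)" "convex hull (vert F) = F"
proof -
  obtain u where u: "u \<in> vert K" "F = convex hull (vert K - {u})"
    using facet_of_simplex_iff[OF vert_T(1)[OF assms(1)]] assms vert_T(2)[OF assms(1)] by auto
  have ind: "\<not> affine_dependent (vert K - {u})"
    using vert_T(1)[OF assms(1)] affine_independent_Diff unfolding simplex_vertices_def by blast
  have "vert F = vert K - {u}" unfolding u(2) by (rule vert_hull[OF ind])
  moreover have "card (vert K - {u}) = CARD('n)"
    using vert_T(1)[OF assms(1)] u(1) by (simp add: simplex_vertices_def)
  ultimately show thesis using that[of u] u ind by simp
qed

lemma facet_integral_eq_0_iff: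
  assumes "K \<in> \<T>" "F facet_of K" "affine_fun g"
  shows "facet_integral F g = 0 \<longleftrightarrow> (\<Sum>v\<in>vert F. g v) = 0"
proof -
  obtain u where u: "\<not> affine_dependent (vert F)" "card (vert F) = CARD('n)" "convex hull (vert F) = F"
    using facet_T[OF assms(1,2)] by blast
  obtain m where "m > 0" "\<And>g. affine_fun g \<Longrightarrow> facet_integral (convex hull (vert F)) g = m * (\<Sum>v\<in>vert F. g v)"
    using facet_integral_affine[OF u(1,2)] by blast
  then show ?thesis using assms(3) u(3) by simp
qed

lemma P_disc_L2: "v \<in> P_disc \<Omega> \<T> m \<Longrightarrow> v \<in> L2 \<Omega>"
  by (simp add: P_disc_def)

lemma P_disc_outside: "v \<in> P_disc \<Omega> \<T> m \<Longrightarrow> (\<And>K. K \<in> \<T> \<Longrightarrow> x \<notin> interior K) \<Longrightarrow> v x = 0"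
  by (auto simp: P_disc_def)

lemma P_disc_eq_0I:
  assumes "v \<in> P_disc \<Omega> \<T> m" and "\<And>K x. K \<in> \<T> \<Longrightarrow> x \<in> interior K \<Longrightarrow> v x = 0"
  shows "v = (\<lambda>x. 0)"
proof
  fix x show "v x = 0"
  proof (cases "\<exists>K\<in>\<T>. x \<in> interior K")
    case True
    then obtain K where "K \<in> \<T>" "x \<in> interior K" by (elim bexE)
    then show ?thesis by (rule assms(2))
  next
    case False
    then show ?thesis using P_disc_outside[OF assms(1)] by simp
  qed
qed

lemma on_elem_unique:
  assumes "K \<in> \<T>" "affine_fun p" "\<And>x. x \<in> interior K \<Longrightarrow> p x = v x"
  shows "on_elem v K = p"
  unfolding on_elem_def
proof (rule the_equality)
  show "p \<in> poly_space 1 \<and> (\<forall>x\<in>interior K. p x = v x)" using assms by (simp add: poly_space_Suc_0)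
  fix p' assume "p' \<in> poly_space 1 \<and> (\<forall>x\<in>interior K. p' x = v x)"
  then show "p' = p"
    using affine_fun_eq_on_open[OF _ assms(2) open_interior T_interior_ne[OF assms(1)], of p'] assms(3)
    by (simp add: poly_space_Suc_0)
qed

lemma on_elem:
  assumes "v \<in> P_disc \<Omega> \<T> 1" "K \<in> \<T>"
  shows "affine_fun (on_elem v K)" "x \<in> interior K \<Longrightarrow> on_elem v K x = v x"
proof -
  obtain p where p: "affine_fun p" "\<forall>x\<in>interior K. v x = p x"
    using assms unfolding P_disc_def poly_space_1 by blast
  then have "on_elem v K = p" using on_elem_unique[OF assms(2) p(1), of v] by simp
  then show "affine_fun (on_elem v K)" "x \<in> interior K \<Longrightarrow> on_elem v K x = v x" using p by auto
qed

lemma on_elem_lincomb: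
  assumes "v \<in> P_disc \<Omega> \<T> 1" "w \<in> P_disc \<Omega> \<T> 1" "K \<in> \<T>"
  shows "on_elem (\<lambda>x. s * v x + t * w x) K = (\<lambda>x. s * on_elem v K x + t * on_elem w K x)"
  using on_elem[OF assms(1,3)] on_elem[OF assms(2,3)]
  by (intro on_elem_unique assms affine_fun_lincomb) auto

lemma elem_grad_pderiv:
  assumes "v \<in> P_disc \<Omega> \<T> 1" "K \<in> \<T>"
  shows "pderiv_at j (on_elem v K) x = elem_grad v K $ j"
proof -
  obtain c b where "on_elem v K = (\<lambda>x. c \<bullet> x + b)"
    using on_elem(1)[OF assms] by (auto simp: affine_fun_def)
  then show ?thesis by (simp add: elem_grad_def pderiv_at_affine)
qed

lemma elem_grad_eq:
  assumes "on_elem v K = (\<lambda>x. c \<bullet> x + b)"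
  shows "elem_grad v K = c"
  by (simp add: elem_grad_def assms pderiv_at_affine vec_eq_iff)

lemma elem_grad_lincomb:
  assumes "v \<in> P_disc \<Omega> \<T> 1" "w \<in> P_disc \<Omega> \<T> 1" "K \<in> \<T>"
  shows "elem_grad (\<lambda>x. s * v x + t * w x) K = s *\<^sub>R elem_grad v K + t *\<^sub>R elem_grad w K"
proof -
  obtain c b c' b' where e: "on_elem v K = (\<lambda>x. c \<bullet> x + b)" "on_elem w K = (\<lambda>x. c' \<bullet> x + b')"
    using on_elem(1)[OF assms(1,3)] on_elem(1)[OF assms(2,3)] by (auto simp: affine_fun_def)
  have "on_elem (\<lambda>x. s * v x + t * w x) K = (\<lambda>x. (s *\<^sub>R c + t *\<^sub>R c') \<bullet> x + (s * b + t * b'))"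
    unfolding on_elem_lincomb[OF assms] e by (simp add: fun_eq_iff inner_add_left algebra_simps)
  then show ?thesis using elem_grad_eq[OF e(1)] elem_grad_eq[OF e(2)] elem_grad_eq by blast
qed

lemma inner_point: "K \<in> \<T> \<Longrightarrow> inner_point K \<in> interior K"
  unfolding inner_point_def using T_interior_ne by (meson ex_in_conv someI_ex)

lemma P_disc_0_const:
  assumes "q \<in> P_disc \<Omega> \<T> 0" "K \<in> \<T>" "x \<in> interior K"
  shows "q x = q (inner_point K)"
proof -
  obtain p where "p \<in> poly_space 0" and p: "\<forall>x\<in>interior K. q x = p x"
    using assms(1,2) unfolding P_disc_def by blast
  then obtain c where "p = (\<lambda>x. c)" by (auto simp: poly_space_0)
  then show ?thesis using p assms(3) inner_point[OF assms(2)] by simp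
qed

lemma P_disc_lincomb_gen:
  assumes "v \<in> P_disc \<Omega> \<T> m" "w \<in> P_disc \<Omega> \<T> m"
    and "\<And>p q. p \<in> poly_space m \<Longrightarrow> q \<in> poly_space m \<Longrightarrow> (\<lambda>x::real^'n. s * p x + t * q x) \<in> poly_space m"
  shows "(\<lambda>x. s * v x + t * w x) \<in> P_disc \<Omega> \<T> m"
  unfolding P_disc_def mem_Collect_eq
proof (intro conjI ballI allI impI)
  show "(\<lambda>x. s * v x + t * w x) \<in> L2 \<Omega>" by (intro L2_lincomb P_disc_L2[OF assms(1)] P_disc_L2[OF assms(2)])
  show "s * v x + t * w x = 0" if "x \<notin> \<Union>(interior ` \<T>)" for x
    using that assms(1,2) by (simp add: P_disc_def)
  fix K assume "K \<in> \<T>"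
  then obtain p q where "p \<in> poly_space m" "\<forall>x\<in>interior K. v x = p x"
    "q \<in> poly_space m" "\<forall>x\<in>interior K. w x = q x"
    using assms(1,2) unfolding P_disc_def by blast
  then show "\<exists>p\<in>poly_space m. \<forall>x\<in>interior K. s * v x + t * w x = p x"
    using assms(3) by (intro bexI[of _ "\<lambda>x. s * p x + t * q x"]) auto
qed

lemma P_disc_1_lincomb:
  assumes "v \<in> P_disc \<Omega> \<T> 1" "w \<in> P_disc \<Omega> \<T> 1"
  shows "(\<lambda>x. s * v x + t * w x) \<in> P_disc \<Omega> \<T> 1"
  using assms by (rule P_disc_lincomb_gen) (simp add: poly_space_Suc_0 affine_fun_lincomb)

lemma P_disc_0_lincomb:
  assumes "v \<in> P_disc \<Omega> \<T> 0" "w \<in> P_disc \<Omega> \<T> 0"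
  shows "(\<lambda>x. s * v x + t * w x) \<in> P_disc \<Omega> \<T> 0"
  using assms by (rule P_disc_lincomb_gen) (auto simp: poly_space_0)

text \<open>The mean value conditions on the facets, expressed through values at the vertices.\<close>

lemma X0_CR_iff:
  "v \<in> X0_CR \<Omega> \<T> \<longleftrightarrow> v \<in> P_disc \<Omega> \<T> 1 \<and>
    (\<forall>F\<in>interior_facets \<Omega> \<T>. \<forall>K\<in>\<T>. \<forall>K'\<in>\<T>. K \<noteq> K' \<and> F facet_of K \<and> F facet_of K' \<longrightarrow>
       (\<Sum>a\<in>vert F. on_elem v K a) = (\<Sum>a\<in>vert F. on_elem v K' a)) \<and>
    (\<forall>F\<in>boundary_facets \<Omega> \<T>. \<forall>K\<in>\<T>. F facet_of K \<longrightarrow> (\<Sum>a\<in>vert F. on_elem v K a) = 0)"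
proof -
  have 1: "facet_integral F (\<lambda>x. on_elem v K x - on_elem v K' x) = 0 \<longleftrightarrow>
      (\<Sum>a\<in>vert F. on_elem v K a) = (\<Sum>a\<in>vert F. on_elem v K' a)"
    if "v \<in> P_disc \<Omega> \<T> 1" "K \<in> \<T>" "K' \<in> \<T>" "F facet_of K" for K K' F
  proof -
    have "affine_fun (\<lambda>x. on_elem v K x - on_elem v K' x)"
      using affine_fun_lincomb[OF on_elem(1)[OF that(1,2)] on_elem(1)[OF that(1,3)], of 1 "-1"] by simp
    then show ?thesis using that by (simp add: facet_integral_eq_0_iff sum_subtractf)
  qed
  have 2: "facet_integral F (on_elem v K) = 0 \<longleftrightarrow> (\<Sum>a\<in>vert F. on_elem v K a) = 0"
    if "v \<in> P_disc \<Omega> \<T> 1" "K \<in> \<T>" "F facet_of K" for K F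
    using that on_elem(1) by (simp add: facet_integral_eq_0_iff)
  show ?thesis
    unfolding X0_CR_def X_CR_def mem_Collect_eq conj_assoc
    by (intro conj_cong ball_cong refl) (auto simp: 1 2 simp del: One_nat_def)
qed

lemma X0_CR_interior:
  assumes "v \<in> X0_CR \<Omega> \<T>" "F \<in> interior_facets \<Omega> \<T>" "K \<in> \<T>" "K' \<in> \<T>" "K \<noteq> K'"
    "F facet_of K" "F facet_of K'"
  shows "(\<Sum>a\<in>vert F. on_elem v K a) = (\<Sum>a\<in>vert F. on_elem v K' a)"
proof -
  have "\<forall>F\<in>interior_facets \<Omega> \<T>. \<forall>K\<in>\<T>. \<forall>K'\<in>\<T>. K \<noteq> K' \<and> F facet_of K \<and> F facet_of K' \<longrightarrow>
      (\<Sum>a\<in>vert F. on_elem v K a) = (\<Sum>a\<in>vert F. on_elem v K' a)"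
    using assms(1) unfolding X0_CR_iff by (elim conjE)
  from bspec[OF bspec[OF bspec[OF this assms(2)] assms(3)] assms(4)] show ?thesis
    using assms(5-7) by simp
qed

lemma X0_CR_boundary:
  assumes "v \<in> X0_CR \<Omega> \<T>" "F \<in> boundary_facets \<Omega> \<T>" "K \<in> \<T>" "F facet_of K"
  shows "(\<Sum>a\<in>vert F. on_elem v K a) = 0"
proof -
  have "\<forall>F\<in>boundary_facets \<Omega> \<T>. \<forall>K\<in>\<T>. F facet_of K \<longrightarrow> (\<Sum>a\<in>vert F. on_elem v K a) = 0"
    using assms(1) unfolding X0_CR_iff by (elim conjE)
  from bspec[OF bspec[OF this assms(2)] assms(3)] show ?thesis using assms(4) by simp
qed

lemma X0_CR_P_disc: "v \<in> X0_CR \<Omega> \<T> \<Longrightarrow> v \<in> P_disc \<Omega> \<T> 1"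
  by (simp add: X0_CR_iff)

lemma X0_CR_lincomb:
  assumes "v \<in> X0_CR \<Omega> \<T>" "w \<in> X0_CR \<Omega> \<T>"
  shows "(\<lambda>x. s * v x + t * w x) \<in> X0_CR \<Omega> \<T>"
proof -
  have vw: "v \<in> P_disc \<Omega> \<T> 1" "w \<in> P_disc \<Omega> \<T> 1" using assms X0_CR_P_disc by auto
  have s: "(\<Sum>a\<in>vert F. on_elem (\<lambda>x. s * v x + t * w x) K a) =
      s * (\<Sum>a\<in>vert F. on_elem v K a) + t * (\<Sum>a\<in>vert F. on_elem w K a)" if "K \<in> \<T>" for K F
    unfolding on_elem_lincomb[OF vw that] by (simp add: sum.distrib sum_distrib_left)
  show ?thesis
    unfolding X0_CR_iff
  proof (intro conjI ballI impI)
    show "(\<lambda>x. s * v x + t * w x) \<in> P_disc \<Omega> \<T> 1" by (rule P_disc_1_lincomb[OF vw])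
  next
    fix F K K' assume "F \<in> interior_facets \<Omega> \<T>" "K \<in> \<T>" "K' \<in> \<T>" "K \<noteq> K' \<and> F facet_of K \<and> F facet_of K'"
    then have "(\<Sum>a\<in>vert F. on_elem v K a) = (\<Sum>a\<in>vert F. on_elem v K' a)"
      "(\<Sum>a\<in>vert F. on_elem w K a) = (\<Sum>a\<in>vert F. on_elem w K' a)"
      by (simp_all add: X0_CR_interior[OF assms(1)] X0_CR_interior[OF assms(2)])
    then show "(\<Sum>a\<in>vert F. on_elem (\<lambda>x. s * v x + t * w x) K a) =
        (\<Sum>a\<in>vert F. on_elem (\<lambda>x. s * v x + t * w x) K' a)"
      using \<open>K \<in> \<T>\<close> \<open>K' \<in> \<T>\<close> by (simp add: s)
  next
    fix F K assume "F \<in> boundary_facets \<Omega> \<T>" "K \<in> \<T>" "F facet_of K"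
    then have "(\<Sum>a\<in>vert F. on_elem v K a) = 0" "(\<Sum>a\<in>vert F. on_elem w K a) = 0"
      by (simp_all add: X0_CR_boundary[OF assms(1)] X0_CR_boundary[OF assms(2)])
    then show "(\<Sum>a\<in>vert F. on_elem (\<lambda>x. s * v x + t * w x) K a) = 0"
      using \<open>K \<in> \<T>\<close> by (simp add: s)
  qed
qed

lemma Q_CR_lincomb:
  assumes "p \<in> Q_CR \<Omega> \<T>" "q \<in> Q_CR \<Omega> \<T>"
  shows "(\<lambda>x. s * p x + t * q x) \<in> Q_CR \<Omega> \<T>"
proof -
  have fin: "finite_measure (lebesgue_on \<Omega>)"
    using bounded_dom open_dom by (intro finite_measure_lebesgue_on bounded_set_imp_lmeasurable) auto
  have L: "p \<in> L2 \<Omega>" "q \<in> L2 \<Omega>" using assms P_disc_L2 by (auto simp: Q_CR_def)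
  have one: "(\<lambda>x. 1) \<in> L2 \<Omega>" using finite_measure.integrable_const[OF fin] by (simp add: L2_def)
  have "L2_inner \<Omega> (\<lambda>x. 1) (\<lambda>x. s * p x + t * q x) = 0"
    using assms by (simp add: L2_inner_lincomb[OF one L]) (simp add: L2_inner_def Q_CR_def L2_zmv_def)
  then show ?thesis
    using assms P_disc_0_lincomb[of p q] L2_lincomb[OF L] by (simp add: L2_inner_def Q_CR_def L2_zmv_def)
qed

lemma vec_space_lincomb:
  assumes "\<And>f g. f \<in> V \<Longrightarrow> g \<in> V \<Longrightarrow> (\<lambda>x::real^'n. s * f x + t * g x) \<in> V"
    and "v \<in> vec_space V" "w \<in> vec_space V"
  shows "(\<lambda>x. s *\<^sub>R v x + t *\<^sub>R w x) \<in> vec_space V"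
  using assms by (simp add: vec_space_def)

lemma CR_space_lincomb:
  assumes "x \<in> CR_space \<Omega> \<T>" "y \<in> CR_space \<Omega> \<T>"
  shows "lincomb s x t y \<in> CR_space \<Omega> \<T>"
proof -
  have "fst x \<in> vec_space (X0_CR \<Omega> \<T>)" "fst y \<in> vec_space (X0_CR \<Omega> \<T>)"
    "snd x \<in> Q_CR \<Omega> \<T>" "snd y \<in> Q_CR \<Omega> \<T>"
    using assms by (simp_all add: CR_space_def mem_Times_iff)
  then show ?thesis
    unfolding CR_space_def lincomb_def mem_Times_iff fst_conv snd_conv
    by (intro conjI vec_space_lincomb X0_CR_lincomb Q_CR_lincomb)
qed

lemma CR_space_comp: "x \<in> CR_space \<Omega> \<T> \<Longrightarrow> (\<lambda>z. fst x z $ i) \<in> X0_CR \<Omega> \<T>"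
  by (simp add: CR_space_def mem_Times_iff vec_space_def)

lemma CR_space_P1: "x \<in> CR_space \<Omega> \<T> \<Longrightarrow> (\<lambda>z. fst x z $ i) \<in> P_disc \<Omega> \<T> 1"
  using CR_space_comp X0_CR_P_disc by blast

lemma CR_space_Q: "x \<in> CR_space \<Omega> \<T> \<Longrightarrow> snd x \<in> Q_CR \<Omega> \<T>"
  by (simp add: CR_space_def mem_Times_iff)

lemma Q_CR_P0: "q \<in> Q_CR \<Omega> \<T> \<Longrightarrow> q \<in> P_disc \<Omega> \<T> 0" and Q_CR_L2: "q \<in> Q_CR \<Omega> \<T> \<Longrightarrow> q \<in> L2 \<Omega>"
  by (auto simp: Q_CR_def P_disc_def)

lemma vol_pos: "K \<in> \<T> \<Longrightarrow> measure lebesgue K > 0"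
proof -
  assume K: "K \<in> \<T>"
  have "\<not> negligible K"
    using T_interior_ne[OF K] by (metis interior_subset negligible_subset open_interior open_not_negligible)
  then show ?thesis
    using lmeasurable_compact[OF T_compact[OF K]] by (simp add: negligible_iff_measure zero_less_measure_iff)
qed

lemma h_inner_eq:
  assumes "\<And>i. (\<lambda>x. v x $ i) \<in> P_disc \<Omega> \<T> 1" "\<And>i. (\<lambda>x. w x $ i) \<in> P_disc \<Omega> \<T> 1"
  shows "h_inner \<T> v w = (\<Sum>K\<in>\<T>. measure lebesgue K *
    (\<Sum>i\<in>UNIV. elem_grad (\<lambda>x. v x $ i) K \<bullet> elem_grad (\<lambda>x. w x $ i) K))"
  unfolding h_inner_def
proof (rule sum.cong[OF refl])
  fix K assume K: "K \<in> \<T>"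
  have "measure (lebesgue_on K) (space (lebesgue_on K)) = measure lebesgue K"
    using T_closed[OF K] by (simp add: measure_restrict_space)
  then show "(\<integral>x. (\<Sum>i\<in>UNIV. \<Sum>j\<in>UNIV. broken_pd v K i j x * broken_pd w K i j x) \<partial>lebesgue_on K) =
      measure lebesgue K * (\<Sum>i\<in>UNIV. elem_grad (\<lambda>x. v x $ i) K \<bullet> elem_grad (\<lambda>x. w x $ i) K)"
    by (simp add: broken_pd_def elem_grad_pderiv[OF assms(1) K] elem_grad_pderiv[OF assms(2) K] inner_vec_def)
qed

lemma div_h_eq:
  assumes v: "\<And>i. (\<lambda>x. v x $ i) \<in> P_disc \<Omega> \<T> 1" and q: "q \<in> P_disc \<Omega> \<T> 0"
  shows "div_h \<T> v q = (\<Sum>K\<in>\<T>. measure lebesgue K * q (inner_point K) *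
    (\<Sum>i\<in>UNIV. elem_grad (\<lambda>x. v x $ i) K $ i))"
  unfolding div_h_def
proof (rule sum.cong[OF refl])
  fix K assume K: "K \<in> \<T>"
  let ?d = "\<Sum>i\<in>UNIV. elem_grad (\<lambda>x. v x $ i) K $ i"
  \<comment> \<open>on the boundary of \<open>K\<close> the representative of \<open>q\<close> vanishes\<close>
  have qK: "q x = indicator (interior K) x * q (inner_point K)" if "x \<in> K" for x
  proof (cases "x \<in> interior K")
    case True
    then show ?thesis using P_disc_0_const[OF q K True] by simp
  next
    case False
    have "x \<notin> interior K'" if "K' \<in> \<T>" for K'
      using T_interior_unique[OF that K] False \<open>x \<in> K\<close> by blast
    then have "q x = 0" using P_disc_outside[OF q] by blast
    then show ?thesis using False by simp
  qed
  have "(\<integral>x. q x * (\<Sum>i\<in>UNIV. broken_pd v K i i x) \<partial>lebesgue_on K) =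
      (\<integral>x. indicator (interior K) x * (q (inner_point K) * ?d) \<partial>lebesgue_on K)"
    by (intro Bochner_Integration.integral_cong refl)
      (simp add: broken_pd_def elem_grad_pderiv[OF v K] qK)
  also have "\<dots> = measure (lebesgue_on K) (interior K \<inter> K) * (q (inner_point K) * ?d)"
    by (simp add: Int_commute)
  also have "measure (lebesgue_on K) (interior K \<inter> K) = measure lebesgue (interior K)"
    using T_closed[OF K] interior_subset[of K] by (simp add: measure_restrict_space Int_absorb2)
  also have "measure lebesgue (interior K) = measure lebesgue K"
    using measure_interior[of K] T_compact[OF K] negligible_convex_frontier[OF T_convex[OF K]]
    by (simp add: compact_imp_bounded)
  finally show "(\<integral>x. q x * (\<Sum>i\<in>UNIV. broken_pd v K i i x) \<partial>lebesgue_on K) =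
      measure lebesgue K * q (inner_point K) * ?d" by simp
qed

text \<open>The broken gradient is injective: a function with vanishing broken gradient is constant
  on every element, its constants agree across interior facets and vanish at the boundary.\<close>

lemma broken_gradient_injective:
  assumes v: "v \<in> X0_CR \<Omega> \<T>" and g: "\<And>K. K \<in> \<T> \<Longrightarrow> elem_grad v K = 0"
  shows "v = (\<lambda>x. 0)"
proof -
  note vP = X0_CR_P_disc[OF v]
  have const: "on_elem v K x = v (inner_point K)" if K: "K \<in> \<T>" for K x
  proof -
    obtain c b where e: "on_elem v K = (\<lambda>x. c \<bullet> x + b)"
      using on_elem(1)[OF vP K] by (auto simp: affine_fun_def)
    then have "c = 0" using elem_grad_eq[OF e] g[OF K] by simp
    then show ?thesis using on_elem(2)[OF vP K inner_point[OF K]] by (simp add: e)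
  qed
  have card_ne_0: "real (card (vert F)) \<noteq> 0" if "K \<in> \<T>" "F facet_of K" for F K
    by (rule facet_T[OF that]) simp
  obtain F K0 where F: "F \<in> boundary_facets \<Omega> \<T>" "K0 \<in> \<T>" "F facet_of K0"
    using boundary_facets_ne by (auto simp: boundary_facets_def mesh_facets_def)
  have "(\<Sum>a\<in>vert F. on_elem v K0 a) = 0" by (rule X0_CR_boundary[OF v F])
  then have z0: "v (inner_point K0) = 0" using const[OF F(2)] card_ne_0[OF F(2,3)] by simp
  have zero: "v (inner_point K) = 0" if K: "K \<in> \<T>" for K
  proof (rule facet_connected[of "\<lambda>K. v (inner_point K) = 0", OF _ F(2) K z0])
    fix K K' F assume *: "K \<in> \<T>" "K' \<in> \<T>" "K \<noteq> K'" "F \<in> interior_facets \<Omega> \<T>"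
      "F facet_of K" "F facet_of K'" "v (inner_point K) = 0"
    then have "(\<Sum>a\<in>vert F. on_elem v K a) = (\<Sum>a\<in>vert F. on_elem v K' a)"
      by (intro X0_CR_interior[OF v])
    then show "v (inner_point K') = 0"
      using * const[OF *(1)] const[OF *(2)] card_ne_0[OF *(1,5)] by simp
  qed
  show ?thesis
    by (rule P_disc_eq_0I[OF vP]) (metis on_elem(2)[OF vP] const zero)
qed

end

section \<open>The basis function of an interior facet\<close>

lemma barycentric_coordinates:
  fixes V :: "(real^'n) set"
  assumes V: "simplex_vertices V"
  shows "\<exists>l. (\<forall>v. affine_fun (l v)) \<and> (\<forall>v. \<forall>u\<in>V. l v u = (if u = v then 1 else 0)) \<and>
    (\<forall>x. (\<Sum>v\<in>V. l v x) = 1) \<and> (\<forall>x. (\<Sum>v\<in>V. l v x *\<^sub>R v) = x)"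
proof -
  have fin: "finite V" using simplex_vertices_finite[OF V] .
  have "\<exists>l. affine_fun l \<and> (\<forall>u\<in>V. l u = (if u = v then 1 else 0))" for v
    by (rule affine_interpolation[OF V, of "\<lambda>u. if u = v then 1 else 0"]) blast
  then obtain l where l: "\<And>v. affine_fun (l v)" "\<And>v u. u \<in> V \<Longrightarrow> l v u = (if u = v then 1 else 0)"
    by metis
  have "(\<Sum>v\<in>V. l v x) = 1 \<and> (\<Sum>v\<in>V. l v x *\<^sub>R v) = x" for x
  proof -
    have "x \<in> affine hull V" using simplex_vertices_hull[OF V] by simp
    then obtain u where u: "sum u V = 1" "(\<Sum>v\<in>V. u v *\<^sub>R v) = x"
      using affine_hull_finite[OF fin] by auto
    have "l v x = u v" if "v \<in> V" for v
    proof -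
      have "l v x = (\<Sum>w\<in>V. u w * l v w)" using affine_fun_affine_comb[OF l(1) fin u(1)] u(2) by simp
      also have "\<dots> = (\<Sum>w\<in>V. if w = v then u w else 0)" by (intro sum.cong) (auto simp: l(2))
      finally show ?thesis using that fin by simp
    qed
    then show ?thesis using u by simp
  qed
  then have "\<forall>x. (\<Sum>v\<in>V. l v x) = 1" "\<forall>x. (\<Sum>v\<in>V. l v x *\<^sub>R v) = x" by iprover+
  moreover have "\<forall>v. affine_fun (l v)" "\<forall>v. \<forall>u\<in>V. l v u = (if u = v then 1 else 0)"
    by (intro allI l(1), intro allI ballI l(2))
  ultimately show ?thesis by iprover
qed

context mesh
begin

lemma facet_vertices:
  assumes "K \<in> \<T>" "F facet_of K"
  obtains a where "a \<notin> vert F" "vert K = insert a (vert F)"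
proof -
  have "\<exists>u. u \<in> vert K \<and> vert F = vert K - {u}"
    by (rule facet_T[OF assms]) (intro exI conjI; assumption)
  then obtain u where "u \<in> vert K" "vert F = vert K - {u}" by (elim exE conjE)
  then show thesis by (intro that[of u]) auto
qed

text \<open>Two elements with a common facet lie on opposite sides of it. The second element is
  nondegenerate, so \<open>a2\<close> is not in the plane of the facet; if it were on the side of \<open>a1\<close>, a point slightly off the
  barycentre of the facet in the direction of \<open>a2\<close> would be interior to the first element and belong to the
  second.\<close>

lemma opposite_sides:
  assumes K: "K1 \<in> \<T>" "K2 \<in> \<T>" "K1 \<noteq> K2" and F: "F facet_of K1" "F facet_of K2"
    and a: "vert K1 = insert a1 (vert F)" "a1 \<notin> vert F" "vert K2 = insert a2 (vert F)" "a2 \<notin> vert F"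
    and l: "affine_fun l" "l a1 = 1" "\<And>v. v \<in> vert F \<Longrightarrow> l v = 0"
  shows "l a2 < 0"
proof (rule ccontr)
  assume "\<not> l a2 < 0"
  have S1: "simplex_vertices (vert K1)" and S2: "simplex_vertices (vert K2)" using vert_T K by auto
  have finF: "finite (vert F)" using vert_T(3)[OF K(1)] a(1) by simp
  have "l a2 \<noteq> 0"
  proof
    assume z: "l a2 = 0"
    have "l = (\<lambda>x. 0)"
      using vert_T(3)[OF K(2)] z l a(3)
      by (intro affine_fun_eq_on_affine_basis[OF l(1) affine_fun_const _ simplex_vertices_hull[OF S2]]) auto
    then show False using l(2) by simp
  qed
  then have pos: "l a2 > 0" using \<open>\<not> l a2 < 0\<close> by simp
  obtain L where L0: "\<forall>v. affine_fun (L v)" "\<forall>v. \<forall>u\<in>vert K1. L v u = (if u = v then 1 else 0)"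
    "\<forall>x. (\<Sum>v\<in>vert K1. L v x) = 1" "\<forall>x. (\<Sum>v\<in>vert K1. L v x *\<^sub>R v) = x"
    using barycentric_coordinates[OF S1] by (elim exE conjE)
  have L: "\<And>v. affine_fun (L v)" "\<And>v u. u \<in> vert K1 \<Longrightarrow> L v u = (if u = v then 1 else 0)"
    "\<And>x. (\<Sum>v\<in>vert K1. L v x) = 1" "\<And>x. (\<Sum>v\<in>vert K1. L v x *\<^sub>R v) = x"
    using L0 by simp_all
  have La1: "L a1 = l"
    using vert_T(3)[OF K(1)] l a L(2)
    by (intro affine_fun_eq_on_affine_basis[OF L(1) l(1) _ simplex_vertices_hull[OF S1]]) auto
  have cF: "card (vert F) = CARD('n)" by (rule facet_T[OF K(1) F(1)]) simp
  define c where "c = (\<Sum>v\<in>vert F. inverse (real CARD('n)) *\<^sub>R v)"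
  have sum1: "(\<Sum>v\<in>vert F. inverse (real CARD('n))) = 1" by (simp add: cF)
  have cK: "c \<in> K2"
  proof -
    have "c \<in> convex hull (vert F)"
      unfolding c_def using finF sum1 by (intro convex_sum) (auto intro: hull_inc)
    also have "convex hull (vert F) \<subseteq> convex hull (vert K2)" by (rule hull_mono) (simp add: a(3) subset_insertI)
    finally show ?thesis using vert_T(2)[OF K(2)] by simp
  qed
  have Lc: "L v c = (if v \<in> vert F then inverse (real CARD('n)) else 0)" for v
  proof -
    have "L v c = (\<Sum>u\<in>vert F. inverse (real CARD('n)) * L v u)"
      unfolding c_def by (rule affine_fun_affine_comb[OF L(1) finF sum1])
    also have "\<dots> = (\<Sum>u\<in>vert F. if u = v then inverse (real CARD('n)) else 0)"
      using a(1) by (intro sum.cong) (auto simp: L(2))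
    finally show ?thesis using finF by simp
  qed
  \<comment> \<open>\<open>e\<close> is chosen so small that no barycentric coordinate of \<open>z\<close> becomes nonpositive\<close>
  define M where "M = Max ((\<lambda>v. \<bar>L v a2\<bar>) ` vert F) + 1"
  have M: "\<bar>L v a2\<bar> < M" if "v \<in> vert F" for v
    using Max_ge[OF finite_imageI[OF finF] imageI[OF that], of "\<lambda>v. \<bar>L v a2\<bar>"]
    unfolding M_def by linarith
  have neF: "vert F \<noteq> {}" using cF by auto
  then have M0: "M > 0" using M abs_ge_zero by (meson all_not_in_conv le_less_trans)
  define N where "N = real CARD('n)"
  have N: "N > 0" by (simp add: N_def)
  define e where "e = inverse (1 + N * (M + 1))"
  have NM: "N * (M + 1) > 0" using N M0 by simp
  have e: "0 < e" "e < 1" using NM by (auto simp: e_def field_simps)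
  have e1: "1 - e = e * (N * (M + 1))" using NM by (simp add: e_def field_simps)
  define z where "z = (1 - e) *\<^sub>R c + e *\<^sub>R a2"
  have zK: "z \<in> K2"
    unfolding z_def using cK vert_T(4)[OF K(2)] a(3) e by (intro convexD[OF T_convex[OF K(2)]]) auto
  have Lz: "L v z = (1 - e) * L v c + e * L v a2" for v
  proof -
    obtain cc b where "L v = (\<lambda>x. cc \<bullet> x + b)" using L(1)[of v] by (auto simp: affine_fun_def)
    then show ?thesis by (simp add: z_def inner_add_right algebra_simps)
  qed
  have Lpos: "0 < L v z" if v: "v \<in> vert K1" for v
  proof (cases "v = a1")
    case True
    have "L v z = e * l a2" unfolding True Lz Lc using a(2) by (simp add: La1)
    then show ?thesis using pos e by simp
  next
    case False
    then have vF: "v \<in> vert F" using v a(1) by simp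
    have "L v z = e * (N * (M + 1)) * inverse N + e * L v a2"
      by (simp add: Lz Lc vF e1 N_def)
    also have "\<dots> = e * (M + 1 + L v a2)" using N by (simp add: field_simps)
    finally show ?thesis using M[OF vF] e(1) by (simp add: abs_less_iff)
  qed
  have "z \<in> rel_interior (convex hull (vert K1))"
    using S1 Lpos L(3,4) unfolding simplex_vertices_def
    by (subst rel_interior_convex_hull_explicit) (auto intro!: exI[of _ "\<lambda>v. L v z"])
  then have "z \<in> interior K1"
    using vert_T(2)[OF K(1)] T_interior_ne[OF K(1)] by (simp add: rel_interior_nonempty_interior)
  then show False using T_interior_unique[OF K(1,2) _ zK] K(3) by blast
qed

text \<open>A facet belongs to at most two elements, as two of three would lie on the same side of it.\<close>

lemma facet_two_elements:
  assumes K: "K1 \<in> \<T>" "K2 \<in> \<T>" "K1 \<noteq> K2" and F: "F facet_of K1" "F facet_of K2"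
    and K3: "K3 \<in> \<T>" "F facet_of K3"
  shows "K3 = K1 \<or> K3 = K2"
proof (rule ccontr)
  assume "\<not> ?thesis"
  then have ne: "K1 \<noteq> K3" "K2 \<noteq> K3" by auto
  obtain a1 where a1: "a1 \<notin> vert F" "vert K1 = insert a1 (vert F)" using facet_vertices[OF K(1) F(1)] .
  obtain a2 where a2: "a2 \<notin> vert F" "vert K2 = insert a2 (vert F)" using facet_vertices[OF K(2) F(2)] .
  obtain a3 where a3: "a3 \<notin> vert F" "vert K3 = insert a3 (vert F)" using facet_vertices[OF K3] .
  obtain l where l: "affine_fun l" "l a1 = 1" "\<And>u. u \<in> vert K1 - {a1} \<Longrightarrow> l u = 0"
    using barycentric_exists[OF vert_T(1)[OF K(1)], of a1] a1 by auto
  have lF: "\<And>v. v \<in> vert F \<Longrightarrow> l v = 0" using l(3) a1 by auto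
  have 12: "l a2 < 0"
    by (rule opposite_sides[OF K F a1(2,1) a2(2,1) l(1,2) lF])
  have 13: "l a3 < 0"
    by (rule opposite_sides[OF K(1) K3(1) ne(1) F(1) K3(2) a1(2,1) a3(2,1) l(1,2) lF])
  have "affine_fun (\<lambda>x. inverse (l a2) * l x)"
    using affine_fun_lincomb[OF l(1) l(1), of "inverse (l a2)" 0] by simp
  then have "inverse (l a2) * l a3 < 0"
    using 12 lF
    by (intro opposite_sides[OF K(2) K3(1) ne(2) F(2) K3(2) a2(2,1) a3(2,1)]) auto
  then show False using 12 13 by (simp add: mult_less_0_iff)
qed

text \<open>The basis function of an interior facet \<open>F\<close> is \<open>1 - d \<lambda>\<close> on the two elements at \<open>F\<close>, where \<open>\<lambda>\<close> is
  the barycentric coordinate of the vertex opposite to \<open>F\<close>, and zero elsewhere. Its mean value is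
  one on \<open>F\<close> and zero on all other facets. Its integrated gradients on the two elements cancel,
  because the gradient of \<open>\<lambda>\<close> is inversely proportional to the height and the volume is
  proportional to it.\<close>

lemma facet_basis_function:
  assumes F: "F \<in> interior_facets \<Omega> \<T>" and K: "K1 \<in> \<T>" "K2 \<in> \<T>" "K1 \<noteq> K2"
    and FK: "F facet_of K1" "F facet_of K2"
  obtains \<phi> g where "\<phi> \<in> X0_CR \<Omega> \<T>" "g \<noteq> 0"
    "measure lebesgue K1 *\<^sub>R elem_grad \<phi> K1 = g" "measure lebesgue K2 *\<^sub>R elem_grad \<phi> K2 = - g"
    "\<And>K. K \<in> \<T> \<Longrightarrow> K \<noteq> K1 \<Longrightarrow> K \<noteq> K2 \<Longrightarrow> elem_grad \<phi> K = 0"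
proof -
  obtain a1 where a1: "a1 \<notin> vert F" "vert K1 = insert a1 (vert F)" using facet_vertices[OF K(1) FK(1)] .
  obtain a2 where a2: "a2 \<notin> vert F" "vert K2 = insert a2 (vert F)" using facet_vertices[OF K(2) FK(2)] .
  have finF: "finite (vert F)" using vert_T(3)[OF K(1)] a1(2) by simp
  have cF: "card (vert F) = CARD('n)" by (rule facet_T[OF K(1) FK(1)]) simp
  obtain l where l: "affine_fun l" "l a1 = 1" "\<And>u. u \<in> vert K1 - {a1} \<Longrightarrow> l u = 0"
    using barycentric_exists[OF vert_T(1)[OF K(1)], of a1] a1 by auto
  have lF: "\<And>v. v \<in> vert F \<Longrightarrow> l v = 0" using l(3) a1 by auto
  have neg: "l a2 < 0"
    by (rule opposite_sides[OF K FK a1(2,1) a2(2,1) l(1,2) lF])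
  obtain c b where lc: "l = (\<lambda>x. c \<bullet> x + b)" using l(1) by (auto simp: affine_fun_def)
  have c0: "c \<noteq> 0"
  proof
    assume "c = 0"
    then have "l a1 = l a2" by (simp add: lc)
    then show False using l(2) neg by simp
  qed
  define N where "N = real CARD('n)"
  \<comment> \<open>\<open>s K * l\<close> is the barycentric coordinate \<open>\<lambda>\<close> on \<open>K\<close>\<close>
  define s where "s K = (if K = K1 then 1 else inverse (l a2))" for K
  define p where "p K = (if K = K1 \<or> K = K2 then (\<lambda>x. (- (N * s K) *\<^sub>R c) \<bullet> x + (1 - N * s K * b))
    else (\<lambda>x. 0))" for K
  have pl: "p K x = 1 - N * s K * l x" if "K = K1 \<or> K = K2" for K x
    using that by (simp add: p_def lc algebra_simps)
  have pa: "affine_fun (p K)" for K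
  proof (cases "K = K1 \<or> K = K2")
    case True
    then have "p K = (\<lambda>x. (- (N * s K) *\<^sub>R c) \<bullet> x + (1 - N * s K * b))" by (simp only: p_def if_True)
    then show ?thesis by (rule ssubst) (rule affine_funI)
  next
    case False
    then have "p K = (\<lambda>x. 0)" by (simp only: p_def if_False)
    then show ?thesis by (rule ssubst) (rule affine_fun_const)
  qed
  define \<phi> where "\<phi> x = indicator (interior K1) x * p K1 x + indicator (interior K2) x * p K2 x" for x
  have \<phi>in: "\<phi> x = p K x" if x: "x \<in> interior K" and KT: "K \<in> \<T>" for K x
  proof -
    have "x \<in> interior K' \<longleftrightarrow> K' = K" if "K' \<in> \<T>" for K'
      using T_interior_unique[OF KT that x] x interior_subset[of K'] by blast
    then have "indicator (interior K1) x = (if K1 = K then 1 else (0::real))"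
      "indicator (interior K2) x = (if K2 = K then 1 else (0::real))" using K by (auto simp: indicator_def)
    then have "\<phi> x = (if K1 = K then p K1 x else 0) + (if K2 = K then p K2 x else 0)"
      using K(3) by (simp add: \<phi>_def)
    moreover have "p K x = 0" if "K \<noteq> K1" "K \<noteq> K2" using that by (simp add: p_def)
    ultimately show ?thesis using K(3) by auto
  qed
  have "\<phi> \<in> L2 \<Omega>"
  proof -
    have L2p: "(\<lambda>x. indicator (interior K) x * p K x) \<in> L2 \<Omega>" if KT: "K \<in> \<T>" for K
    proof -
      have "compact (p K ` K)" by (intro compact_continuous_image affine_fun_continuous pa T_compact KT)
      then obtain B where "\<forall>y\<in>p K ` K. norm y \<le> B" using compact_imp_bounded bounded_iff by blast
      then have B: "\<bar>p K x\<bar> \<le> B" if "x \<in> K" for x using that by simp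
      have pb[measurable]: "p K \<in> borel_measurable borel"
        by (intro borel_measurable_continuous_onI affine_fun_continuous pa)
      show ?thesis
      proof (rule L2_boundedI[OF open_dom bounded_dom, where B = "max B 0"])
        show "(\<lambda>x. indicator (interior K) x * p K x) \<in> borel_measurable borel" by measurable
        show "AE x in lborel. \<bar>indicator (interior K) x * p K x\<bar> \<le> max B 0"
        proof (intro AE_I2)
          fix x
          show "\<bar>indicator (interior K) x * p K x\<bar> \<le> max B 0"
          proof (cases "x \<in> interior K")
            case True
            then have "\<bar>p K x\<bar> \<le> B" using B subsetD[OF interior_subset] by blast
            then show ?thesis using True by simp
          next
            case False
            then show ?thesis by simp
          qed
        qed
      qed
    qed
    show ?thesis
      using L2_lincomb[OF L2p[OF K(1)] L2p[OF K(2)], of 1 1] K(3) by (simp add: \<phi>_def[abs_def])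
  qed
  then have \<phi>P: "\<phi> \<in> P_disc \<Omega> \<T> 1"
    unfolding P_disc_def mem_Collect_eq
  proof (intro conjI ballI allI impI)
    show "\<exists>q\<in>poly_space 1. \<forall>x\<in>interior K. \<phi> x = q x" if "K \<in> \<T>" for K
      using that pa[of K] \<phi>in unfolding poly_space_1 by blast
    show "\<phi> x = 0" if "x \<notin> \<Union>(interior ` \<T>)" for x
      using that K by (simp add: \<phi>_def)
  qed
  have el: "on_elem \<phi> K = p K" if "K \<in> \<T>" for K
    using that pa \<phi>in by (intro on_elem_unique) auto
  have two: "K = K1 \<or> K = K2" if "K \<in> \<T>" "F facet_of K" for K
    by (rule facet_two_elements[OF K FK that])
  have sumF: "(\<Sum>a\<in>vert F. p K a) = N" if "K = K1 \<or> K = K2" for K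
    using that by (simp add: pl lF cF N_def)
  have sumF': "(\<Sum>a\<in>vert F'. p K a) = 0" if K': "K \<in> \<T>" "F' facet_of K" "F' \<noteq> F" for K F'
  proof (cases "K = K1 \<or> K = K2")
    case True
    have "\<exists>a. a \<notin> vert F \<and> vert K = insert a (vert F) \<and> s K * l a = 1"
      using True
    proof
      assume "K = K1"
      then show ?thesis using a1 l(2) by (intro exI[of _ a1]) (simp add: s_def)
    next
      assume "K = K2"
      then show ?thesis using a2 neg K(3) by (intro exI[of _ a2]) (simp add: s_def)
    qed
    then obtain a where a: "a \<notin> vert F" "vert K = insert a (vert F)" "s K * l a = 1"
      by (elim exE conjE)
    have FK': "F facet_of K" using True FK by auto
    have "\<exists>u. u \<in> vert K \<and> vert F' = vert K - {u} \<and> card (vert F') = CARD('n) \<and>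
        convex hull (vert F') = F'"
      by (rule facet_T[OF K'(1,2)]) (intro exI conjI; assumption)
    then obtain u where u: "u \<in> vert K" "vert F' = vert K - {u}" "card (vert F') = CARD('n)"
      "convex hull (vert F') = F'" by (elim exE conjE)
    have "convex hull (vert F) = F" by (rule facet_T[OF K'(1) FK']) simp
    then have "u \<noteq> a" using u(2,4) a(1,2) K'(3) by auto
    then have aF': "a \<in> vert F'" using a(2) u(2) by simp
    have fin': "finite (vert F')" using vert_T(3)[OF K'(1)] u(2) by simp
    have "(\<Sum>v\<in>vert F'. s K * l v) = (\<Sum>v\<in>vert F'. if v = a then 1 else 0)"
      using u(2) a lF by (intro sum.cong) auto
    then have "(\<Sum>v\<in>vert F'. s K * l v) = 1" using fin' aF' by simp
    then show ?thesis
      using True u(3) by (simp add: pl sum_subtractf N_def mult.assoc flip: sum_distrib_left)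
  next
    case False
    then show ?thesis by (simp add: p_def)
  qed
  have X: "\<phi> \<in> X0_CR \<Omega> \<T>"
    unfolding X0_CR_iff
  proof (intro conjI ballI impI \<phi>P)
    fix F' K K' assume *: "F' \<in> interior_facets \<Omega> \<T>" "K \<in> \<T>" "K' \<in> \<T>"
      "K \<noteq> K' \<and> F' facet_of K \<and> F' facet_of K'"
    show "(\<Sum>a\<in>vert F'. on_elem \<phi> K a) = (\<Sum>a\<in>vert F'. on_elem \<phi> K' a)"
    proof (cases "F' = F")
      case True
      then show ?thesis using * two[of K] two[of K'] sumF[of K] sumF[of K'] by (simp add: el)
    next
      case False
      then show ?thesis using * sumF'[of K F'] sumF'[of K' F'] by (simp add: el)
    qed
  next
    fix F' K assume *: "F' \<in> boundary_facets \<Omega> \<T>" "K \<in> \<T>" "F' facet_of K"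
    then have "F' \<noteq> F" using F by (auto simp: interior_facets_def)
    then show "(\<Sum>a\<in>vert F'. on_elem \<phi> K a) = 0" using * sumF'[of K F'] by (simp add: el)
  qed
  have grad: "elem_grad \<phi> K = - (N * s K) *\<^sub>R c" if "K = K1 \<or> K = K2" for K
  proof (rule elem_grad_eq)
    have "K \<in> \<T>" using that K by auto
    then show "on_elem \<phi> K = (\<lambda>x. (- (N * s K) *\<^sub>R c) \<bullet> x + (1 - N * s K * b))"
      using el[of K] that by (simp add: p_def)
  qed
  have mborel: "measure lebesgue K = measure lborel K" if "K \<in> \<T>" for K
    using T_closed[OF that] by simp
  have K12: "K1 = convex hull (insert a1 (vert F))" "K2 = convex hull (insert a2 (vert F))"
    using vert_T(2) K a1(2) a2(2) by metis+
  have vol: "measure lebesgue K2 = \<bar>l a2\<bar> * measure lebesgue K1"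
    using content_simplex_common_facet[OF finF cF a1(1) a2(1) l(1,2) lF] vol_pos[OF K(1)]
    unfolding mborel[OF K(1)] mborel[OF K(2)] K12[symmetric] by simp
  show thesis
  proof (rule that[OF X])
    let ?g = "measure lebesgue K1 *\<^sub>R elem_grad \<phi> K1"
    show "?g \<noteq> 0" using vol_pos[OF K(1)] c0 by (simp add: grad s_def N_def)
    show "measure lebesgue K2 *\<^sub>R elem_grad \<phi> K2 = - ?g"
      using neg K(3) by (simp add: grad s_def vol)
    show "elem_grad \<phi> K = 0" if "K \<in> \<T>" "K \<noteq> K1" "K \<noteq> K2" for K
    proof (rule elem_grad_eq)
      show "on_elem \<phi> K = (\<lambda>x. 0 \<bullet> x + 0)" using that el[of K] by (simp add: p_def)
    qed
  qed simp
qed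

text \<open>The transpose of the discrete divergence is injective; on a fixed mesh this is the inf-sup
  condition.\<close>

lemma div_h_orthogonal_eq_0:
  assumes q: "q \<in> Q_CR \<Omega> \<T>" and orth: "\<And>v. v \<in> vec_space (X0_CR \<Omega> \<T>) \<Longrightarrow> div_h \<T> v q = 0"
  shows "q = (\<lambda>x. 0)"
proof -
  note qP = Q_CR_P0[OF q]
  have step: "q (inner_point K1) = q (inner_point K2)"
    if K: "K1 \<in> \<T>" "K2 \<in> \<T>" "K1 \<noteq> K2" and F: "F \<in> interior_facets \<Omega> \<T>" "F facet_of K1" "F facet_of K2"
    for K1 K2 F
  proof -
    obtain \<phi> g where \<phi>: "\<phi> \<in> X0_CR \<Omega> \<T>" "g \<noteq> 0"
      "measure lebesgue K1 *\<^sub>R elem_grad \<phi> K1 = g" "measure lebesgue K2 *\<^sub>R elem_grad \<phi> K2 = - g"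
      "\<And>K. K \<in> \<T> \<Longrightarrow> K \<noteq> K1 \<Longrightarrow> K \<noteq> K2 \<Longrightarrow> elem_grad \<phi> K = 0"
      using facet_basis_function[OF F(1) K F(2,3)] by metis
    obtain i where i: "g $ i \<noteq> 0" using \<phi>(2) by (auto simp: vec_eq_iff)
    define v where "v x = (\<chi> j. if j = i then \<phi> x else 0)" for x
    have zero: "(\<lambda>x. 0) \<in> X0_CR \<Omega> \<T>" using X0_CR_lincomb[OF \<phi>(1) \<phi>(1), of 0 0] by simp
    have v: "v \<in> vec_space (X0_CR \<Omega> \<T>)" 
      unfolding vec_space_def mem_Collect_eq
    proof
      fix j show "(\<lambda>x. v x $ j) \<in> X0_CR \<Omega> \<T>"
        using \<phi>(1) zero by (cases "j = i") (simp_all add: v_def)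
    qed
    have vP: "(\<lambda>x. v x $ j) \<in> P_disc \<Omega> \<T> 1" for j
      using v X0_CR_P_disc by (simp add: vec_space_def)
    have z: "elem_grad (\<lambda>x. 0) K = 0" if "K \<in> \<T>" for K
      using on_elem_unique[OF that affine_fun_const[of 0], of "\<lambda>x. 0"] elem_grad_eq[of "\<lambda>x. 0" K 0 0] by simp
    have tr: "(\<Sum>j\<in>UNIV. elem_grad (\<lambda>x. v x $ j) K $ j) = elem_grad \<phi> K $ i" if "K \<in> \<T>" for K
    proof -
      have "(\<Sum>j\<in>UNIV. elem_grad (\<lambda>x. v x $ j) K $ j) = (\<Sum>j\<in>UNIV. if j = i then elem_grad \<phi> K $ j else 0)"
        by (intro sum.cong) (auto simp: v_def z[OF that])
      then show ?thesis by simp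
    qed
    have "0 = (\<Sum>K\<in>\<T>. measure lebesgue K * q (inner_point K) * elem_grad \<phi> K $ i)"
      using orth[OF v] div_h_eq[OF vP qP] by (simp add: tr)
    also have "\<dots> = (\<Sum>K\<in>{K1, K2}. measure lebesgue K * q (inner_point K) * elem_grad \<phi> K $ i)"
      using finite_T K \<phi>(5) by (intro sum.mono_neutral_right) auto
    also have "\<dots> = q (inner_point K1) * (measure lebesgue K1 *\<^sub>R elem_grad \<phi> K1) $ i +
        q (inner_point K2) * (measure lebesgue K2 *\<^sub>R elem_grad \<phi> K2) $ i"
      using K(3) by simp
    also have "\<dots> = (q (inner_point K1) - q (inner_point K2)) * g $ i"
      unfolding \<phi>(3,4) by (simp add: algebra_simps)
    finally show ?thesis using i by simp
  qed
  have "\<T> \<noteq> {}"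
  proof
    assume "\<T> = {}"
    then have "closure \<Omega> = {}" using union_T by simp
    then show False using dom_ne by simp
  qed
  then obtain K0 where K0: "K0 \<in> \<T>" by blast
  define c where "c = q (inner_point K0)"
  have all: "q (inner_point K) = c" if "K \<in> \<T>" for K
  proof (rule facet_connected[of "\<lambda>K. q (inner_point K) = c", OF _ K0 that])
    show "q (inner_point K') = c"
      if "K \<in> \<T>" "K' \<in> \<T>" "K \<noteq> K'" "F \<in> interior_facets \<Omega> \<T>" "F facet_of K" "F facet_of K'"
        "q (inner_point K) = c" for K K' F
      using step[OF that(1-6)] that(7) by simp
  qed (simp add: c_def)
  have qc: "q x = c" if "x \<in> interior K" "K \<in> \<T>" for x K
    using P_disc_0_const[OF qP that(2,1)] all[OF that(2)] by simp
  have lm: "\<Omega> \<in> lmeasurable" using bounded_dom open_dom by (intro bounded_set_imp_lmeasurable) auto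
  have "AE x in lebesgue. x \<notin> (\<Union>K\<in>\<T>. frontier K)"
    using skeleton_negligible by (intro AE_not_in) (simp add: negligible_iff_null_sets)
  then have "AE x in lebesgue. x \<in> \<Omega> \<longrightarrow> q x = c"
  proof eventually_elim
    case (elim x)
    show ?case
    proof
      assume "x \<in> \<Omega>"
      then obtain K where "K \<in> \<T>" "x \<in> interior K" 
        using subsetD[OF dom_subset_interiors, of x] elim by auto
      then show "q x = c" using qc by blast
    qed
  qed
  then have ae: "AE x in lebesgue_on \<Omega>. q x = c"
    using lm by (subst AE_restrict_space_iff) auto
  have "(\<integral>x. q x \<partial>lebesgue_on \<Omega>) = (\<integral>x. c \<partial>lebesgue_on \<Omega>)"
    using ae Q_CR_L2[OF q] by (intro integral_cong_AE) (auto simp: L2_def)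
  also have "\<dots> = c * measure lebesgue \<Omega>" using lm by (simp add: measure_restrict_space mult.commute)
  finally have "c * measure lebesgue \<Omega> = 0" using q by (simp add: Q_CR_def L2_zmv_def)
  moreover have "measure lebesgue \<Omega> \<noteq> 0"
    using open_not_negligible[OF open_dom dom_ne] lm by (simp add: negligible_iff_measure)
  ultimately have "c = 0" by simp
  show ?thesis by (rule P_disc_eq_0I[OF qP]) (simp add: qc \<open>c = 0\<close>)
qed

end

section \<open>Conforming functions and the averaging operator\<close>

context mesh
begin

lemma P1_cont_0_affine:
  assumes "w \<in> P1_cont_0 \<Omega> \<T>"
  shows "\<exists>c b. \<forall>K\<in>\<T>. \<forall>x\<in>K. w x = c K \<bullet> x + b K"
proof -
  have "\<forall>K\<in>\<T>. \<exists>cb. \<forall>x\<in>K. w x = fst cb \<bullet> x + snd cb"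
  proof
    fix K assume "K \<in> \<T>"
    then
    obtain p where p: "affine_fun p" "\<forall>x\<in>K. w x = p x"
      using assms unfolding P1_cont_0_def poly_space_1 by blast
    obtain c b where "p = (\<lambda>x. c \<bullet> x + b)" using p(1) unfolding affine_fun_def by (elim exE)
    then show "\<exists>cb. \<forall>x\<in>K. w x = fst cb \<bullet> x + snd cb"
      using p(2) by (intro exI[of _ "(c, b)"]) simp
  qed
  from bchoice[OF this] obtain cb where "\<forall>K\<in>\<T>. \<forall>x\<in>K. w x = fst (cb K) \<bullet> x + snd (cb K)"
    by (elim exE)
  then show ?thesis
    by (intro exI[of _ "\<lambda>K. fst (cb K)"] exI[of _ "\<lambda>K. snd (cb K)"])
qed

text \<open>A line segment is covered by its intersections with the closed elements and with the closed
  complement of the domain, and on each of these pieces the function is Lipschitz. Continuity is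
  not a hypothesis: it follows from agreement on the closed pieces.\<close>

lemma P1_cont_0_lipschitz:
  assumes w0: "\<And>x. x \<notin> \<Omega> \<Longrightarrow> w x = 0" and w: "\<And>K x. K \<in> \<T> \<Longrightarrow> x \<in> K \<Longrightarrow> w x = c K \<bullet> x + b K"
  shows "\<bar>w x - w y\<bar> \<le> (\<Sum>K\<in>\<T>. norm (c K)) * norm (x - y)"
proof -
  define L where "L = (\<Sum>K\<in>\<T>. norm (c K))"
  have L: "norm (c K) \<le> L" if "K \<in> \<T>" for K
    unfolding L_def using finite_T that by (intro member_le_sum) auto
  have L0: "L \<ge> 0" by (simp add: L_def sum_nonneg)
  define \<gamma> where "\<gamma> t = x + t *\<^sub>R (y - x)" for t
  have \<gamma>c: "continuous_on UNIV \<gamma>" unfolding \<gamma>_def by (intro continuous_intros)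
  define U where "U i = (case i of None \<Rightarrow> \<gamma> -` (- \<Omega>) | Some K \<Rightarrow> \<gamma> -` K)" for i
  have "(L * norm (x - y))-lipschitz_on {0..1} (\<lambda>t. w (\<gamma> t))"
  proof (rule lipschitz_on_closed_Union[where I = "insert None (Some ` \<T>)" and U = U])
    show "finite (insert None (Some ` \<T>))" using finite_T by simp
    show "0 \<le> L * norm (x - y)" using L0 by simp
    show "closed (U i)" if "i \<in> insert None (Some ` \<T>)" for i
      using that open_dom T_closed \<gamma>c by (auto simp: U_def intro!: closed_vimage)
    show "(L * norm (x - y))-lipschitz_on (U i) (\<lambda>t. w (\<gamma> t))" if "i \<in> insert None (Some ` \<T>)" for i
    proof (rule lipschitz_onI)
      fix s t assume st: "s \<in> U i" "t \<in> U i"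
      show "dist (w (\<gamma> s)) (w (\<gamma> t)) \<le> L * norm (x - y) * dist s t"
      proof (cases i)
        case None
        then show ?thesis using st L0 by (simp add: U_def w0)
      next
        case (Some K)
        then have K: "K \<in> \<T>" using that by auto
        have "w (\<gamma> s) - w (\<gamma> t) = c K \<bullet> (\<gamma> s - \<gamma> t)"
          using st Some by (simp add: U_def w[OF K] inner_diff_right)
        also have "\<gamma> s - \<gamma> t = (s - t) *\<^sub>R (y - x)" by (simp add: \<gamma>_def algebra_simps)
        finally have "\<bar>w (\<gamma> s) - w (\<gamma> t)\<bar> \<le> norm (c K) * norm ((s - t) *\<^sub>R (y - x))"
          by (metis Cauchy_Schwarz_ineq2)
        also have "\<dots> \<le> L * norm ((s - t) *\<^sub>R (y - x))" by (intro mult_right_mono L K) simp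
        finally show ?thesis by (simp add: dist_real_def norm_minus_commute mult_ac)
      qed
    qed (use L0 in simp)
    show "{0..1} \<subseteq> (\<Union>i\<in>insert None (Some ` \<T>). U i)"
    proof
      fix t :: real
      show "t \<in> (\<Union>i\<in>insert None (Some ` \<T>). U i)"
      proof (cases "\<gamma> t \<in> \<Omega>")
        case True
        then have "\<gamma> t \<in> \<Union>\<T>" using union_T closure_subset by blast
        then show ?thesis by (auto simp: U_def)
      next
        case False
        then show ?thesis by (auto simp: U_def)
      qed
    qed
  qed
  from lipschitz_onD[OF this, of 0 1] show ?thesis
    by (simp add: \<gamma>_def dist_real_def L_def)
qed

theorem P1_cont_0_subset_H10:
  assumes wP: "w \<in> P1_cont_0 \<Omega> \<T>"
  shows "w \<in> H10 \<Omega>"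
proof -
  obtain c b where cb: "\<forall>K\<in>\<T>. \<forall>x\<in>K. w x = c K \<bullet> x + b K"
    using P1_cont_0_affine[OF wP] by (elim exE)
  have w: "w x = c K \<bullet> x + b K" if "K \<in> \<T>" "x \<in> K" for K x using cb that by simp
  have w0: "w x = 0" if "x \<notin> \<Omega>" for x using wP that by (simp add: P1_cont_0_def)
  \<comment> \<open>off this null set, \<open>w\<close> is affine near every point, and locally zero near each of its zeros\<close>
  define Z where "Z = (\<Union>K\<in>\<T>. frontier K) \<union> (\<Union>K\<in>{K\<in>\<T>. c K \<noteq> 0}. {x. c K \<bullet> x = - b K})"
  have "negligible (\<Union>K\<in>{K\<in>\<T>. c K \<noteq> 0}. {x. c K \<bullet> x = - b K})"
    using finite_T by (intro negligible_Union) (auto intro: negligible_hyperplane)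
  then have "negligible Z" unfolding Z_def using skeleton_negligible by simp
  then have "AE x in lebesgue. x \<notin> Z" by (intro AE_not_in) (simp add: negligible_iff_null_sets)
  then have ae: "AE x in lborel. x \<notin> Z" by (simp add: AE_completion_iff)
  interpret lipschitz_piecewise \<Omega> w "\<Sum>K\<in>\<T>. norm (c K)"
  proof
    show "open \<Omega>" by (rule open_dom)
    show "bounded \<Omega>" by (rule bounded_dom)
    show "\<bar>w x - w y\<bar> \<le> (\<Sum>K\<in>\<T>. norm (c K)) * norm (x - y)" for x y
      by (rule P1_cont_0_lipschitz[OF w0 w])
    show "0 \<le> (\<Sum>K\<in>\<T>. norm (c K))" by (simp add: sum_nonneg)
    show "w x = 0" if "x \<notin> \<Omega>" for x using w0[OF that] .
    show "AE x in lborel. \<exists>a b. \<exists>r>0. (\<forall>y. dist x y < r \<longrightarrow> w y = a \<bullet> y + b) \<and> (a \<noteq> 0 \<longrightarrow> w x \<noteq> 0)"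
      using ae
    proof eventually_elim
      case (elim x)
      show ?case
      proof (cases "x \<in> \<Union>\<T>")
        case True
        then obtain K where K: "K \<in> \<T>" "x \<in> K" by (elim UnionE)
        have "x \<notin> frontier K" using elim K(1) by (auto simp: Z_def)
        then have "x \<in> interior K" using K T_closed[OF K(1)] by (simp add: frontier_def)
        then obtain r where r: "r > 0" "ball x r \<subseteq> interior K"
          using open_contains_ball open_interior by blast
        have 1: "w y = c K \<bullet> y + b K" if "dist x y < r" for y
        proof (rule w[OF K(1)])
          have "y \<in> interior K" using r(2) that by auto
          then show "y \<in> K" by (rule subsetD[OF interior_subset])
        qed
        have 2: "w x \<noteq> 0" if "c K \<noteq> 0"
        proof
          assume "w x = 0"
          then have "c K \<bullet> x = - b K" using w[OF K] by simp
          then have "x \<in> Z" using K(1) that by (auto simp: Z_def)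
          then show False using elim by simp
        qed
        show ?thesis
          by (rule exI[of _ "c K"], rule exI[of _ "b K"], rule exI[of _ r]) (use r(1) 1 2 in simp)
      next
        case False
        have op: "open (- \<Union>\<T>)" using finite_T T_closed by (auto intro: closed_Union)
        have "x \<in> - \<Union>\<T>" using False by simp
        then obtain r where r: "r > 0" "ball x r \<subseteq> - \<Union>\<T>"
          using op open_contains_ball by blast
        have "w y = 0 \<bullet> y + 0" if "dist x y < r" for y
        proof -
          have "y \<in> - \<Union>\<T>" using r(2) that by auto
          then have "y \<notin> \<Omega>" using union_T closure_subset by auto
          then show ?thesis by (simp add: w0)
        qed
        then show ?thesis
          by (intro exI[of _ 0] exI[of _ 0] exI[of _ r]) (use r(1) in simp)
      qed
    qed
  qed
  show ?thesis by (rule in_H10)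
qed

lemma P1_cont_0_lincomb:
  assumes "v \<in> P1_cont_0 \<Omega> \<T>" "w \<in> P1_cont_0 \<Omega> \<T>"
  shows "(\<lambda>x. s * v x + t * w x) \<in> P1_cont_0 \<Omega> \<T>"
  unfolding P1_cont_0_def mem_Collect_eq
proof (intro conjI ballI allI impI)
  show "continuous_on (closure \<Omega>) (\<lambda>x. s * v x + t * w x)"
    using assms by (intro continuous_intros) (simp_all add: P1_cont_0_def)
  show "s * v x + t * w x = 0" if "x \<notin> \<Omega>" for x using assms that by (simp add: P1_cont_0_def)
  fix K assume K: "K \<in> \<T>"
  obtain p where p: "affine_fun p" "\<forall>x\<in>K. v x = p x"
    using assms(1) K unfolding P1_cont_0_def poly_space_1 by blast
  obtain q where q: "affine_fun q" "\<forall>x\<in>K. w x = q x"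
    using assms(2) K unfolding P1_cont_0_def poly_space_1 by blast
  show "\<exists>p\<in>poly_space 1. \<forall>x\<in>K. s * v x + t * w x = p x"
    unfolding poly_space_1
    by (rule bexI[of _ "\<lambda>x. s * p x + t * q x"]) (simp_all add: p q affine_fun_lincomb)
qed

text \<open>A point of two elements is an affine combination of their common vertices.\<close>

lemma common_face_comb:
  assumes K: "K \<in> \<T>" "K' \<in> \<T>" and x: "x \<in> K" "x \<in> K'"
  shows "\<exists>C u. finite C \<and> C \<subseteq> vert K \<and> C \<subseteq> vert K' \<and> sum u C = 1 \<and> (\<Sum>v\<in>C. u v *\<^sub>R v) = x"
proof -
  have face: "\<exists>C. C \<subseteq> vert K \<and> K \<inter> K' = convex hull C \<and> vert (K \<inter> K') = C"
    if K: "K \<in> \<T>" "K' \<in> \<T>" for K K'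
  proof -
    have ind: "\<not> affine_dependent (vert K)" using vert_T(1)[OF K(1)] by (simp add: simplex_vertices_def)
    have "(K \<inter> K') face_of convex hull (vert K)" using T_face[OF K] vert_T(2)[OF K(1)] by simp
    then obtain C where C: "C \<subseteq> vert K" "K \<inter> K' = convex hull C"
      using face_of_convex_hull_affine_independent[OF ind] by blast
    have "\<not> affine_dependent C" using affine_independent_subset[OF ind C(1)] .
    then have "vert (K \<inter> K') = C" unfolding C(2) by (rule vert_hull)
    then show ?thesis using C by blast
  qed
  obtain C where C: "C \<subseteq> vert K" "K \<inter> K' = convex hull C" "vert (K \<inter> K') = C"
    using face[OF K] by (elim exE conjE)
  obtain C' where C': "C' \<subseteq> vert K'" "vert (K' \<inter> K) = C'"
    using face[OF K(2,1)] by (elim exE conjE)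
  have "C \<subseteq> vert K'" using C(3) C' by (simp add: Int_commute)
  moreover have fin: "finite C" using C(1) vert_T(3)[OF K(1)] by (rule finite_subset)
  moreover have "x \<in> convex hull C" using x C(2) by blast
  then have "\<exists>u. sum u C = 1 \<and> (\<Sum>v\<in>C. u v *\<^sub>R v) = x"
    unfolding convex_hull_finite[OF fin] by blast
  ultimately show ?thesis using C(1) by blast
qed

text \<open>Values at the vertices inside the domain can be prescribed; the vertices on the boundary get the
  value zero. Interpolants on neighbouring elements agree on the common face, and the interpolant
  vanishes on the boundary because the boundary is a union of facets.\<close>

lemma nodal_interpolant_exists:
  "\<exists>w. w \<in> P1_cont_0 \<Omega> \<T> \<and> (\<forall>a\<in>mesh_vertices \<T> \<inter> \<Omega>. w a = f a)"
proof -
  define \<beta> where "\<beta> a = (if a \<in> \<Omega> then f a else 0)" for a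
  have "\<exists>p. affine_fun p \<and> (\<forall>a\<in>vert K. p a = \<beta> a)" if "K \<in> \<T>" for K
    by (rule affine_interpolation[OF vert_T(1)[OF that], of \<beta>]) blast
  then obtain p where p: "\<And>K. K \<in> \<T> \<Longrightarrow> affine_fun (p K)"
    "\<And>K a. K \<in> \<T> \<Longrightarrow> a \<in> vert K \<Longrightarrow> p K a = \<beta> a" by metis
  have agree: "p K x = p K' x" if K: "K \<in> \<T>" "K' \<in> \<T>" "x \<in> K" "x \<in> K'" for K K' x
  proof -
    obtain C u where C: "finite C" "C \<subseteq> vert K" "C \<subseteq> vert K'" "sum u C = 1" "(\<Sum>v\<in>C. u v *\<^sub>R v) = x"
      using common_face_comb[OF K] by (elim exE conjE)
    have "p K x = (\<Sum>v\<in>C. u v * p K v)"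
      using affine_fun_affine_comb[OF p(1)[OF K(1)] C(1,4)] C(5) by simp
    also have "\<dots> = (\<Sum>v\<in>C. u v * p K' v)"
    proof (rule sum.cong[OF refl])
      fix v assume v: "v \<in> C"
      show "u v * p K v = u v * p K' v"
        using p(2)[OF K(1) subsetD[OF C(2) v]] p(2)[OF K(2) subsetD[OF C(3) v]] by simp
    qed
    also have "\<dots> = p K' x"
      using affine_fun_affine_comb[OF p(1)[OF K(2)] C(1,4)] C(5) by simp
    finally show ?thesis .
  qed
  define w where "w x = (if \<exists>K\<in>\<T>. x \<in> K then p (SOME K. K \<in> \<T> \<and> x \<in> K) x else 0)" for x
  have wK: "w x = p K x" if "K \<in> \<T>" "x \<in> K" for K x
  proof -
    have "(SOME K. K \<in> \<T> \<and> x \<in> K) \<in> \<T> \<and> x \<in> (SOME K. K \<in> \<T> \<and> x \<in> K)"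
      by (rule someI[of "\<lambda>K. K \<in> \<T> \<and> x \<in> K" K]) (use that in simp)
    then have "p (SOME K. K \<in> \<T> \<and> x \<in> K) x = p K x"
      using that by (intro agree) simp_all
    then show ?thesis using that by (auto simp: w_def)
  qed
  have "w \<in> P1_cont_0 \<Omega> \<T>"
    unfolding P1_cont_0_def mem_Collect_eq
  proof (intro conjI ballI allI impI)
    have "continuous_on (\<Union>K\<in>\<T>. K) w"
    proof (rule continuous_on_closed_Union[OF finite_T])
      show "closed K" if "K \<in> \<T>" for K using T_closed[OF that] .
      show "continuous_on K w" if "K \<in> \<T>" for K
        using continuous_on_cong[OF refl, of K w "p K"] wK[OF that] affine_fun_continuous[OF p(1)[OF that]]
        by simp
    qed
    then show "continuous_on (closure \<Omega>) w" by (simp add: union_T)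
    show "\<exists>p\<in>poly_space 1. \<forall>x\<in>K. w x = p x" if "K \<in> \<T>" for K
      unfolding poly_space_1 by (rule bexI[of _ "p K"]) (simp_all add: p(1) wK that)
    fix x assume x: "x \<notin> \<Omega>"
    show "w x = 0"
    proof (cases "\<exists>K\<in>\<T>. x \<in> K")
      case False
      then show ?thesis by (simp add: w_def)
    next
      case True
      then have "x \<in> closure \<Omega>" using union_T by blast
      then have "x \<in> frontier \<Omega>" using x open_dom by (simp add: frontier_def interior_open)
      then obtain F where F: "F \<in> boundary_facets \<Omega> \<T>" "x \<in> F" using frontier_facet by blast
      then obtain K where K: "K \<in> \<T>" "F facet_of K" and FO: "F \<subseteq> frontier \<Omega>"
        unfolding boundary_facets_def mesh_facets_def by blast
      have "\<exists>u. vert F = vert K - {u} \<and> convex hull (vert F) = F"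
        by (rule facet_T[OF K]) (intro exI conjI; assumption)
      then obtain u where u: "vert F = vert K - {u}" "convex hull (vert F) = F" by (elim exE conjE)
      have fin: "finite (vert F)" using u(1) vert_T(3)[OF K(1)] by simp
      have z: "p K a = 0" if "a \<in> vert F" for a
      proof -
        have "a \<in> F" using hull_inc[OF that, of convex] u(2) by simp
        then have "a \<notin> \<Omega>" using FO frontier_disjoint by blast
        then show ?thesis using p(2)[OF K(1), of a] that u(1) by (simp add: \<beta>_def)
      qed
      have "x \<in> convex hull (vert F)" using F(2) u(2) by simp
      then have "\<exists>t. sum t (vert F) = 1 \<and> (\<Sum>v\<in>vert F. t v *\<^sub>R v) = x"
        unfolding convex_hull_finite[OF fin] by blast
      then obtain t where t: "sum t (vert F) = 1" "(\<Sum>v\<in>vert F. t v *\<^sub>R v) = x" by (elim exE conjE)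
      have "p K x = (\<Sum>v\<in>vert F. t v * p K v)"
        using affine_fun_affine_comb[OF p(1)[OF K(1)] fin t(1)] t(2) by simp
      also have "\<dots> = 0" by (simp add: z)
      finally show ?thesis using wK[OF K(1)] facet_subset[OF K(2)] F(2) by auto
    qed
  qed
  moreover have "w a = f a" if a: "a \<in> mesh_vertices \<T> \<inter> \<Omega>" for a
  proof -
    obtain K where K: "K \<in> \<T>" "a \<in> vert K" using a by (auto simp: mesh_vertices_def vert_def)
    then have "w a = p K a" using wK vert_T(4) by blast
    then show ?thesis using p(2)[OF K] a by (simp add: \<beta>_def)
  qed
  ultimately show ?thesis by blast
qed

lemma nodal_values_unique:
  assumes "v \<in> P1_cont_0 \<Omega> \<T>" "w \<in> P1_cont_0 \<Omega> \<T>"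
    and eq: "\<And>a. a \<in> mesh_vertices \<T> \<inter> \<Omega> \<Longrightarrow> v a = w a"
  shows "v = w"
proof
  fix x
  show "v x = w x"
  proof (cases "x \<in> \<Omega>")
    case False
    then show ?thesis using assms(1,2) by (simp add: P1_cont_0_def)
  next
    case True
    then have "x \<in> \<Union>\<T>" using union_T closure_subset by blast
    then obtain K where K: "K \<in> \<T>" "x \<in> K" by (elim UnionE)
    obtain p where p: "affine_fun p" "\<forall>x\<in>K. v x = p x"
      using assms(1) K(1) unfolding P1_cont_0_def poly_space_1 by blast
    obtain q where q: "affine_fun q" "\<forall>x\<in>K. w x = q x"
      using assms(2) K(1) unfolding P1_cont_0_def poly_space_1 by blast
    have "p = q"
    proof (rule affine_fun_eq_on_affine_basis[OF p(1) q(1) vert_T(3)[OF K(1)]])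
      show "affine hull (vert K) = UNIV" by (rule simplex_vertices_hull[OF vert_T(1)[OF K(1)]])
      fix a assume a: "a \<in> vert K"
      then have aK: "a \<in> K" using vert_T(4)[OF K(1)] by blast
      have "v a = w a"
      proof (cases "a \<in> \<Omega>")
        case True
        then show ?thesis using a K(1) by (intro eq) (auto simp: mesh_vertices_def vert_def)
      next
        case False
        then show ?thesis using assms(1,2) by (simp add: P1_cont_0_def)
      qed
      then show "p a = q a" using p(2) q(2) aK by simp
    qed
    then show ?thesis using p(2) q(2) K(2) by simp
  qed
qed

lemma averaging_ex1:
  "\<exists>!w. w \<in> vec_space (P1_cont_0 \<Omega> \<T>) \<and> (\<forall>a\<in>mesh_vertices \<T> \<inter> \<Omega>. w a = vertex_mean \<T> v a)"
proof -
  have "\<exists>w. w \<in> P1_cont_0 \<Omega> \<T> \<and> (\<forall>a\<in>mesh_vertices \<T> \<inter> \<Omega>. w a = vertex_mean \<T> v a $ i)" for i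
    by (rule nodal_interpolant_exists)
  then obtain w where w: "\<And>i. w i \<in> P1_cont_0 \<Omega> \<T>"
    "\<And>i a. a \<in> mesh_vertices \<T> \<inter> \<Omega> \<Longrightarrow> w i a = vertex_mean \<T> v a $ i" by metis
  show ?thesis
  proof (rule ex1I[of _ "\<lambda>x. \<chi> i. w i x"])
    show "(\<lambda>x. \<chi> i. w i x) \<in> vec_space (P1_cont_0 \<Omega> \<T>) \<and>
        (\<forall>a\<in>mesh_vertices \<T> \<inter> \<Omega>. (\<chi> i. w i a) = vertex_mean \<T> v a)"
      using w by (simp add: vec_space_def vec_eq_iff)
    fix w' assume w': "w' \<in> vec_space (P1_cont_0 \<Omega> \<T>) \<and>
        (\<forall>a\<in>mesh_vertices \<T> \<inter> \<Omega>. w' a = vertex_mean \<T> v a)"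
    have "(\<lambda>x. w' x $ i) = w i" for i
      by (rule nodal_values_unique) (use w w' in \<open>simp_all add: vec_space_def\<close>)
    then have "w' x $ i = w i x" for x i by (rule fun_cong)
    then show "w' = (\<lambda>x. \<chi> i. w i x)" by (simp add: fun_eq_iff vec_eq_iff)
  qed
qed

lemma averaging:
  shows "averaging \<Omega> \<T> v \<in> vec_space (P1_cont_0 \<Omega> \<T>)"
    and "\<And>a. a \<in> mesh_vertices \<T> \<inter> \<Omega> \<Longrightarrow> averaging \<Omega> \<T> v a = vertex_mean \<T> v a"
proof -
  have "averaging \<Omega> \<T> v \<in> vec_space (P1_cont_0 \<Omega> \<T>) \<and>
      (\<forall>a\<in>mesh_vertices \<T> \<inter> \<Omega>. averaging \<Omega> \<T> v a = vertex_mean \<T> v a)"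
    unfolding averaging_def by (rule theI'[OF averaging_ex1])
  then show "averaging \<Omega> \<T> v \<in> vec_space (P1_cont_0 \<Omega> \<T>)"
    and "\<And>a. a \<in> mesh_vertices \<T> \<inter> \<Omega> \<Longrightarrow> averaging \<Omega> \<T> v a = vertex_mean \<T> v a" by simp_all
qed

lemma vertex_mean_lincomb:
  assumes v: "\<And>i. (\<lambda>x. v x $ i) \<in> P_disc \<Omega> \<T> 1" and w: "\<And>i. (\<lambda>x. w x $ i) \<in> P_disc \<Omega> \<T> 1"
  shows "vertex_mean \<T> (\<lambda>x. s *\<^sub>R v x + t *\<^sub>R w x) a = s *\<^sub>R vertex_mean \<T> v a + t *\<^sub>R vertex_mean \<T> w a"
proof -
  have "(\<chi> i. on_elem (\<lambda>x. (s *\<^sub>R v x + t *\<^sub>R w x) $ i) K a) =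
      s *\<^sub>R (\<chi> i. on_elem (\<lambda>x. v x $ i) K a) + t *\<^sub>R (\<chi> i. on_elem (\<lambda>x. w x $ i) K a)"
    if "K \<in> \<T>" for K
    using on_elem_lincomb[OF v w that] by (simp add: vec_eq_iff)
  then have "(\<Sum>K | K \<in> \<T> \<and> a \<in> K. \<chi> i. on_elem (\<lambda>x. (s *\<^sub>R v x + t *\<^sub>R w x) $ i) K a) =
      s *\<^sub>R (\<Sum>K | K \<in> \<T> \<and> a \<in> K. \<chi> i. on_elem (\<lambda>x. v x $ i) K a) +
      t *\<^sub>R (\<Sum>K | K \<in> \<T> \<and> a \<in> K. \<chi> i. on_elem (\<lambda>x. w x $ i) K a)"
    by (simp add: scaleR_sum_right flip: sum.distrib)
  then show ?thesis unfolding vertex_mean_def by (simp add: scaleR_add_right mult.commute)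
qed

lemma averaging_lincomb:
  assumes "\<And>i. (\<lambda>x. v x $ i) \<in> P_disc \<Omega> \<T> 1" "\<And>i. (\<lambda>x. w x $ i) \<in> P_disc \<Omega> \<T> 1"
  shows "averaging \<Omega> \<T> (\<lambda>x. s *\<^sub>R v x + t *\<^sub>R w x) =
    (\<lambda>x. s *\<^sub>R averaging \<Omega> \<T> v x + t *\<^sub>R averaging \<Omega> \<T> w x)"
  unfolding averaging_def[of _ _ "\<lambda>x. s *\<^sub>R v x + t *\<^sub>R w x"]
proof (rule the1_equality[OF averaging_ex1], intro conjI ballI)
  show "(\<lambda>x. s *\<^sub>R averaging \<Omega> \<T> v x + t *\<^sub>R averaging \<Omega> \<T> w x) \<in> vec_space (P1_cont_0 \<Omega> \<T>)"
    by (rule vec_space_lincomb[OF P1_cont_0_lincomb averaging(1) averaging(1)])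
  show "s *\<^sub>R averaging \<Omega> \<T> v a + t *\<^sub>R averaging \<Omega> \<T> w a = vertex_mean \<T> (\<lambda>x. s *\<^sub>R v x + t *\<^sub>R w x) a"
    if "a \<in> mesh_vertices \<T> \<inter> \<Omega>" for a
    using averaging(2)[OF that] vertex_mean_lincomb[OF assms] by simp
qed

lemma L2_inner_vec_sum:
  assumes "g \<in> vec_space (L2 \<Omega>)" "v \<in> vec_space (L2 \<Omega>)"
  shows "L2_inner_vec \<Omega> g v = (\<Sum>i\<in>UNIV. L2_inner \<Omega> (\<lambda>x. g x $ i) (\<lambda>x. v x $ i))"
  unfolding L2_inner_vec_def L2_inner_def inner_vec_def inner_real_def
  using assms by (intro Bochner_Integration.integral_sum L2_mult_integrable) (simp_all add: vec_space_def)

text \<open>Linearity of the right-hand side. The functional itself is linear on \<open>H\<^sup>1\<^sub>0\<close> only, which is where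
  the averaging operator takes its values.\<close>

lemma rhs_form_linear:
  assumes f: "f \<in> Hminus1 \<Omega>"
  shows "linear_form_on (CR_space \<Omega> \<T>) (rhs_form \<Omega> \<T> f)"
  unfolding linear_form_on_def
proof (intro ballI allI)
  fix x y s t assume xy: "x \<in> CR_space \<Omega> \<T>" "y \<in> CR_space \<Omega> \<T>"
  have P: "(\<lambda>z. fst x z $ i) \<in> P_disc \<Omega> \<T> 1" "(\<lambda>z. fst y z $ i) \<in> P_disc \<Omega> \<T> 1" for i
    using CR_space_P1[OF xy(1)] CR_space_P1[OF xy(2)] by simp_all
  have L: "(\<lambda>z. fst x z $ i) \<in> L2 \<Omega>" "(\<lambda>z. fst y z $ i) \<in> L2 \<Omega>" for i
    by (rule P_disc_L2[OF P(1)], rule P_disc_L2[OF P(2)])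
  have fl: "fst (lincomb s x t y) = (\<lambda>z. s *\<^sub>R fst x z + t *\<^sub>R fst y z)" by (simp add: lincomb_def)
  show "rhs_form \<Omega> \<T> f (lincomb s x t y) = s * rhs_form \<Omega> \<T> f x + t * rhs_form \<Omega> \<T> f y"
  proof (cases "\<exists>g. L2_represents \<Omega> g f")
    case True
    define g where "g = (SOME g. L2_represents \<Omega> g f)"
    have "L2_represents \<Omega> g f" unfolding g_def by (rule someI_ex[OF True])
    then have g: "g \<in> vec_space (L2 \<Omega>)" by (simp add: L2_represents_def)
    then have gi: "(\<lambda>z. g z $ i) \<in> L2 \<Omega>" for i by (simp add: vec_space_def)
    have v: "fst x \<in> vec_space (L2 \<Omega>)" "fst y \<in> vec_space (L2 \<Omega>)"
      "(\<lambda>z. s *\<^sub>R fst x z + t *\<^sub>R fst y z) \<in> vec_space (L2 \<Omega>)"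
      using L by (simp_all add: vec_space_def L2_lincomb)
    have r: "rhs_form \<Omega> \<T> f z = L2_inner_vec \<Omega> g (fst z)" for z
      using True by (simp add: rhs_form_def g_def)
    show ?thesis
      unfolding r fl L2_inner_vec_sum[OF g v(1)] L2_inner_vec_sum[OF g v(2)] L2_inner_vec_sum[OF g v(3)]
      by (simp add: L2_inner_lincomb[OF gi L] sum.distrib sum_distrib_left)
  next
    case False
    have r: "rhs_form \<Omega> \<T> f z = f (averaging \<Omega> \<T> (fst z))" for z
      using False by (simp add: rhs_form_def)
    have H: "averaging \<Omega> \<T> v \<in> vec_space (H10 \<Omega>)" for v
      using averaging(1)[of v] P1_cont_0_subset_H10 by (simp add: vec_space_def)
    have lin: "\<forall>v\<in>vec_space (H10 \<Omega>). \<forall>w\<in>vec_space (H10 \<Omega>). \<forall>a b.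
        f (\<lambda>x. a *\<^sub>R v x + b *\<^sub>R w x) = a * f v + b * f w"
      using f unfolding Hminus1_def by (elim CollectE conjE)
    show ?thesis
      unfolding r fl averaging_lincomb[OF P] using lin H[of "fst x"] H[of "fst y"] by simp
  qed
qed

end

section \<open>The discrete Stokes form\<close>

context mesh
begin

lemma CR_lincomb_comp:
  "(\<lambda>z. fst (lincomb s x t y) z $ i) = (\<lambda>z. s * fst x z $ i + t * fst y z $ i)"
  "snd (lincomb s x t y) = (\<lambda>z. s * snd x z + t * snd y z)"
  by (simp_all add: lincomb_def)

lemma elem_grad_lincomb_CR:
  assumes "x \<in> CR_space \<Omega> \<T>" "y \<in> CR_space \<Omega> \<T>" "K \<in> \<T>"
  shows "elem_grad (\<lambda>z. fst (lincomb s x t y) z $ i) K =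
    s *\<^sub>R elem_grad (\<lambda>z. fst x z $ i) K + t *\<^sub>R elem_grad (\<lambda>z. fst y z $ i) K"
  unfolding CR_lincomb_comp by (rule elem_grad_lincomb[OF CR_space_P1[OF assms(1)] CR_space_P1[OF assms(2)] assms(3)])

lemma h_inner_CR:
  assumes "x \<in> CR_space \<Omega> \<T>" "y \<in> CR_space \<Omega> \<T>"
  shows "h_inner \<T> (fst x) (fst y) = (\<Sum>K\<in>\<T>. measure lebesgue K *
    (\<Sum>i\<in>UNIV. elem_grad (\<lambda>z. fst x z $ i) K \<bullet> elem_grad (\<lambda>z. fst y z $ i) K))"
  by (rule h_inner_eq[OF CR_space_P1[OF assms(1)] CR_space_P1[OF assms(2)]])

lemma div_h_CR:
  assumes "x \<in> CR_space \<Omega> \<T>" "y \<in> CR_space \<Omega> \<T>"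
  shows "div_h \<T> (fst x) (snd y) = (\<Sum>K\<in>\<T>. measure lebesgue K * snd y (inner_point K) *
    (\<Sum>i\<in>UNIV. elem_grad (\<lambda>z. fst x z $ i) K $ i))"
  by (rule div_h_eq[OF CR_space_P1[OF assms(1)] Q_CR_P0[OF CR_space_Q[OF assms(2)]]])

lemma h_inner_linear:
  assumes "x \<in> CR_space \<Omega> \<T>" "y \<in> CR_space \<Omega> \<T>" "z \<in> CR_space \<Omega> \<T>"
  shows "h_inner \<T> (fst x) (fst (lincomb s y t z)) =
    s * h_inner \<T> (fst x) (fst y) + t * h_inner \<T> (fst x) (fst z)"
  unfolding h_inner_CR[OF assms(1) CR_space_lincomb[OF assms(2,3)]] h_inner_CR[OF assms(1,2)] h_inner_CR[OF assms(1,3)]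
  using elem_grad_lincomb_CR[OF assms(2,3)]
  by (simp add: inner_add_right sum.distrib sum_distrib_left distrib_left mult.left_commute)

lemma h_inner_commute:
  assumes "x \<in> CR_space \<Omega> \<T>" "y \<in> CR_space \<Omega> \<T>"
  shows "h_inner \<T> (fst x) (fst y) = h_inner \<T> (fst y) (fst x)"
  unfolding h_inner_CR[OF assms] h_inner_CR[OF assms(2,1)] by (simp add: inner_commute)

lemma h_inner_nonneg:
  assumes "x \<in> CR_space \<Omega> \<T>"
  shows "h_inner \<T> (fst x) (fst x) \<ge> 0"
  unfolding h_inner_CR[OF assms assms] by (intro sum_nonneg mult_nonneg_nonneg) auto

lemma h_inner_definite:
  assumes x: "x \<in> CR_space \<Omega> \<T>" and z: "h_inner \<T> (fst x) (fst x) = 0"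
  shows "fst x = (\<lambda>z. 0)"
proof -
  have "(\<lambda>z. fst x z $ i) = (\<lambda>z. 0)" for i
  proof (rule broken_gradient_injective[OF CR_space_comp[OF x]])
    fix K assume K: "K \<in> \<T>"
    have "measure lebesgue K * (\<Sum>i\<in>UNIV. elem_grad (\<lambda>z. fst x z $ i) K \<bullet> elem_grad (\<lambda>z. fst x z $ i) K) = 0"
      using z K finite_T unfolding h_inner_CR[OF x x]
      by (subst (asm) sum_nonneg_eq_0_iff) (auto intro!: mult_nonneg_nonneg sum_nonneg)
    then have "(\<Sum>i\<in>UNIV. elem_grad (\<lambda>z. fst x z $ i) K \<bullet> elem_grad (\<lambda>z. fst x z $ i) K) = 0"
      using vol_pos[OF K] by simp
    then show "elem_grad (\<lambda>z. fst x z $ i) K = 0"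
      by (subst (asm) sum_nonneg_eq_0_iff) auto
  qed
  then have "fst x z $ i = 0" for z i by (rule fun_cong)
  then show ?thesis by (simp add: fun_eq_iff vec_eq_iff)
qed

lemma div_h_linear_left:
  assumes "x \<in> CR_space \<Omega> \<T>" "y \<in> CR_space \<Omega> \<T>" "z \<in> CR_space \<Omega> \<T>"
  shows "div_h \<T> (fst (lincomb s x t y)) (snd z) =
    s * div_h \<T> (fst x) (snd z) + t * div_h \<T> (fst y) (snd z)"
  unfolding div_h_CR[OF CR_space_lincomb[OF assms(1,2)] assms(3)] div_h_CR[OF assms(1,3)] div_h_CR[OF assms(2,3)]
  using elem_grad_lincomb_CR[OF assms(1,2)]
  by (simp add: sum.distrib sum_distrib_left distrib_left mult.left_commute)

lemma div_h_linear_right: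
  assumes "x \<in> CR_space \<Omega> \<T>" "y \<in> CR_space \<Omega> \<T>" "z \<in> CR_space \<Omega> \<T>"
  shows "div_h \<T> (fst x) (snd (lincomb s y t z)) =
    s * div_h \<T> (fst x) (snd y) + t * div_h \<T> (fst x) (snd z)"
  unfolding div_h_CR[OF assms(1) CR_space_lincomb[OF assms(2,3)]] div_h_CR[OF assms(1,2)] div_h_CR[OF assms(1,3)]
  by (simp add: CR_lincomb_comp(2) sum.distrib sum_distrib_left distrib_left distrib_right mult_ac)

lemma L2_inner_definite:
  assumes q: "q \<in> P_disc \<Omega> \<T> 0" and z: "L2_inner \<Omega> q q = 0"
  shows "q = (\<lambda>x. 0)"
proof -
  have qL: "q \<in> L2 \<Omega>" by (rule P_disc_L2[OF q])
  have om: "\<Omega> \<in> sets lebesgue" using open_dom by simp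
  have "AE x in lebesgue_on \<Omega>. q x * q x = 0"
    using z unfolding L2_inner_def
    by (subst (asm) integral_nonneg_eq_0_iff_AE[OF L2_mult_integrable[OF qL qL]]) auto
  then have "AE x in lebesgue. x \<in> \<Omega> \<longrightarrow> q x = 0"
    using om by (subst (asm) AE_restrict_space_iff) auto
  then obtain Z where Z: "Z \<in> null_sets lebesgue" "\<And>x. x \<in> \<Omega> \<Longrightarrow> q x \<noteq> 0 \<Longrightarrow> x \<in> Z"
    by (auto simp: eventually_ae_filter subset_iff)
  have qK: "q (inner_point K) = 0" if K: "K \<in> \<T>" for K
  proof (rule ccontr)
    assume nz: "q (inner_point K) \<noteq> 0"
    have "interior K \<subseteq> Z"
    proof
      fix x assume x: "x \<in> interior K"
      have "q x \<noteq> 0" using P_disc_0_const[OF q K x] nz by simp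
      then show "x \<in> Z" by (rule Z(2)[OF subsetD[OF T_interior_subset[OF K] x]])
    qed
    then have "negligible (interior K)"
      using Z(1) negligible_subset by (simp add: negligible_iff_null_sets)
    then show False using open_not_negligible[OF open_interior T_interior_ne[OF K]] by simp
  qed
  show ?thesis by (rule P_disc_eq_0I[OF q]) (simp add: P_disc_0_const[OF q] qK)
qed

lemma mixed_eq_0I: "fst x = (\<lambda>z. 0) \<Longrightarrow> snd x = (\<lambda>z. 0) \<Longrightarrow> (x :: 'n mixed) = 0"
  by (simp add: prod_eq_iff zero_fun_def)

text \<open>The values of a velocity at the vertices of every element, taken from inside the element, and
  those of a pressure at inner points. These finitely many functionals separate points, which
  expresses that the space is finite-dimensional.\<close>

definition dof :: "('n mixed \<Rightarrow> real) set" where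
  "dof = (\<Union>K\<in>\<T>. \<Union>i\<in>UNIV. \<Union>a\<in>vert K. {\<lambda>x. on_elem (\<lambda>z. fst x z $ i) K a}) \<union>
     (\<Union>K\<in>\<T>. {\<lambda>x. snd x (inner_point K)})"

lemma finite_dof: "finite dof"
  unfolding dof_def using finite_T vert_T(3) by auto

lemma dof_linear: "l \<in> dof \<Longrightarrow> linear_form_on (CR_space \<Omega> \<T>) l"
  unfolding linear_form_on_def
proof (intro ballI allI)
  fix x y s t assume l: "l \<in> dof" and xy: "x \<in> CR_space \<Omega> \<T>" "y \<in> CR_space \<Omega> \<T>"
  from l consider K i a where "K \<in> \<T>" "l = (\<lambda>x. on_elem (\<lambda>z. fst x z $ i) K a)"
    | K where "K \<in> \<T>" "l = (\<lambda>x. snd x (inner_point K))"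
    unfolding dof_def by blast
  then show "l (lincomb s x t y) = s * l x + t * l y"
  proof cases
    case 1
    then show ?thesis
      using on_elem_lincomb[OF CR_space_P1[OF xy(1)] CR_space_P1[OF xy(2)] 1(1)]
      by (simp add: CR_lincomb_comp)
  next
    case 2
    then show ?thesis by (simp add: CR_lincomb_comp)
  qed
qed

lemma dof_separate:
  assumes x: "x \<in> CR_space \<Omega> \<T>" and z: "\<And>l. l \<in> dof \<Longrightarrow> l x = 0"
  shows "x = 0"
proof (rule mixed_eq_0I)
  have 1: "on_elem (\<lambda>z. fst x z $ i) K = (\<lambda>z. 0)" if K: "K \<in> \<T>" for K i
  proof (rule affine_fun_eq_on_affine_basis[OF on_elem(1)[OF CR_space_P1[OF x] K] affine_fun_const
        vert_T(3)[OF K] simplex_vertices_hull[OF vert_T(1)[OF K]]])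
    fix a assume a: "a \<in> vert K"
    have "(\<lambda>x. on_elem (\<lambda>z. fst x z $ i) K a) \<in> dof" unfolding dof_def using K a by blast
    from z[OF this] show "on_elem (\<lambda>z. fst x z $ i) K a = 0" .
  qed
  have "(\<lambda>z. fst x z $ i) = (\<lambda>z. 0)" for i
  proof (rule P_disc_eq_0I[OF CR_space_P1[OF x]])
    show "fst x y $ i = 0" if "K \<in> \<T>" "y \<in> interior K" for K y
      using on_elem(2)[OF CR_space_P1[OF x] that, of i] 1[OF that(1), of i] by simp
  qed
  then have "fst x y $ i = 0" for y i by (rule fun_cong)
  then show "fst x = (\<lambda>z. 0)" by (simp add: fun_eq_iff vec_eq_iff)
  have 2: "snd x (inner_point K) = 0" if K: "K \<in> \<T>" for K
  proof -
    have "(\<lambda>x. snd x (inner_point K)) \<in> dof" unfolding dof_def using K by blast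
    from z[OF this] show ?thesis .
  qed
  note q = Q_CR_P0[OF CR_space_Q[OF x]]
  show "snd x = (\<lambda>z. 0)"
    by (rule P_disc_eq_0I[OF q]) (simp add: P_disc_0_const[OF q] 2)
qed

text \<open>The inner product behind the norm of the product space, without the weight \<open>1/\<nu>\<close>.\<close>

definition CR_inner :: "'n mixed \<Rightarrow> 'n mixed \<Rightarrow> real" where
  "CR_inner x y = h_inner \<T> (fst x) (fst y) + L2_inner \<Omega> (snd x) (snd y)"

text \<open>Testing with \<open>(u, - p)\<close> removes both divergence terms and gives \<open>u = 0\<close>; then \<open>p\<close> is orthogonal to all
  discrete divergences.\<close>

lemma a_S_nondegenerate:
  assumes nu: "\<nu> > 0" and x: "x \<in> CR_space \<Omega> \<T>"
    and z: "\<And>y. y \<in> CR_space \<Omega> \<T> \<Longrightarrow> a_S \<nu> \<T> x y = 0"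
  shows "x = 0"
proof (rule mixed_eq_0I)
  have Q0: "(\<lambda>z. 0) \<in> Q_CR \<Omega> \<T>" using Q_CR_lincomb[OF CR_space_Q[OF x] CR_space_Q[OF x], of 0 0] by simp
  have V: "fst x \<in> vec_space (X0_CR \<Omega> \<T>)" using x by (simp add: CR_space_def mem_Times_iff)
  define y where "y = (fst x, \<lambda>z. - snd x z)"
  have yC: "y \<in> CR_space \<Omega> \<T>"
    using V Q_CR_lincomb[OF CR_space_Q[OF x] CR_space_Q[OF x], of "-1" 0] by (simp add: CR_space_def y_def)
  have "div_h \<T> (fst x) (snd y) = - div_h \<T> (fst x) (snd x)"
    unfolding div_h_CR[OF x yC] div_h_CR[OF x x] by (simp add: y_def sum_negf)
  then have "\<nu> * h_inner \<T> (fst x) (fst x) = 0"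
    using z[OF yC] by (simp add: a_S_def y_def)
  then have "h_inner \<T> (fst x) (fst x) = 0" using nu by simp
  then show u: "fst x = (\<lambda>z. 0)" by (rule h_inner_definite[OF x])
  show "snd x = (\<lambda>z. 0)"
  proof (rule div_h_orthogonal_eq_0[OF CR_space_Q[OF x]])
    fix v assume "v \<in> vec_space (X0_CR \<Omega> \<T>)"
    then have w: "(v, \<lambda>z. 0) \<in> CR_space \<Omega> \<T>" using Q0 by (simp add: CR_space_def)
    have "elem_grad (\<lambda>z. fst x z $ i) K = 0" if "K \<in> \<T>" for i K
      using on_elem_unique[OF that affine_fun_const[of 0], of "\<lambda>z. 0"] elem_grad_eq[of "\<lambda>z. 0" K 0 0] by (simp add: u)
    then have "h_inner \<T> (fst x) v = 0" "div_h \<T> (fst x) (\<lambda>z. 0) = 0"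
      using h_inner_CR[OF x w] div_h_CR[OF x w] by simp_all
    then show "div_h \<T> v (snd x) = 0" using z[OF w] by (simp add: a_S_def)
  qed
qed

lemma a_S_commute:
  assumes "x \<in> CR_space \<Omega> \<T>" "y \<in> CR_space \<Omega> \<T>"
  shows "a_S \<nu> \<T> x y = a_S \<nu> \<T> y x"
  using h_inner_commute[OF assms] by (simp add: a_S_def)

lemma a_S_linear: "x \<in> CR_space \<Omega> \<T> \<Longrightarrow> linear_form_on (CR_space \<Omega> \<T>) (a_S \<nu> \<T> x)"
  unfolding linear_form_on_def a_S_def
  by (intro ballI allI) (simp add: h_inner_linear div_h_linear_left div_h_linear_right algebra_simps)

lemma CR_inner_facts:
  shows "\<And>x. x \<in> CR_space \<Omega> \<T> \<Longrightarrow> linear_form_on (CR_space \<Omega> \<T>) (CR_inner x)"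
    and "\<And>x y. x \<in> CR_space \<Omega> \<T> \<Longrightarrow> y \<in> CR_space \<Omega> \<T> \<Longrightarrow> CR_inner x y = CR_inner y x"
    and "\<And>x. x \<in> CR_space \<Omega> \<T> \<Longrightarrow> CR_inner x x \<ge> 0"
    and "\<And>x. x \<in> CR_space \<Omega> \<T> \<Longrightarrow> CR_inner x x = 0 \<Longrightarrow> x = 0"
proof -
  note QL = Q_CR_L2[OF CR_space_Q]
  fix x assume x: "x \<in> CR_space \<Omega> \<T>"
  show "linear_form_on (CR_space \<Omega> \<T>) (CR_inner x)"
    unfolding linear_form_on_def CR_inner_def
    by (intro ballI allI)
      (simp add: h_inner_linear x CR_lincomb_comp(2) L2_inner_lincomb QL algebra_simps)
  show "CR_inner x y = CR_inner y x" if "y \<in> CR_space \<Omega> \<T>" for y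
    unfolding CR_inner_def using h_inner_commute[OF x that] L2_inner_commute by metis
  note n = h_inner_nonneg[OF x] L2_inner_nonneg[of \<Omega> "snd x"]
  show "CR_inner x x \<ge> 0" unfolding CR_inner_def using n by linarith
  show "x = 0" if "CR_inner x x = 0"
  proof (rule mixed_eq_0I)
    have 0: "h_inner \<T> (fst x) (fst x) = 0" "L2_inner \<Omega> (snd x) (snd x) = 0"
      using n that unfolding CR_inner_def by linarith+
    show "fst x = (\<lambda>z. 0)" by (rule h_inner_definite[OF x 0(1)])
    show "snd x = (\<lambda>z. 0)" by (rule L2_inner_definite[OF Q_CR_P0[OF CR_space_Q[OF x]] 0(2)])
  qed
qed

lemma CR_norm_equiv:
  assumes nu: "\<nu> > 0" and x: "x \<in> CR_space \<Omega> \<T>"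
  shows "CR_norm \<nu> \<Omega> \<T> x \<ge> 0"
    and "CR_norm \<nu> \<Omega> \<T> x \<le> (1 + \<nu> + inverse \<nu>) * sqrt (CR_inner x x)"
    and "sqrt (CR_inner x x) \<le> (1 + \<nu> + inverse \<nu>) * CR_norm \<nu> \<Omega> \<T> x"
proof -
  define A where "A = sqrt (h_inner \<T> (fst x) (fst x))"
  define B where "B = sqrt (L2_inner \<Omega> (snd x) (snd x))"
  define S where "S = sqrt (CR_inner x x)"
  note n = h_inner_nonneg[OF x] L2_inner_nonneg[of \<Omega> "snd x"]
  have AB: "A \<ge> 0" "B \<ge> 0" using n by (simp_all add: A_def B_def)
  have N: "CR_norm \<nu> \<Omega> \<T> x = A + inverse \<nu> * B"
    by (simp add: CR_norm_def h_norm_def L2_norm_def A_def B_def)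
  have iv: "inverse \<nu> > 0" using nu by simp
  show "CR_norm \<nu> \<Omega> \<T> x \<ge> 0" using AB iv by (simp add: N)
  have S: "A \<le> S" "B \<le> S" "S \<le> A + B"
    using n sqrt_add_le_add_sqrt[OF n] by (simp_all add: A_def B_def S_def CR_inner_def)
  have "A + inverse \<nu> * B \<le> S + inverse \<nu> * S"
    using S iv by (intro add_mono mult_left_mono) auto
  also have "\<dots> \<le> (1 + \<nu> + inverse \<nu>) * S"
    using AB S nu by (simp add: algebra_simps)
  finally show "CR_norm \<nu> \<Omega> \<T> x \<le> (1 + \<nu> + inverse \<nu>) * sqrt (CR_inner x x)"
    by (simp add: N S_def)
  have "0 \<le> \<nu> * A" "0 \<le> inverse \<nu> * A" "0 \<le> inverse \<nu> * B" "0 \<le> inverse \<nu> * (inverse \<nu> * B)" "\<nu> * (inverse \<nu> * B) = B"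
    using AB nu iv by simp_all
  then have "A + B \<le> (1 + \<nu> + inverse \<nu>) * (A + inverse \<nu> * B)"
    unfolding distrib_left distrib_right mult_1 by linarith
  then show "sqrt (CR_inner x x) \<le> (1 + \<nu> + inverse \<nu>) * CR_norm \<nu> \<Omega> \<T> x"
    using S(3) by (simp add: N S_def)
qed

lemma CR_space_ne: "CR_space \<Omega> \<T> \<noteq> {}"
proof -
  have L2: "(\<lambda>x. 0) \<in> L2 \<Omega>" by (simp add: L2_def)
  have z: "(\<lambda>x. 0) \<in> P_disc \<Omega> \<T> 0" "(\<lambda>x. 0) \<in> P_disc \<Omega> \<T> 1"
    using L2 affine_fun_const[of 0] by (auto simp: P_disc_def poly_space_0 poly_space_Suc_0 intro!: bexI[of _ "\<lambda>x. 0"])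
  have "(\<lambda>x. 0) \<in> Q_CR \<Omega> \<T>" using z L2 by (simp add: Q_CR_def L2_zmv_def)
  moreover have e: "on_elem (\<lambda>x. 0) K = (\<lambda>x. 0)" if "K \<in> \<T>" for K
    using that affine_fun_const by (intro on_elem_unique) auto
  have "(\<lambda>x. 0) \<in> X0_CR \<Omega> \<T>" unfolding X0_CR_iff using z(2) by (simp add: e)
  then have "(\<lambda>x. 0) \<in> vec_space (X0_CR \<Omega> \<T>)" by (simp add: vec_space_def)
  ultimately have "((\<lambda>x. 0), (\<lambda>x. 0)) \<in> CR_space \<Omega> \<T>" by (simp add: CR_space_def)
  then show ?thesis by blast
qed

theorem discrete_stokes:
  assumes nu: "\<nu> > 0"
  shows "continuous_bilinear_form (CR_space \<Omega> \<T>) (CR_norm \<nu> \<Omega> \<T>) (a_S \<nu> \<T>)"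
    and "T_coercive (CR_space \<Omega> \<T>) (CR_norm \<nu> \<Omega> \<T>) (a_S \<nu> \<T>)"
    and "well_posed (CR_space \<Omega> \<T>) (CR_norm \<nu> \<Omega> \<T>) (a_S \<nu> \<T>)"
    and "\<And>l. linear_form_on (CR_space \<Omega> \<T>) l \<Longrightarrow>
      continuous_linear_form (CR_space \<Omega> \<T>) (CR_norm \<nu> \<Omega> \<T>) l"
proof -
  note facts = CR_space_ne CR_space_lincomb finite_dof dof_linear CR_inner_facts(1,2,3)
    CR_norm_equiv[OF nu] a_S_linear a_S_commute
  note main = nondegenerate_form_well_posed[where X = "CR_space \<Omega> \<T>" and L = dof and b = CR_inner
    and N = "CR_norm \<nu> \<Omega> \<T>" and C = "1 + \<nu> + inverse \<nu>" and a = "a_S \<nu> \<T>"]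
  note definite = dof_separate CR_inner_facts(4) a_S_nondegenerate[OF nu]
  show "continuous_bilinear_form (CR_space \<Omega> \<T>) (CR_norm \<nu> \<Omega> \<T>) (a_S \<nu> \<T>)"
    by (rule main(1); (rule facts; assumption)?; (rule definite; simp)?)
  show "T_coercive (CR_space \<Omega> \<T>) (CR_norm \<nu> \<Omega> \<T>) (a_S \<nu> \<T>)"
    by (rule main(2); (rule facts; assumption)?; (rule definite; simp)?)
  show "well_posed (CR_space \<Omega> \<T>) (CR_norm \<nu> \<Omega> \<T>) (a_S \<nu> \<T>)"
    by (rule main(3); (rule facts; assumption)?; (rule definite; simp)?)
  show "continuous_linear_form (CR_space \<Omega> \<T>) (CR_norm \<nu> \<Omega> \<T>) l"
    if l: "linear_form_on (CR_space \<Omega> \<T>) l" for l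
    by (rule main(4); (rule facts l; assumption)?; (rule definite; simp)?)
qed

end

section \<open>Well-posedness of the discrete Stokes problem\<close>

theorem theorem5:
  fixes \<nu> :: real and \<Omega> :: "(real^'n) set" and \<T> :: "(real^'n) set set"
  assumes dim: "CARD('n) \<in> {2, 3}"
    and dom: "admissible_domain \<Omega>"
    and mesh: "simplicial_mesh \<Omega> \<T>"
    and nu: "\<nu> > 0"
  shows "continuous_bilinear_form (CR_space \<Omega> \<T>) (CR_norm \<nu> \<Omega> \<T>) (a_S \<nu> \<T>)
    \<and> T_coercive (CR_space \<Omega> \<T>) (CR_norm \<nu> \<Omega> \<T>) (a_S \<nu> \<T>)
    \<and> well_posed (CR_space \<Omega> \<T>) (CR_norm \<nu> \<Omega> \<T>) (a_S \<nu> \<T>)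
    \<and> (\<forall>f\<in>Hminus1 \<Omega>.
         continuous_linear_form (CR_space \<Omega> \<T>) (CR_norm \<nu> \<Omega> \<T>) (rhs_form \<Omega> \<T> f) \<and>
         (\<exists>!x. is_solution (CR_space \<Omega> \<T>) (a_S \<nu> \<T>) (rhs_form \<Omega> \<T> f) x))"
proof -
  interpret mesh \<Omega> \<T>
    using dom mesh by unfold_locales (auto simp: admissible_domain_def)
  have "continuous_linear_form (CR_space \<Omega> \<T>) (CR_norm \<nu> \<Omega> \<T>) (rhs_form \<Omega> \<T> f)"
    if "f \<in> Hminus1 \<Omega>" for f
    by (rule discrete_stokes(4)[OF nu rhs_form_linear[OF that]])
  then show ?thesis
    using discrete_stokes(1-3)[OF nu] unfolding well_posed_def by simp
qed

end
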